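(* Let $T>0$ be fixed and let $a\in\mathbb{R}^d$ be an arbitrary (but known) vector. Consider the bi-objective optimization problem $$\min_{b_T,c_T,u_t}\Big(\mathsf{E}\big[|\mathsf{E}[\bar S_T|\mathcal{Z}_T]-a^\top X_T|^2\big],\ \mathsf{E}\big[|\mathsf{E}[\bar S_T^{\,2}|\mathcal{Z}_T]-(a^\top X_T)^2|^2\big]\Big)$$ over the filter parameters $b_T,c_T\in\mathbb{R}^d$ and $u:[0,T]\to\mathbb{R}^m$ (written $u_t$), subject to the constraints $$dX_t=A_tX_t\,dt+dB_t,\quad X_0\sim\mathcal{N}(m_0,\Sigma_0),\qquad dZ_t=C_tX_t\,dt+dW_t,$$ $$\bar S_T=b_T^\top m_0+c_T^\top(\bar X_0-m_0)+\int_0^T u_t^\top\,dZ_t,\quad \bar X_0\sim\mathcal{N}(m_0,\Sigma_0).$$ Its solution is as follows: $$b_T=\Phi(0;T)a,\qquad c_T=\Psi(0;T)a,\qquad u_t=\mathsf{K}_t^\top\Phi(t;T)a.$$ The solution for $c_T$ is unique up to a sign for the scalar ($d=1$) case but it is not unique for the vector ($d>1$) case. Using these optimal parameters, the estimator is $$\bar S_T=a^\top\Big(\Phi^\top(0;T)m_0+\Psi^\top(0;T)(\bar X_0-m_0)+\int_0^T\Phi^\top(t;T)\mathsf{K}_t\,dZ_t\Big),\quad \bar X_0\sim\mathcal{N}(m_0,\Sigma_0).$$ This estimator is exact. That is, $$\mathsf{E}(g(\bar S_T)|\mathcal{Z}_T)=\mathsf{E}(g(a^\top X_T)|\mathcal{Z}_T)$$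 for all smooth test functions $g$ and vectors $a\in\mathbb{R}^d$.
   Context: Model: $X_t\in\mathbb{R}^d$ is the hidden state at time $t$ and $Z_t\in\mathbb{R}^m$ is the observation. $A_t$ and $C_t$ are matrices of appropriate dimension ($d\times d$ and $m\times d$) whose elements are continuous in $t$. $\{B_t\}$ and $\{W_t\}$ are Wiener processes taking values in $\mathbb{R}^d$ and $\mathbb{R}^m$, with associated covariances $Q_t$ and $R_t$ respectively. The covariance matrices $Q_t$, $R_t$ and $\Sigma_0$ are strictly positive definite for all $t$; $m_0\in\mathbb{R}^d$. The noise processes $\{B_t\}$, $\{W_t\}$ and the initial conditions $X_0$, $\bar X_0$ are all mutually independent. $\mathcal{Z}_t:=\sigma(Z_s;s\in[0,t])$ is the filtration generated by the observations. Notation: $\Sigma_t$ is the solution of the dynamic Riccati equation $$\frac{d\Sigma_t}{dt}=A_t\Sigma_t+\Sigma_tA_t^\top+Q_t-\Sigma_tC_t^\top R_t^{-1}C_t\Sigma_t$$ with initial condition $\Sigma_0$, and $\mathsf{K}_t:=\Sigma_tC_t^\top R_t^{-1}$ is the Kalman gain. The state transition matrices $\Phi(t;\tau)$ and $\Psi(t;\tau)$ are defined by $$\frac{d\Phi}{dt}(t;\tau)=\big(-A_t^\top+C_t^\top\mathsf{K}_t^\top\big)\Phi(t;\tau),\qquad \frac{d\Psi}{dt}(t;\tau)=\big(-A_t^\top+\tfrac12C_t^\top\mathsf{K}_t^\top-\tfrac12\Sigma_t^{-1}Q_t\big)\Psi(t;\tau),$$ with $\Phi(\tau;\tau)=\Psi(\tau;\tau)=I$,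 the identity matrix. $\Phi^\top(t;\tau)$ and $\Psi^\top(t;\tau)$ denote the transposes of $\Phi(t;\tau)$ and $\Psi(t;\tau)$.
   Formalization: Non-uniqueness of c_T in the vector case d>1 is asserted only for a≠0; for a=0 it fails, since c_T=0 and any solution must satisfy c^TΣ_0c=0, so c=0 is the only solution. *)

theory Defs
  imports "HOL-Probability.Probability"
begin

definition posdef :: "real ^ 'n ^ 'n \<Rightarrow> bool" where
  "posdef S \<longleftrightarrow> transpose S = S \<and> (\<forall>v. v \<noteq> 0 \<longrightarrow> 0 < v \<bullet> (S *v v))"

definition smooth :: "(real \<Rightarrow> real) \<Rightarrow> bool" where
  "smooth g \<longleftrightarrow> (\<forall>k. (deriv ^^ k) g differentiable_on UNIV)"


subsection \<open>Gaussian vectors and Wiener processes\<close>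

text \<open>The parameter \<open>v\<close> is the variance. \<^const>\<open>normal_density\<close> is parametrised by the
  standard deviation and vanishes identically when that is \<open>0\<close>, hence the case distinction.\<close>

definition normal_law :: "real \<Rightarrow> real \<Rightarrow> real measure" where
  "normal_law \<mu> v =
    (if v = 0 then return borel \<mu> else density lborel (\<lambda>x. ennreal (normal_density \<mu> (sqrt v) x)))"

text \<open>\<open>X \<sim> N(m, S)\<close>: every linear functional of \<open>X\<close> is a (possibly degenerate) normal variable.\<close>

definition gaussian_vector ::
    "'a measure \<Rightarrow> ('a \<Rightarrow> real ^ 'n) \<Rightarrow> real ^ 'n \<Rightarrow> real ^ 'n ^ 'n \<Rightarrow> bool" where
  "gaussian_vector M X m S \<longleftrightarrow>
    X \<in> borel_measurable M \<and>
    (\<forall>v. distr M borel (\<lambda>\<omega>. v \<bullet> X \<omega>) = normal_law (v \<bullet> m) (v \<bullet> (S *v v)))"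

definition generated_algebra ::
    "'a measure \<Rightarrow> (real \<Rightarrow> 'a \<Rightarrow> 'b::topological_space) \<Rightarrow> real set \<Rightarrow> 'a measure" where
  "generated_algebra M X I =
    sigma (space M) {X t -` A \<inter> space M | t A. t \<in> I \<and> A \<in> sets borel}"

text \<open>The matrix \<open>Q t\<close> is the covariance rate, \<open>E[dB dB\<^sup>T] = Q t dt\<close>, so that the increment
  over \<open>[s, t]\<close> has covariance \<open>\<integral>\<^sub>s\<^sup>t Q\<close>. No continuity of \<open>Q\<close> is required.\<close>

definition wiener_process ::
    "'a measure \<Rightarrow> (real \<Rightarrow> 'a \<Rightarrow> real ^ 'n) \<Rightarrow> (real \<Rightarrow> real ^ 'n ^ 'n) \<Rightarrow> bool" where
  "wiener_process M B Q \<longleftrightarrow>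
    (\<forall>t\<ge>0. B t \<in> borel_measurable M) \<and>
    (\<forall>t\<ge>0. Q absolutely_integrable_on {0..t}) \<and>
    (AE \<omega> in M. B 0 \<omega> = 0 \<and> continuous_on {0..} (\<lambda>t. B t \<omega>)) \<and>
    (\<forall>s t. 0 \<le> s \<and> s \<le> t \<longrightarrow>
      prob_space.indep_set M
        (sets (generated_algebra M B {0..s}))
        (sets (vimage_algebra (space M) (\<lambda>\<omega>. B t \<omega> - B s \<omega>) borel)) \<and>
      gaussian_vector M (\<lambda>\<omega>. B t \<omega> - B s \<omega>) 0 (integral {s..t} Q))"


subsection \<open>Stochastic integrals of deterministic integrands\<close>

definition partition_of :: "real \<Rightarrow> nat \<Rightarrow> (nat \<Rightarrow> real) \<Rightarrow> bool" where
  "partition_of T n \<tau> \<longleftrightarrow> \<tau> 0 = 0 \<and> \<tau> n = T \<and> (\<forall>i<n. \<tau> i \<le> \<tau> (Suc i))"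

definition step_function :: "nat \<Rightarrow> (nat \<Rightarrow> real) \<Rightarrow> (nat \<Rightarrow> real ^ 'm) \<Rightarrow> real \<Rightarrow> real ^ 'm" where
  "step_function n \<tau> x t = (\<Sum>i<n. indicator {\<tau> i<..\<tau> (Suc i)} t *\<^sub>R x i)"

definition step_integral ::
    "(real \<Rightarrow> 'a \<Rightarrow> real ^ 'm) \<Rightarrow> nat \<Rightarrow> (nat \<Rightarrow> real) \<Rightarrow> (nat \<Rightarrow> real ^ 'm) \<Rightarrow> 'a \<Rightarrow> real" where
  "step_integral W n \<tau> x \<omega> = (\<Sum>i<n. x i \<bullet> (W (\<tau> (Suc i)) \<omega> - W (\<tau> i) \<omega>))"

text \<open>\<open>I\<close> is a version of \<open>\<integral>\<^sub>0\<^sup>T u\<^sup>T dW\<close>: the mean-square limit of the elementary integrals of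
  step functions that converge to \<open>u\<close> in \<open>L\<^sup>2(R dt)\<close>, the norm of the Ito isometry.\<close>

definition has_wiener_integral ::
    "'a measure \<Rightarrow> (real \<Rightarrow> 'a \<Rightarrow> real ^ 'm) \<Rightarrow> (real \<Rightarrow> real ^ 'm ^ 'm) \<Rightarrow> real \<Rightarrow>
     (real \<Rightarrow> real ^ 'm) \<Rightarrow> ('a \<Rightarrow> real) \<Rightarrow> bool" where
  "has_wiener_integral M W R T u I \<longleftrightarrow>
    I \<in> borel_measurable M \<and>
    (\<exists>n \<tau> x.
      (\<forall>k. partition_of T (n k) (\<tau> k)) \<and>
      ((\<lambda>k. \<integral>\<^sup>+t. ennreal ((step_function (n k) (\<tau> k) (x k) t - u t) \<bullet>
            (R t *v (step_function (n k) (\<tau> k) (x k) t - u t))) \<partial>lebesgue_on {0..T})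
          \<longlonglongrightarrow> 0) \<and>
      ((\<lambda>k. \<integral>\<^sup>+\<omega>. ennreal ((step_integral W (n k) (\<tau> k) (x k) \<omega> - I \<omega>)\<^sup>2) \<partial>M)
          \<longlonglongrightarrow> 0))"

text \<open>\<open>\<integral>\<^sub>0\<^sup>T u\<^sup>T dZ\<close> for \<open>dZ = H dt + dW\<close>. It is determined only up to null sets;
  \<open>ito_integral\<close> picks a measurable version.\<close>

definition has_ito_integral ::
    "'a measure \<Rightarrow> (real \<Rightarrow> 'a \<Rightarrow> real ^ 'm) \<Rightarrow> (real \<Rightarrow> 'a \<Rightarrow> real ^ 'm) \<Rightarrow>
     (real \<Rightarrow> real ^ 'm ^ 'm) \<Rightarrow> real \<Rightarrow> (real \<Rightarrow> real ^ 'm) \<Rightarrow> ('a \<Rightarrow> real) \<Rightarrow> bool" where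
  "has_ito_integral M H W R T u I \<longleftrightarrow>
    I \<in> borel_measurable M \<and>
    (\<exists>J. has_wiener_integral M W R T u J \<and>
      (AE \<omega> in M. (\<lambda>t. u t \<bullet> H t \<omega>) absolutely_integrable_on {0..T} \<and>
        I \<omega> = integral {0..T} (\<lambda>t. u t \<bullet> H t \<omega>) + J \<omega>))"

definition ito_integral ::
    "'a measure \<Rightarrow> (real \<Rightarrow> 'a \<Rightarrow> real ^ 'm) \<Rightarrow> (real \<Rightarrow> 'a \<Rightarrow> real ^ 'm) \<Rightarrow>
     (real \<Rightarrow> real ^ 'm ^ 'm) \<Rightarrow> real \<Rightarrow> (real \<Rightarrow> real ^ 'm) \<Rightarrow> 'a \<Rightarrow> real" where
  "ito_integral M H W R T u = (SOME I. has_ito_integral M H W R T u I)"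


subsection \<open>Riccati equation, Kalman gain, transition matrices\<close>

definition riccati_solution ::
    "(real \<Rightarrow> real ^ 'd ^ 'd) \<Rightarrow> (real \<Rightarrow> real ^ 'd ^ 'm) \<Rightarrow> (real \<Rightarrow> real ^ 'd ^ 'd) \<Rightarrow>
     (real \<Rightarrow> real ^ 'm ^ 'm) \<Rightarrow> (real \<Rightarrow> real ^ 'd ^ 'd) \<Rightarrow> bool" where
  "riccati_solution A C Q R \<Sigma> \<longleftrightarrow>
    (\<forall>t\<ge>0. (\<Sigma> has_vector_derivative
      (A t ** \<Sigma> t + \<Sigma> t ** transpose (A t) + Q t
        - \<Sigma> t ** transpose (C t) ** matrix_inv (R t) ** C t ** \<Sigma> t)) (at t within {0..}))"

definition kalman_gain ::
    "(real \<Rightarrow> real ^ 'd ^ 'm) \<Rightarrow> (real \<Rightarrow> real ^ 'm ^ 'm) \<Rightarrow> (real \<Rightarrow> real ^ 'd ^ 'd) \<Rightarrow>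
     real \<Rightarrow> real ^ 'm ^ 'd" where
  "kalman_gain C R \<Sigma> t = \<Sigma> t ** transpose (C t) ** matrix_inv (R t)"

text \<open>The transition matrix of \<open>dx/dt = F t x\<close>; \<open>\<Phi> t \<tau>\<close> is defined for \<open>t < \<tau>\<close> as well.\<close>

definition transition_matrix ::
    "(real \<Rightarrow> real ^ 'd ^ 'd) \<Rightarrow> (real \<Rightarrow> real \<Rightarrow> real ^ 'd ^ 'd) \<Rightarrow> bool" where
  "transition_matrix F \<Phi> \<longleftrightarrow>
    (\<forall>\<tau>\<ge>0. \<Phi> \<tau> \<tau> = mat 1 \<and>
      (\<forall>t\<ge>0. ((\<lambda>s. \<Phi> s \<tau>) has_vector_derivative (F t ** \<Phi> t \<tau>)) (at t within {0..})))"


subsection \<open>The bi-objective problem\<close>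

text \<open>The functions \<open>u\<close> on \<open>[0, T]\<close> for which \<open>\<integral>\<^sub>0\<^sup>T u\<^sup>T dZ\<close> is defined: \<open>u \<in> L\<^sup>2(R dt)\<close> for
  the martingale part, \<open>C\<^sup>T u \<in> L\<^sup>1(dt)\<close> for the drift part. If \<open>R\<close> is continuous, this is
  \<open>L\<^sup>2([0, T])\<close>.\<close>

definition admissible ::
    "(real \<Rightarrow> real ^ 'd ^ 'm) \<Rightarrow> (real \<Rightarrow> real ^ 'm ^ 'm) \<Rightarrow> real \<Rightarrow> (real \<Rightarrow> real ^ 'm) \<Rightarrow> bool" where
  "admissible C R T u \<longleftrightarrow>
    u \<in> borel_measurable (lebesgue_on {0..T}) \<and>
    (\<lambda>t. u t \<bullet> (R t *v u t)) absolutely_integrable_on {0..T} \<and>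
    (\<lambda>t. transpose (C t) *v u t) absolutely_integrable_on {0..T}"

definition estimator ::
    "'a measure \<Rightarrow> (real \<Rightarrow> real ^ 'd ^ 'm) \<Rightarrow> (real \<Rightarrow> real ^ 'm ^ 'm) \<Rightarrow>
     (real \<Rightarrow> 'a \<Rightarrow> real ^ 'd) \<Rightarrow> (real \<Rightarrow> 'a \<Rightarrow> real ^ 'm) \<Rightarrow> ('a \<Rightarrow> real ^ 'd) \<Rightarrow> real ^ 'd \<Rightarrow> real \<Rightarrow>
     real ^ 'd \<Rightarrow> real ^ 'd \<Rightarrow> (real \<Rightarrow> real ^ 'm) \<Rightarrow> 'a \<Rightarrow> real" where
  "estimator M C R X W Xbar0 m0 T b c u \<omega> =
    b \<bullet> m0 + c \<bullet> (Xbar0 \<omega> - m0) + ito_integral M (\<lambda>t \<omega>. C t *v X t \<omega>) W R T u \<omega>"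

text \<open>\<open>E[|E[S | F] - Y|\<^sup>2]\<close>. The outer expectation takes values in \<open>[0, \<infinity>]\<close>, since the Bochner
  integral of a non-integrable function would be \<open>0\<close>.\<close>

definition cond_mse :: "'a measure \<Rightarrow> 'a measure \<Rightarrow> ('a \<Rightarrow> real) \<Rightarrow> ('a \<Rightarrow> real) \<Rightarrow> ennreal" where
  "cond_mse M F S Y = (\<integral>\<^sup>+\<omega>. ennreal (\<bar>real_cond_exp M F S \<omega> - Y \<omega>\<bar>\<^sup>2) \<partial>M)"

text \<open>A solution minimises both objectives simultaneously. Once such a point exists, these are
  exactly the Pareto-optimal points.\<close>

definition bi_objective_solution ::
    "'a measure \<Rightarrow> (real \<Rightarrow> real ^ 'd ^ 'm) \<Rightarrow> (real \<Rightarrow> real ^ 'm ^ 'm) \<Rightarrow>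
     (real \<Rightarrow> 'a \<Rightarrow> real ^ 'd) \<Rightarrow> (real \<Rightarrow> 'a \<Rightarrow> real ^ 'm) \<Rightarrow> (real \<Rightarrow> 'a \<Rightarrow> real ^ 'm) \<Rightarrow>
     ('a \<Rightarrow> real ^ 'd) \<Rightarrow> real ^ 'd \<Rightarrow> real \<Rightarrow> real ^ 'd \<Rightarrow>
     real ^ 'd \<Rightarrow> real ^ 'd \<Rightarrow> (real \<Rightarrow> real ^ 'm) \<Rightarrow> bool" where
  "bi_objective_solution M C R X W Z Xbar0 m0 T a b c u \<longleftrightarrow>
    (let \<Z> = generated_algebra M Z {0..T};
         S = estimator M C R X W Xbar0 m0 T;
         J1 = (\<lambda>b c u. cond_mse M \<Z> (S b c u) (\<lambda>\<omega>. a \<bullet> X T \<omega>));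
         J2 = (\<lambda>b c u. cond_mse M \<Z> (\<lambda>\<omega>. (S b c u \<omega>)\<^sup>2) (\<lambda>\<omega>. (a \<bullet> X T \<omega>)\<^sup>2))
     in admissible C R T u \<and>
        (\<forall>b' c' u'. admissible C R T u' \<longrightarrow> J1 b c u \<le> J1 b' c' u' \<and> J2 b c u \<le> J2 b' c' u'))"

end

theory Submission
  imports Defs
begin

text \<open>Write \<open>p t = \<Phi>(t;T) a\<close> and \<open>u = K\<^sup>T p\<close>. Since \<open>p' = - A\<^sup>T p + C\<^sup>T u\<close>, the product rule for \<open>p \<bullet> X\<close>
  gives \<open>a \<bullet> X\<^sub>T = p\<^sub>0 \<bullet> X\<^sub>0 + \<integral> u \<bullet> C X dt + \<integral> p \<bullet> dB\<close> (\<open>path_duality\<close>). Hence \<open>a \<bullet> X\<^sub>T = Y + e\<close>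
  with \<open>Y = p\<^sub>0 \<bullet> m\<^sub>0 + \<integral> u \<bullet> dZ\<close> and \<open>e = p\<^sub>0 \<bullet> (X\<^sub>0 - m\<^sub>0) + \<integral> p \<bullet> dB - \<integral> u \<bullet> dW\<close>
  (\<open>opt_error_gauss\<close>). The variable \<open>Y\<close> is a function of the observations, because the integral
  against \<open>Z\<close> is a limit of elementary integrals against \<open>Z\<close> (\<open>ito_observable_version\<close>).

  The error \<open>e\<close> is independent of the observations. Indeed the same duality, now for the solution \<open>q\<close>
  of \<open>q' = - A\<^sup>T q - C\<^sup>T w\<close> with terminal value \<open>0\<close>, writes \<open>w \<bullet> Z\<^sub>t\<close> as a constant plus an initial
  term and Wiener integrals (\<open>observable_gauss\<close>), and the covariance of \<open>e\<close> with it vanishes because its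
  integrand is the derivative of \<open>q \<bullet> \<Sigma> p\<close> (\<open>opt_error_orthogonal\<close>). All these variables form one
  Gaussian family, the predicate \<open>gauss\<close>, in which orthogonality is independence
  (\<open>gauss_orthogonal_indep\<close>). So, given the observations, \<open>a \<bullet> X\<^sub>T\<close> has the law
  \<open>N(Y, a \<bullet> \<Sigma>\<^sub>T a)\<close>.

  The estimator with sampling vector \<open>c\<close> equals \<open>Y + c \<bullet> (Xbar\<^sub>0 - m\<^sub>0)\<close>, and the second summand is an
  independent \<open>N(0, c \<bullet> \<Sigma>\<^sub>0 c)\<close> variable. The two conditional laws agree if
  \<open>c \<bullet> \<Sigma>\<^sub>0 c = a \<bullet> \<Sigma>\<^sub>T a\<close>, and \<open>\<Psi>\<close> is designed to achieve this: \<open>r \<bullet> \<Sigma> r\<close> is constant along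
  \<open>r t = \<Psi>(t;T) a\<close> (\<open>Psi_energy\<close>). This is exactness, for every Borel test function
  (\<open>estimator_exact\<close>).

  Optimality is Pythagoras: among the functions of the observations, the conditional expectation is the
  unique best mean-square approximation of a square integrable variable (\<open>cond_exp_pythagoras\<close>).
  Exactness for \<open>g x = x\<close> and \<open>g x = x\<^sup>2\<close> therefore makes both objectives minimal at once. Conversely,
  every solution \<open>(b, c, v)\<close> reproduces the first two conditional moments of \<open>a \<bullet> X\<^sub>T\<close>, which forces
  \<open>c \<bullet> \<Sigma>\<^sub>0 c = a \<bullet> \<Sigma>\<^sub>T a\<close> (\<open>variance_if_solution\<close>). On the line this leaves \<open>\<plusminus> c\<^sub>T\<close>, in higher dimension
  a whole ellipsoid.

  As \<open>R\<close> is merely integrable, \<open>R\<inverse>\<close> has no evident integrability. What is needed comes from the Riccati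
  equation through one identity, valid for solutions \<open>y\<close>, \<open>z\<close> of the closed-loop adjoint equation:
  \<open>(y \<bullet> \<Sigma> z)' = y \<bullet> Q z + K\<^sup>T y \<bullet> R K\<^sup>T z\<close> (\<open>energy_derivative\<close>). Its right-hand side is symmetric, so
  \<open>\<Sigma>\<close> is symmetric; for \<open>y = z\<close> it is nonnegative, so \<open>\<Sigma>\<close> is positive definite; and being a nonnegative
  derivative it is integrable, so the gain is admissible.\<close>

section \<open>Linear differential equations\<close>

lemma bounded_bilinear_matrix_vector:
  "bounded_bilinear ((*v) :: real^'n^'m \<Rightarrow> real^'n \<Rightarrow> real^'m)"
  by (intro bilinear_conv_bounded_bilinear[THEN iffD1])
     (auto simp: bilinear_def intro!: linearI simp: matrix_vector_mult_add_rdistrib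
        matrix_vector_right_distrib scaleR_matrix_vector_assoc matrix_vector_mult_scaleR)

lemma inner_matrix_vector: "x \<bullet> (S *v y) = (transpose S *v x) \<bullet> y" for S :: "real^'n^'m"
  by (simp add: transpose_matrix_vector dot_lmul_matrix)

lemma matrix_inv_vector:
  fixes S :: "real^'n^'n"
  assumes "\<And>v. S *v v = 0 \<Longrightarrow> v = 0"
  shows "S *v (matrix_inv S *v v) = v" "matrix_inv S *v (S *v v) = v"
proof -
  have "inj ((*v) S)"
    by (rule injI) (metis assms eq_iff_diff_eq_0 matrix_vector_mult_diff_distrib)
  then have "invertible S"
    using invertible_left_inverse matrix_left_invertible_injective by blast
  then have "S ** matrix_inv S = mat 1 \<and> matrix_inv S ** S = mat 1"
    unfolding invertible_def matrix_inv_def by (rule someI_ex)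
  then show "S *v (matrix_inv S *v v) = v" "matrix_inv S *v (S *v v) = v"
    by (auto simp: matrix_vector_mul_assoc)
qed

lemma transition_vector:
  assumes "transition_matrix F \<Phi>" "0 \<le> \<tau>" "0 \<le> t"
  shows "((\<lambda>s. \<Phi> s \<tau> *v a) has_vector_derivative F t *v (\<Phi> t \<tau> *v a)) (at t within {0..})"
    and "\<Phi> \<tau> \<tau> *v a = a"
proof -
  have "((\<lambda>s. \<Phi> s \<tau>) has_vector_derivative F t ** \<Phi> t \<tau>) (at t within {0..})" "\<Phi> \<tau> \<tau> = mat 1"
    using assms by (auto simp: transition_matrix_def)
  then show "((\<lambda>s. \<Phi> s \<tau> *v a) has_vector_derivative F t *v (\<Phi> t \<tau> *v a)) (at t within {0..})"
    "\<Phi> \<tau> \<tau> *v a = a"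
    using bounded_bilinear.has_vector_derivative[OF bounded_bilinear_matrix_vector _ has_vector_derivative_const, of "\<lambda>s. \<Phi> s \<tau>" _ t "{0..}" a]
    by (auto simp: matrix_vector_mul_assoc)
qed

text \<open>Near \<open>t1\<close> the transition matrix \<open>P\<close> is close to the identity, and \<open>z = P\<inverse> y\<close> has derivative zero:
  \<open>P\<close> expands lengths by at least one half, so the increment of \<open>z\<close> is bounded by twice that of
  \<open>y - P z(s)\<close>, whose value and derivative at \<open>s\<close> vanish.\<close>

lemma ode_zero_local:
  fixes y :: "real \<Rightarrow> real^'d" and F :: "real \<Rightarrow> real^'d^'d"
  assumes tr: "transition_matrix F \<Phi>"
    and y: "\<And>t. 0 \<le> t \<Longrightarrow> (y has_vector_derivative F t *v y t) (at t within {0..})"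
    and t1: "0 \<le> t1" "y t1 = 0"
  shows "\<exists>\<delta>>0. \<forall>s\<ge>0. \<bar>s - t1\<bar> < \<delta> \<longrightarrow> y s = 0"
proof -
  define P where "P = (\<lambda>s. \<Phi> s t1)"
  have P1: "P t1 = mat 1" and Pd: "\<And>t. 0 \<le> t \<Longrightarrow> (P has_vector_derivative F t ** P t) (at t within {0..})"
    using tr t1 by (auto simp: transition_matrix_def P_def)
  obtain K where K: "K > 0" "\<And>(S::real^'d^'d) x. norm (S *v x) \<le> norm S * norm x * K"
    using bounded_bilinear.pos_bounded[OF bounded_bilinear_matrix_vector] by blast
  have "continuous (at t1 within {0..}) P"
    using Pd[OF t1(1)] by (rule has_vector_derivative_continuous)
  then obtain \<delta> where \<delta>: "\<delta> > 0" "\<And>s. s \<ge> 0 \<Longrightarrow> \<bar>s - t1\<bar> < \<delta> \<Longrightarrow> norm (P s - mat 1) < 1 / (2*K)"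
    using K(1) unfolding continuous_within_eps_delta dist_norm P1
    by (metis atLeast_iff real_norm_def zero_less_divide_1_iff zero_less_mult_iff zero_less_numeral)
  define S where "S = {s. s \<ge> 0 \<and> \<bar>s - t1\<bar> < \<delta>}"
  have S: "S = {0..} \<inter> ball t1 \<delta>" by (auto simp: S_def dist_real_def)
  \<comment> \<open>the radius was chosen such that \<open>P s\<close> differs from the identity by at most one half\<close>
  have lower: "norm x \<le> 2 * norm (P s *v x)" if "s \<in> S" for s x
  proof -
    have "norm ((P s - mat 1) *v x) \<le> norm (P s - mat 1) * norm x * K" by (rule K)
    also have "\<dots> \<le> 1/(2*K) * norm x * K"
      using \<delta>(2)[of s] that K(1) by (intro mult_right_mono) (auto simp: S_def)
    also have "\<dots> = norm x / 2" using K(1) by simp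
    finally have "norm (P s *v x - x) \<le> norm x / 2" by (simp add: matrix_vector_mult_diff_rdistrib)
    then show ?thesis using norm_triangle_ineq3[of "P s *v x" x] by linarith
  qed
  have inv: "P s *v (matrix_inv (P s) *v v) = v" if "s \<in> S" for s v
  proof -
    have "w = 0" if w: "P s *v w = 0" for w
      using lower[OF \<open>s \<in> S\<close>, of w] w by simp
    then show ?thesis by (rule matrix_inv_vector(1))
  qed
  define z where "z s = matrix_inv (P s) *v y s" for s
  have Pz: "P s *v z s = y s" if "s \<in> S" for s using inv[OF that] by (simp add: z_def)
  have "(z has_vector_derivative 0) (at s within S)" if s: "s \<in> S" for s
  proof -
    have s0: "0 \<le> s" using s by (simp add: S_def)
    define g where "g r = y r - P r *v z s" for r
    have gs: "g s = 0" using Pz[OF s] by (simp add: g_def)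
    have "(g has_vector_derivative F s *v y s - (P s *v 0 + (F s ** P s) *v z s)) (at s within {0..})"
      unfolding g_def
      by (intro has_vector_derivative_diff y s0 bounded_bilinear.has_vector_derivative[OF bounded_bilinear_matrix_vector]
            Pd has_vector_derivative_const)
    moreover have "F s *v y s - (P s *v 0 + (F s ** P s) *v z s) = 0"
      using Pz[OF s] by (simp add: matrix_vector_mul_assoc[symmetric])
    ultimately have "(g has_vector_derivative 0) (at s within S)"
      using has_vector_derivative_within_subset[of g 0 s "{0..}" S] by (auto simp: S_def)
    then have "((\<lambda>r. 2 *\<^sub>R ((g r - (g s + (r - s) *\<^sub>R 0)) /\<^sub>R norm (r - s))) \<longlongrightarrow> 2 *\<^sub>R 0) (at s within S)"
      unfolding has_vector_derivative_def has_derivative_within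
      by (intro tendsto_scaleR tendsto_const) (auto simp: field_simps)
    then have lim: "((\<lambda>r. 2 *\<^sub>R (g r /\<^sub>R norm (r - s))) \<longlongrightarrow> 0) (at s within S)"
      by (simp add: gs)
    have "((\<lambda>r. (z r - (z s + (r - s) *\<^sub>R 0)) /\<^sub>R norm (r - s)) \<longlongrightarrow> 0) (at s within S)"
    proof (rule Lim_null_comparison[OF _ tendsto_norm_zero[OF lim]])
      show "\<forall>\<^sub>F r in at s within S. norm ((z r - (z s + (r - s) *\<^sub>R 0)) /\<^sub>R norm (r - s)) \<le> norm (2 *\<^sub>R (g r /\<^sub>R norm (r - s)))"
        unfolding eventually_at_filter
      proof (intro always_eventually allI impI)
        fix r assume r: "r \<in> S"
        have "norm (z r - z s) \<le> 2 * norm (P r *v (z r - z s))" by (rule lower[OF r])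
        also have "P r *v (z r - z s) = g r"
          using Pz[OF r] by (simp add: g_def matrix_vector_mult_diff_distrib)
        finally have "inverse \<bar>r - s\<bar> * norm (z r - z s) \<le> inverse \<bar>r - s\<bar> * (2 * norm (g r))"
          by (rule mult_left_mono) simp
        then show "norm ((z r - (z s + (r - s) *\<^sub>R 0)) /\<^sub>R norm (r - s)) \<le> norm (2 *\<^sub>R (g r /\<^sub>R norm (r - s)))"
          by (simp only: norm_scaleR scaleR_zero_right add_0_right real_norm_def abs_inverse abs_abs abs_numeral mult.left_commute)
      qed
    qed
    then show ?thesis unfolding has_vector_derivative_def has_derivative_within
      by (simp add: bounded_linear_zero divide_inverse_commute)
  qed
  moreover have "convex S" unfolding S by (intro convex_Int convex_ball) simp
  ultimately obtain c where c: "\<And>s. s \<in> S \<Longrightarrow> z s = c"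
    using has_vector_derivative_zero_constant[of S z] by blast
  have t1S: "t1 \<in> S" using t1 \<delta>(1) by (simp add: S_def)
  have "c = 0" using lower[OF t1S, of "z t1"] Pz[OF t1S] c[OF t1S] t1(2) by simp
  then have "y s = 0" if "s \<in> S" for s using Pz[OF that] c[OF that] by simp
  then show ?thesis using \<delta>(1) by (auto simp: S_def)
qed

text \<open>The zero set of a solution is closed by continuity and open by the local statement; the half-line is
  connected.\<close>

lemma ode_zero:
  fixes y :: "real \<Rightarrow> real^'d"
  assumes tr: "transition_matrix F \<Phi>"
    and y: "\<And>t. 0 \<le> t \<Longrightarrow> (y has_vector_derivative F t *v y t) (at t within {0..})"
    and t0: "0 \<le> t0" "y t0 = 0" and t: "0 \<le> t"
  shows "y t = 0"
proof -
  define Z where "Z = {s\<in>{0..}. y s = 0}"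
  have "continuous_on {0..} y"
    by (metis y has_vector_derivative_continuous continuous_on_eq_continuous_within atLeast_iff)
  then have cl: "closedin (top_of_set {0..}) Z"
    unfolding Z_def using continuous_closedin_preimage_constant by blast
  have op: "openin (top_of_set {0..}) Z"
    unfolding openin_contains_ball
  proof (intro conjI ballI)
    fix x assume "x \<in> Z"
    then obtain \<delta> where "\<delta> > 0" "\<forall>s\<ge>0. \<bar>s - x\<bar> < \<delta> \<longrightarrow> y s = 0"
      using ode_zero_local[OF tr y, of x] by (auto simp: Z_def)
    then show "\<exists>e>0. ball x e \<inter> {0..} \<subseteq> Z"
      by (intro exI[of _ \<delta>]) (auto simp: Z_def dist_real_def)
  qed (auto simp: Z_def)
  have "Z = {} \<or> Z = {0..}"
    using connected_clopen[of "{0::real..}"] cl op by auto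
  moreover have "t0 \<in> Z" using t0 by (simp add: Z_def)
  ultimately show ?thesis using t by (auto simp: Z_def)
qed

lemma transition_inj:
  assumes "transition_matrix F \<Phi>" "0 \<le> \<tau>" "0 \<le> t" "\<Phi> t \<tau> *v v = 0"
  shows "v = 0"
  using ode_zero[OF assms(1) transition_vector(1)[OF assms(1)], of \<tau> t v \<tau>]
    transition_vector(2)[OF assms(1,2,2)] assms by auto

lemma transition_surj:
  assumes "transition_matrix F \<Phi>" "0 \<le> \<tau>" "0 \<le> t"
  shows "\<exists>v. \<Phi> t \<tau> *v v = w"
  using matrix_inv_vector(1)[of "\<Phi> t \<tau>" w] transition_inj[OF assms] by blast

lemma uminus_matrix_vector: "(- S) *v x = - (S *v x)" for S :: "real^'n^'m"
  by (simp add: matrix_vector_mult_def vec_eq_iff sum_negf)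

text \<open>With \<open>y t = exp (l t) z t\<close> the integral equation becomes a fixed-point equation for \<open>z\<close> whose right-hand
  side is a contraction in the supremum norm as soon as \<open>l\<close> exceeds the bound of \<open>G\<close>. Composition with
  the projection \<open>\<pi>\<close> onto the interval turns it into an equation for bounded continuous functions on the
  whole line, which form a complete space.\<close>

lemma linear_ode_exists:
  fixes G :: "real \<Rightarrow> real^'d^'d" and h :: "real \<Rightarrow> real^'d"
  assumes T: "0 \<le> T" and G: "continuous_on {0..T} G" and h: "continuous_on {0..T} h"
  shows "\<exists>y. continuous_on {0..T} y \<and>
           (\<forall>t\<in>{0..T}. y t = y0 + integral {0..t} (\<lambda>s. G s *v y s + h s))"
proof -
  obtain K where K: "K > 0" "\<And>(S::real^'d^'d) x. norm (S *v x) \<le> norm S * norm x * K"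
    using bounded_bilinear.pos_bounded[OF bounded_bilinear_matrix_vector] by blast
  have "bounded (G ` {0..T})"
    by (intro compact_imp_bounded compact_continuous_image G) auto
  then obtain L0 where L0: "L0 > 0" "\<And>t. t \<in> {0..T} \<Longrightarrow> norm (G t) \<le> L0"
    unfolding bounded_pos by auto
  define L where "L = L0 * K"
  have L: "L > 0" "\<And>t x. t \<in> {0..T} \<Longrightarrow> norm (G t *v x) \<le> L * norm x"
  proof -
    show "L > 0" using L0 K by (simp add: L_def)
    fix t and x :: "real^'d" assume "t \<in> {0..T}"
    then have "norm (G t) * norm x * K \<le> L0 * norm x * K"
      using L0(2) K(1) by (intro mult_right_mono) auto
    then show "norm (G t *v x) \<le> L * norm x"
      using K(2)[of "G t" x] by (simp add: L_def mult.commute mult.left_commute)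
  qed
  \<comment> \<open>twice the bound of the linear part: this makes the contraction constant one half\<close>
  define l where "l = 2 * L"
  have l: "l > 0" using L by (simp add: l_def)
  define \<pi> where "\<pi> t = max 0 (min T t)" for t :: real
  have \<pi>: "\<pi> t \<in> {0..T}" "t \<in> {0..T} \<Longrightarrow> \<pi> t = t" for t using T by (auto simp: \<pi>_def)
  have \<pi>c: "continuous_on UNIV \<pi>" unfolding \<pi>_def by (intro continuous_intros)
  define J where "J z t = exp (- l * t) *\<^sub>R (y0 + integral {0..t} (\<lambda>s. exp (l * s) *\<^sub>R (G s *v z s) + h s))"
    for z :: "real \<Rightarrow> real^'d" and t
  have ic: "continuous_on {0..T} (\<lambda>s. exp (l * s) *\<^sub>R (G s *v z s) + h s)" if "continuous_on {0..T} z" for z :: "real \<Rightarrow> real^'d"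
    by (intro continuous_intros h that G bounded_bilinear.continuous_on[OF bounded_bilinear_matrix_vector])
  have Jc: "continuous_on {0..T} (J z)" if "continuous_on {0..T} z" for z :: "real \<Rightarrow> real^'d"
    unfolding J_def
    by (intro continuous_intros indefinite_integral_continuous_1 integrable_continuous_interval ic that)
  have Jb: "(\<lambda>t. J (apply_bcontfun z) (\<pi> t)) \<in> bcontfun" for z :: "real \<Rightarrow>\<^sub>C (real^'d)"
  proof -
    have c: "continuous_on {0..T} (J (apply_bcontfun z))" by (intro Jc) auto
    have "continuous_on UNIV (\<lambda>t. J (apply_bcontfun z) (\<pi> t))"
      by (rule continuous_on_compose2[OF c \<pi>c]) (use \<pi> in auto)
    moreover have "bounded (J (apply_bcontfun z) ` {0..T})"
      by (intro compact_imp_bounded compact_continuous_image c) auto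
    then have "bounded (range (\<lambda>t. J (apply_bcontfun z) (\<pi> t)))"
      by (rule bounded_subset) (use \<pi>(1) in auto)
    ultimately show ?thesis by (simp add: bcontfun_def)
  qed
  define \<Gamma> where "\<Gamma> z = Bcontfun (\<lambda>t. J (apply_bcontfun z) (\<pi> t))" for z :: "real \<Rightarrow>\<^sub>C (real^'d)"
  have \<Gamma>: "apply_bcontfun (\<Gamma> z) t = J (apply_bcontfun z) (\<pi> t)" for z :: "real \<Rightarrow>\<^sub>C (real^'d)" and t
    unfolding \<Gamma>_def using Bcontfun_inverse[OF Jb] by simp
  have "dist (\<Gamma> z) (\<Gamma> w) \<le> 1/2 * dist z w" for z w :: "real \<Rightarrow>\<^sub>C (real^'d)"
  proof (rule dist_bound)
    fix t0
    define t where "t = \<pi> t0"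
    have t: "t \<in> {0..T}" using \<pi> by (simp add: t_def)
    have sub: "continuous_on {0..t} f" if "continuous_on {0..T} f" for f :: "real \<Rightarrow> real^'d"
      using continuous_on_subset[OF that] t by auto
    note int = integrable_continuous_interval[OF sub[OF ic]]
    have "J (apply_bcontfun z) t - J (apply_bcontfun w) t =
        exp (- l * t) *\<^sub>R (integral {0..t} (\<lambda>s. (exp (l * s) *\<^sub>R (G s *v z s) + h s) - (exp (l * s) *\<^sub>R (G s *v w s) + h s)))"
      unfolding J_def by (subst Henstock_Kurzweil_Integration.integral_diff[OF int int]) (simp_all add: algebra_simps)
    also have "(\<lambda>s. (exp (l * s) *\<^sub>R (G s *v z s) + h s) - (exp (l * s) *\<^sub>R (G s *v w s) + h s)) =
       (\<lambda>s. exp (l * s) *\<^sub>R (G s *v (z s - w s)))"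
      by (simp add: algebra_simps matrix_vector_mult_diff_distrib)
    finally have eq: "J (apply_bcontfun z) t - J (apply_bcontfun w) t =
        exp (- l * t) *\<^sub>R integral {0..t} (\<lambda>s. exp (l * s) *\<^sub>R (G s *v (z s - w s)))" .
    have ex: "((\<lambda>s. exp (l * s) * (L * dist z w)) has_integral
         (exp (l * t) * (L * dist z w) / l - exp (l * 0) * (L * dist z w) / l)) {0..t}"
      using t l by (intro fundamental_theorem_of_calculus)
         (auto intro!: derivative_eq_intros simp: has_real_derivative_iff_has_vector_derivative[symmetric])
    have "norm (integral {0..t} (\<lambda>s. exp (l * s) *\<^sub>R (G s *v (z s - w s)))) \<le> integral {0..t} (\<lambda>s. exp (l * s) * (L * dist z w))"
    proof (rule integral_norm_bound_integral)
      show "(\<lambda>s. exp (l * s) *\<^sub>R (G s *v (z s - w s))) integrable_on {0..t}"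
        by (intro integrable_continuous_interval sub continuous_intros G bounded_bilinear.continuous_on[OF bounded_bilinear_matrix_vector]) auto
      show "(\<lambda>s. exp (l * s) * (L * dist z w)) integrable_on {0..t}" using ex by (rule has_integral_integrable)
      fix s assume s: "s \<in> {0..t}"
      have "norm (G s *v (z s - w s)) \<le> L * norm (z s - w s)" using s t by (intro L) auto
      also have "\<dots> \<le> L * dist z w"
        using dist_bounded[of z s w] L by (intro mult_left_mono) (auto simp: dist_norm)
      finally show "norm (exp (l * s) *\<^sub>R (G s *v (z s - w s))) \<le> exp (l * s) * (L * dist z w)"
        by simp
    qed
    also have "\<dots> = (exp (l * t) - 1) * (dist z w / 2)"
      using integral_unique[OF ex] L by (simp add: l_def field_simps)
    also have "\<dots> \<le> exp (l * t) * (dist z w / 2)" by (intro mult_right_mono) auto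
    finally have "norm (J (apply_bcontfun z) t - J (apply_bcontfun w) t) \<le> exp (- l * t) * (exp (l * t) * (dist z w / 2))"
      unfolding eq by (simp add: mult_left_mono)
    also have "\<dots> = 1/2 * dist z w" by (simp add: exp_minus)
    finally show "dist (\<Gamma> z t0) (\<Gamma> w t0) \<le> 1/2 * dist z w"
      by (simp add: \<Gamma> dist_norm t_def)
  qed
  then have "\<exists>!z. \<Gamma> z = z" by (intro banach_fix_type[of "1/2"]) auto
  then obtain z where z: "\<Gamma> z = z" by blast
  define y where "y t = exp (l * t) *\<^sub>R z t" for t
  have yc: "continuous_on {0..T} y" unfolding y_def by (intro continuous_intros) auto
  have "y t = y0 + integral {0..t} (\<lambda>s. G s *v y s + h s)" if "t \<in> {0..T}" for t
  proof -
    have "z t = J (apply_bcontfun z) t" using \<Gamma>[of z t] z \<pi>(2)[OF that] by simp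
    then have "y t = exp (l * t) *\<^sub>R J (apply_bcontfun z) t" by (simp add: y_def)
    also have "\<dots> = y0 + integral {0..t} (\<lambda>s. exp (l * s) *\<^sub>R (G s *v z s) + h s)"
      by (simp add: J_def exp_minus)
    finally show ?thesis by (simp add: y_def matrix_vector_mult_scaleR)
  qed
  then show ?thesis using yc by blast
qed

text \<open>The adjoint equations of filtering run backwards from the terminal time; time reversal reduces them to
  the initial value problem.\<close>

lemma terminal_ode_exists:
  fixes G :: "real \<Rightarrow> real^'d^'d" and h :: "real \<Rightarrow> real^'d"
  assumes T: "0 \<le> T" and G: "continuous_on {0..T} G" and h: "continuous_on {0..T} h"
  shows "\<exists>q. q T = q1 \<and> (\<forall>t\<in>{0..T}. (q has_vector_derivative G t *v q t + h t) (at t within {0..T}))"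
proof -
  have rev: "continuous_on {0..T} (\<lambda>t. - f (T - t))" if "continuous_on {0..T} f" for f :: "real \<Rightarrow> 'b::real_normed_vector"
    by (intro continuous_on_minus continuous_on_compose2[OF that]) (auto intro!: continuous_intros)
  obtain y where yc: "continuous_on {0..T} y"
    and y: "\<And>t. t \<in> {0..T} \<Longrightarrow> y t = q1 + integral {0..t} (\<lambda>s. (- G (T - s)) *v y s + - h (T - s))"
    using linear_ode_exists[OF T rev[OF G] rev[OF h]] by blast
  have cont: "continuous_on {0..T} (\<lambda>s. (- G (T - s)) *v y s + - h (T - s))"
    by (intro continuous_intros rev G h yc bounded_bilinear.continuous_on[OF bounded_bilinear_matrix_vector])
  have yd: "(y has_vector_derivative (- G (T - t)) *v y t + - h (T - t)) (at t within {0..T})" if "t \<in> {0..T}" for t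
  proof (rule has_vector_derivative_transform[OF that])
    show "((\<lambda>t. q1 + integral {0..t} (\<lambda>s. (- G (T - s)) *v y s + - h (T - s)))
       has_vector_derivative (- G (T - t)) *v y t + - h (T - t)) (at t within {0..T})"
      using integral_has_vector_derivative[OF cont that] has_vector_derivative_add[OF has_vector_derivative_const] by fastforce
  qed (use y in auto)
  define q where "q = (\<lambda>t. y (T - t))"
  have "(q has_vector_derivative G t *v q t + h t) (at t within {0..T})" if t: "t \<in> {0..T}" for t
  proof -
    have im: "(\<lambda>t. T - t) ` {0..T} = {0..T}"
      by (auto simp: image_iff intro!: bexI[of _ "T - _"])
    have "((y \<circ> (\<lambda>t. T - t)) has_vector_derivative (-1) *\<^sub>R ((- G (T - (T - t))) *v y (T - t) + - h (T - (T - t)))) (at t within {0..T})"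
    proof (rule vector_diff_chain_within)
      show "((\<lambda>t. T - t) has_vector_derivative - 1) (at t within {0..T})"
        by (auto intro!: derivative_eq_intros)
      show "(y has_vector_derivative (- G (T - (T - t))) *v y (T - t) + - h (T - (T - t))) (at (T - t) within (\<lambda>t. T - t) ` {0..T})"
        unfolding im by (rule yd) (use t in auto)
    qed
    then show ?thesis by (simp add: q_def o_def uminus_matrix_vector add.commute)
  qed
  moreover have "q T = q1" using y[of 0] T by (simp add: q_def)
  ultimately show ?thesis by blast
qed

section \<open>The Riccati equation and its closed-loop flow\<close>

lemma continuous_on_imp_lebesgue_measurable:
  fixes f :: "real \<Rightarrow> 'b::euclidean_space"
  shows "continuous_on {a..b} f \<Longrightarrow> f \<in> borel_measurable (lebesgue_on {a..b})"
  by (rule continuous_imp_measurable_on_sets_lebesgue) auto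

lemma abs_integrable_matrix_vector:
  fixes S :: "real \<Rightarrow> real^'n^'m"
  assumes S: "S absolutely_integrable_on {a..b}" and z: "continuous_on {a..b} z"
  shows "(\<lambda>t. S t *v z t) absolutely_integrable_on {a..b}"
proof -
  have "bilinear (\<lambda>x (M::real^'n^'m). M *v x)"
    using bounded_bilinear.flip[OF bounded_bilinear_matrix_vector] bilinear_conv_bounded_bilinear by blast
  then show ?thesis
    by (rule absolutely_integrable_bounded_measurable_product)
      (auto intro!: S continuous_on_imp_lebesgue_measurable z compact_imp_bounded compact_continuous_image)
qed

lemma abs_integrable_inner:
  fixes g :: "real \<Rightarrow> real^'n"
  assumes g: "g absolutely_integrable_on {a..b}" and z: "continuous_on {a..b} z"
  shows "(\<lambda>t. z t \<bullet> g t) absolutely_integrable_on {a..b}"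
  by (rule absolutely_integrable_bounded_measurable_product[OF _ _ _ _ g])
    (auto intro!: continuous_on_imp_lebesgue_measurable z compact_imp_bounded compact_continuous_image
      simp: bilinear_conv_bounded_bilinear bounded_bilinear_inner)

lemma abs_integrable_quadratic:
  fixes S :: "real \<Rightarrow> real^'n^'m"
  assumes S: "S absolutely_integrable_on {a..b}" and "continuous_on {a..b} y" "continuous_on {a..b} z"
  shows "(\<lambda>t. y t \<bullet> (S t *v z t)) absolutely_integrable_on {a..b}"
  using assms by (intro abs_integrable_inner abs_integrable_matrix_vector)

lemma posdef_sym: "posdef S \<Longrightarrow> v \<bullet> (S *v w) = (S *v v) \<bullet> w"
  by (simp add: posdef_def inner_matrix_vector)

lemma posdef_swap: "posdef S \<Longrightarrow> v \<bullet> (S *v w) = w \<bullet> (S *v v)"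
  by (subst posdef_sym) (auto simp: inner_commute)

lemma posdef_nonneg: "posdef S \<Longrightarrow> 0 \<le> v \<bullet> (S *v v)"
  by (cases "v = 0") (auto simp: posdef_def less_imp_le)

lemma posdef_inv:
  assumes "posdef S"
  shows "S *v (matrix_inv S *v v) = v" "matrix_inv S *v (S *v v) = v"
  using assms matrix_inv_vector[of S v] by (force simp: posdef_def)+

lemma posdef_inv_sym:
  assumes "posdef S" shows "v \<bullet> (matrix_inv S *v w) = (matrix_inv S *v v) \<bullet> w"
  by (metis assms posdef_inv(1) posdef_sym)

lemma transpose_matrix_inv:
  assumes "posdef S" shows "transpose (matrix_inv S) = matrix_inv S"
proof -
  have "transpose (matrix_inv S) *v v = matrix_inv S *v v" for v
    by (metis assms inner_commute inner_matrix_vector posdef_inv_sym vector_eq_ldot)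
  then show ?thesis by (simp add: matrix_eq)
qed

lemma measurable_vec_nth:
  fixes f :: "'a \<Rightarrow> real^'n"
  shows "f \<in> borel_measurable M \<Longrightarrow> (\<lambda>x. f x $ i) \<in> borel_measurable M"
  by (rule borel_measurable_continuous_on[of "\<lambda>x. x $ i"]) (auto intro: continuous_intros)

lemma measurable_mat_nth:
  fixes S :: "'a \<Rightarrow> real^'n^'m"
  shows "S \<in> borel_measurable M \<Longrightarrow> (\<lambda>x. S x $ i $ j) \<in> borel_measurable M"
  by (rule borel_measurable_continuous_on[of "\<lambda>x. x $ i $ j"])
    (auto intro: linear_continuous_on bounded_linear_compose[OF bounded_linear_vec_nth bounded_linear_vec_nth])

lemma measurable_vec_lambda:
  fixes f :: "'a \<Rightarrow> 'n::finite \<Rightarrow> real"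
  assumes "\<And>i. (\<lambda>x. f x i) \<in> borel_measurable M"
  shows "(\<lambda>x. \<chi> i. f x i) \<in> borel_measurable M"
  by (subst borel_measurable_euclidean_space)
    (auto simp: Basis_vec_def inner_axis assms)

lemma measurable_matrix_vector:
  fixes S :: "'a \<Rightarrow> real^'n^'m"
  assumes "S \<in> borel_measurable M" "v \<in> borel_measurable M"
  shows "(\<lambda>x. S x *v v x) \<in> borel_measurable M"
  unfolding matrix_vector_mult_def
  by (intro measurable_vec_lambda borel_measurable_sum borel_measurable_times measurable_mat_nth measurable_vec_nth assms)

lemma measurable_det:
  fixes S :: "'a \<Rightarrow> real^'n^'n"
  assumes "\<And>i j. (\<lambda>x. S x $ i $ j) \<in> borel_measurable M"
  shows "(\<lambda>x. det (S x)) \<in> borel_measurable M"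
  unfolding det_def by (intro borel_measurable_sum borel_measurable_times borel_measurable_prod assms) auto

text \<open>By Cramer's rule the inverse is a rational function of the entries.\<close>

lemma measurable_matrix_inv_vector:
  fixes S :: "'a \<Rightarrow> real^'n^'n"
  assumes S: "S \<in> borel_measurable M" and v: "v \<in> borel_measurable M"
    and pos: "\<And>x. x \<in> space M \<Longrightarrow> posdef (S x)"
  shows "(\<lambda>x. matrix_inv (S x) *v v x) \<in> borel_measurable M"
proof -
  have eq: "matrix_inv (S x) *v v x = (\<chi> k. det (\<chi> i j. if j = k then v x $ i else S x $ i $ j) / det (S x))"
    if "x \<in> space M" for x
  proof -
    have "invertible (S x)"
      using posdef_inv[OF pos[OF that]] unfolding invertible_def
      by (intro exI[of _ "matrix_inv (S x)"]) (auto simp: matrix_eq matrix_vector_mul_assoc[symmetric])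
    then have "det (S x) \<noteq> 0" by (simp add: invertible_det_nz)
    then show ?thesis using cramer posdef_inv(1)[OF pos[OF that]] by blast
  qed
  have "(\<lambda>x. \<chi> k. det (\<chi> i j. if j = k then v x $ i else S x $ i $ j) / det (S x)) \<in> borel_measurable M"
  proof (intro measurable_vec_lambda borel_measurable_divide measurable_det)
    fix k i j
    show "(\<lambda>x. (\<chi> i j. if j = k then v x $ i else S x $ i $ j) $ i $ j) \<in> borel_measurable M"
      by (cases "j = k") (simp_all add: measurable_mat_nth[OF S] measurable_vec_nth[OF v])
  qed (rule measurable_mat_nth[OF S])
  then show ?thesis by (subst measurable_cong[OF eq])
qed

text \<open>The minimum of \<open>norm (P t *v x)\<close> over the compact product of interval and unit sphere is attained, hence
  positive.\<close>

lemma uniformly_injective: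
  fixes P :: "real \<Rightarrow> real^'n^'m"
  assumes P: "continuous_on {a..b} P" and inj: "\<And>t x. t \<in> {a..b} \<Longrightarrow> P t *v x = 0 \<Longrightarrow> x = 0"
  shows "\<exists>\<kappa>>0. \<forall>t\<in>{a..b}. \<forall>x. \<kappa> * norm x \<le> norm (P t *v x)"
proof (cases "{a..b} = {}")
  case False
  define D where "D = {a..b} \<times> sphere (0::real^'n) 1"
  have "continuous_on D (\<lambda>(t,x). norm (P t *v x))"
    unfolding D_def split_def
    by (intro continuous_intros bounded_bilinear.continuous_on[OF bounded_bilinear_matrix_vector]
        continuous_on_compose2[OF P]) auto
  moreover have "compact D" "D \<noteq> {}" using False by (auto simp: D_def intro!: compact_Times)
  ultimately obtain p where p: "p \<in> D" "\<And>t x. (t, x) \<in> D \<Longrightarrow> norm (P (fst p) *v snd p) \<le> norm (P t *v x)"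
    using continuous_attains_inf[of D "\<lambda>(t,x). norm (P t *v x)"] by (force simp: split_def)
  define \<kappa> where "\<kappa> = norm (P (fst p) *v snd p)"
  have "\<kappa> \<noteq> 0" using inj[of "fst p" "snd p"] p(1) by (auto simp: \<kappa>_def D_def)
  then have pos: "\<kappa> > 0" by (simp add: \<kappa>_def)
  have "\<kappa> * norm x \<le> norm (P t *v x)" if "t \<in> {a..b}" for t x
  proof (cases "x = 0")
    case False
    have "\<kappa> \<le> norm (P t *v (x /\<^sub>R norm x))"
      unfolding \<kappa>_def by (rule p) (use that False in \<open>auto simp: D_def\<close>)
    also have "\<dots> = norm (P t *v x) / norm x"
      by (simp add: matrix_vector_mult_scaleR divide_inverse mult.commute)
    finally show ?thesis using False by (simp add: pos_le_divide_eq)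
  qed simp
  then show ?thesis using pos by blast
qed (auto intro: exI[of _ 1])

text \<open>The algebra behind the energy identity: the terms with \<open>A\<close> cancel, and the quadratic term of the
  Riccati equation absorbs one of the two gain terms of \<open>F\<close>. The transpose of \<open>S\<close> is kept
  apart from \<open>S\<close>, because the identity serves to prove that \<open>\<Sigma>\<close> is symmetric.\<close>

lemma riccati_form_identity:
  fixes A S Q :: "real^'d^'d" and C :: "real^'d^'m" and R :: "real^'m^'m"
  assumes "posdef R"
  defines "F \<equiv> - transpose A + transpose C ** transpose (S ** transpose C ** matrix_inv R)"
  shows "(F *v v) \<bullet> (S *v w)
      + (v \<bullet> ((A ** S + S ** transpose A + Q - S ** transpose C ** matrix_inv R ** C ** S) *v w)
      + v \<bullet> (S *v (F *v w)))
    = v \<bullet> (Q *v w) + (transpose (S ** transpose C ** matrix_inv R) *v v) \<bullet> (R *v (transpose (S ** transpose C ** matrix_inv R) *v w))"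
proof -
  define I where "I = matrix_inv R"
  have K: "transpose (S ** transpose C ** I) = I ** (C ** transpose S)"
    by (simp add: matrix_transpose_mul I_def transpose_matrix_inv[OF assms(1)])
  have sym: "(I *v x) \<bullet> y = x \<bullet> (I *v y)" for x y
    using posdef_inv_sym[OF assms(1)] by (simp add: I_def)
  have A: "(transpose A *v x) \<bullet> y = x \<bullet> (A *v y)" for x y
    by (simp add: inner_matrix_vector)
  have C: "(transpose C *v x) \<bullet> y = x \<bullet> (C *v y)" "y \<bullet> (transpose C *v x) = (C *v y) \<bullet> x" for x y
    by (metis inner_matrix_vector, metis inner_commute inner_matrix_vector)
  have Ri: "R *v (I *v x) = x" for x using posdef_inv(1)[OF assms(1)] by (simp add: I_def)
  have S: "v \<bullet> (S *v x) = (transpose S *v v) \<bullet> x" for x by (rule inner_matrix_vector)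
  show ?thesis
    unfolding F_def I_def[symmetric] K
    by (simp add: matrix_vector_mult_add_rdistrib matrix_vector_mult_diff_rdistrib matrix_vector_mul_assoc[symmetric]
        matrix_vector_right_distrib inner_add_left inner_add_right inner_diff_right S A C sym Ri uminus_matrix_vector
        inner_minus_left inner_minus_right inner_diff_left del: transpose_matrix_vector)
qed

lemma DERIV_zero_half_line:
  fixes f :: "real \<Rightarrow> real"
  assumes "\<And>s. s \<in> {0..} \<Longrightarrow> (f has_real_derivative 0) (at s within {0..})" "0 \<le> t"
  shows "f t = f 0"
proof -
  have "\<exists>c. \<forall>s\<in>{0..}. f s = c"
    by (rule has_field_derivative_zero_constant[OF convex_real_interval(1) assms(1)])
  then show ?thesis using assms(2) by auto
qed

locale riccati_flow =
  fixes A :: "real \<Rightarrow> real^'d^'d" and C :: "real \<Rightarrow> real^'d^'m"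
    and Q :: "real \<Rightarrow> real^'d^'d" and R :: "real \<Rightarrow> real^'m^'m"
    and \<Sigma> :: "real \<Rightarrow> real^'d^'d" and \<Phi> :: "real \<Rightarrow> real \<Rightarrow> real^'d^'d"
  assumes A_cont: "continuous_on {0..} A" and C_cont: "continuous_on {0..} C"
    and Q_pos: "0 \<le> t \<Longrightarrow> posdef (Q t)" and R_pos: "0 \<le> t \<Longrightarrow> posdef (R t)"
    and Sigma0_pos: "posdef (\<Sigma> 0)"
    and Q_int: "0 \<le> t \<Longrightarrow> Q absolutely_integrable_on {0..t}"
    and R_int: "0 \<le> t \<Longrightarrow> R absolutely_integrable_on {0..t}"
    and Sigma: "riccati_solution A C Q R \<Sigma>"
    and Phi: "transition_matrix
      (\<lambda>t. - transpose (A t) + transpose (C t) ** transpose (kalman_gain C R \<Sigma> t)) \<Phi>"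
begin

text \<open>The generator of \<open>\<Phi>\<close>, that is, minus the transpose of the closed-loop matrix \<open>A - K C\<close>.\<close>

definition F :: "real \<Rightarrow> real^'d^'d" where
  "F t = - transpose (A t) + transpose (C t) ** transpose (kalman_gain C R \<Sigma> t)"

definition Kt :: "real \<Rightarrow> real^'d^'m" where
  "Kt t = transpose (kalman_gain C R \<Sigma> t)"

definition sol :: "(real \<Rightarrow> real^'d) \<Rightarrow> bool" where
  "sol y \<longleftrightarrow> (\<forall>t\<ge>0. (y has_vector_derivative F t *v y t) (at t within {0..}))"

lemma sol_Phi: "0 \<le> \<tau> \<Longrightarrow> sol (\<lambda>t. \<Phi> t \<tau> *v a)"
  using transition_vector(1)[OF Phi] by (auto simp: sol_def F_def)

lemma sol_add: "sol y \<Longrightarrow> sol z \<Longrightarrow> sol (\<lambda>t. y t + z t)"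
  by (auto simp: sol_def matrix_vector_right_distrib intro!: has_vector_derivative_add)

lemma sol_continuous: "sol y \<Longrightarrow> continuous_on {0..} y"
  by (metis sol_def has_vector_derivative_continuous continuous_on_eq_continuous_within atLeast_iff)

lemma Sigma_derivative:
  "0 \<le> t \<Longrightarrow> (\<Sigma> has_vector_derivative
      (A t ** \<Sigma> t + \<Sigma> t ** transpose (A t) + Q t
        - \<Sigma> t ** transpose (C t) ** matrix_inv (R t) ** C t ** \<Sigma> t)) (at t within {0..})"
  using Sigma by (simp add: riccati_solution_def)

lemma Sigma_continuous: "continuous_on {0..} \<Sigma>"
  by (metis Sigma_derivative has_vector_derivative_continuous continuous_on_eq_continuous_within atLeast_iff)

lemma energy_derivative:
  assumes "sol y" "sol z" "0 \<le> t"
  shows "((\<lambda>s. y s \<bullet> (\<Sigma> s *v z s)) has_real_derivative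
    y t \<bullet> (Q t *v z t) + (Kt t *v y t) \<bullet> (R t *v (Kt t *v z t))) (at t within {0..})"
proof -
  have "((\<lambda>s. y s \<bullet> (\<Sigma> s *v z s)) has_vector_derivative
     y t \<bullet> (\<Sigma> t *v (F t *v z t) + (A t ** \<Sigma> t + \<Sigma> t ** transpose (A t) + Q t
        - \<Sigma> t ** transpose (C t) ** matrix_inv (R t) ** C t ** \<Sigma> t) *v z t)
     + (F t *v y t) \<bullet> (\<Sigma> t *v z t)) (at t within {0..})"
    using assms unfolding sol_def
    by (intro bounded_bilinear.has_vector_derivative[OF bounded_bilinear_inner]
        bounded_bilinear.has_vector_derivative[OF bounded_bilinear_matrix_vector] Sigma_derivative) auto
  moreover have "y t \<bullet> (\<Sigma> t *v (F t *v z t) + (A t ** \<Sigma> t + \<Sigma> t ** transpose (A t) + Q t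
        - \<Sigma> t ** transpose (C t) ** matrix_inv (R t) ** C t ** \<Sigma> t) *v z t)
     + (F t *v y t) \<bullet> (\<Sigma> t *v z t) = y t \<bullet> (Q t *v z t) + (Kt t *v y t) \<bullet> (R t *v (Kt t *v z t))"
    using riccati_form_identity[OF R_pos[OF assms(3)], of "A t" "C t" "\<Sigma> t" "y t" "z t" "Q t"]
    by (simp add: F_def Kt_def kalman_gain_def inner_add_right)
  ultimately show ?thesis
    by (simp add: has_real_derivative_iff_has_vector_derivative)
qed

text \<open>For solutions \<open>y\<close>, \<open>z\<close> the derivatives of \<open>y \<bullet> \<Sigma> z\<close> and \<open>z \<bullet> \<Sigma> y\<close> coincide, and so do the initial
  values. Every pair of vectors at time \<open>t\<close> is reached by solutions.\<close>

lemma Sigma_sym_form: assumes "0 \<le> t" shows "v \<bullet> (\<Sigma> t *v w) = w \<bullet> (\<Sigma> t *v v)"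
proof -
  obtain v0 w0 where vw: "\<Phi> t 0 *v v0 = v" "\<Phi> t 0 *v w0 = w"
    using transition_surj[OF Phi _ assms] by (metis order_refl)
  define y z where "y s = \<Phi> s 0 *v v0" and "z s = \<Phi> s 0 *v w0" for s
  have yz: "sol y" "sol z" unfolding y_def z_def by (auto intro!: sol_Phi)
  have "((\<lambda>s. y s \<bullet> (\<Sigma> s *v z s) - z s \<bullet> (\<Sigma> s *v y s)) has_real_derivative 0) (at s within {0..})"
    if "s \<in> {0..}" for s
  proof -
    have "y s \<bullet> (Q s *v z s) = z s \<bullet> (Q s *v y s)"
      "(Kt s *v y s) \<bullet> (R s *v (Kt s *v z s)) = (Kt s *v z s) \<bullet> (R s *v (Kt s *v y s))"
      using that by (auto intro!: posdef_swap Q_pos R_pos)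
    then show ?thesis
      using DERIV_diff[OF energy_derivative[OF yz(1,2)] energy_derivative[OF yz(2,1)], of s] that by simp
  qed
  from DERIV_zero_half_line[OF this assms]
  have c: "y t \<bullet> (\<Sigma> t *v z t) - z t \<bullet> (\<Sigma> t *v y t) = y 0 \<bullet> (\<Sigma> 0 *v z 0) - z 0 \<bullet> (\<Sigma> 0 *v y 0)" .
  have "y 0 \<bullet> (\<Sigma> 0 *v z 0) - z 0 \<bullet> (\<Sigma> 0 *v y 0) = 0"
    using posdef_swap[OF Sigma0_pos, of "y 0" "z 0"] by simp
  then show ?thesis using c by (simp add: y_def z_def vw)
qed

lemma energy_has_integral:
  assumes "sol y" "sol z" "0 \<le> T"
  shows "((\<lambda>t. y t \<bullet> (Q t *v z t) + (Kt t *v y t) \<bullet> (R t *v (Kt t *v z t))) has_integral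
     y T \<bullet> (\<Sigma> T *v z T) - y 0 \<bullet> (\<Sigma> 0 *v z 0)) {0..T}"
proof (rule fundamental_theorem_of_calculus[OF assms(3)])
  fix t assume "t \<in> {0..T}"
  then show "((\<lambda>s. y s \<bullet> (\<Sigma> s *v z s)) has_vector_derivative
      y t \<bullet> (Q t *v z t) + (Kt t *v y t) \<bullet> (R t *v (Kt t *v z t))) (at t within {0..T})"
    using has_vector_derivative_within_subset[OF energy_derivative[OF assms(1,2), of t, unfolded has_real_derivative_iff_has_vector_derivative], of "{0..T}"]
    by auto
qed

text \<open>Along a solution \<open>y \<bullet> \<Sigma> y\<close> is nondecreasing, and it starts positive.\<close>

lemma Sigma_pos: assumes t: "0 \<le> t" shows "posdef (\<Sigma> t)"
proof -
  have "transpose (\<Sigma> t) *v w = \<Sigma> t *v w" for w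
    by (metis Sigma_sym_form[OF t] inner_commute inner_matrix_vector vector_eq_ldot)
  then have 1: "transpose (\<Sigma> t) = \<Sigma> t" by (simp add: matrix_eq)
  have "0 < v \<bullet> (\<Sigma> t *v v)" if "v \<noteq> 0" for v
  proof -
    obtain v0 where v0: "\<Phi> t 0 *v v0 = v" using transition_surj[OF Phi _ t] by (metis order_refl)
    have P0: "\<Phi> 0 0 *v v0 = v0" using transition_vector(2)[OF Phi, of 0 0 v0] by simp
    have "v0 \<noteq> 0" using that v0 by auto
    then have "0 < v0 \<bullet> (\<Sigma> 0 *v v0)" using Sigma0_pos by (simp add: posdef_def)
    moreover have "0 \<le> v \<bullet> (\<Sigma> t *v v) - v0 \<bullet> (\<Sigma> 0 *v v0)"
      using has_integral_nonneg[OF energy_has_integral[OF sol_Phi sol_Phi t, of 0 0 v0 v0]] v0 P0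
      by (auto intro!: add_nonneg_nonneg posdef_nonneg Q_pos R_pos)
    ultimately show ?thesis by simp
  qed
  then show ?thesis using 1 by (simp add: posdef_def)
qed

lemma Kt_vector: "0 \<le> t \<Longrightarrow> Kt t *v v = matrix_inv (R t) *v (C t *v (\<Sigma> t *v v))"
  using Sigma_pos[of t]
  by (simp add: Kt_def kalman_gain_def matrix_transpose_mul transpose_matrix_inv[OF R_pos[of t]] matrix_vector_mul_assoc posdef_def)

lemma R_Kt: "0 \<le> t \<Longrightarrow> R t *v (Kt t *v v) = C t *v (\<Sigma> t *v v)"
  by (simp add: Kt_vector posdef_inv R_pos)

lemma F_vector: "F t *v v = - (transpose (A t) *v v) + transpose (C t) *v (Kt t *v v)"
  by (simp add: F_def Kt_def matrix_vector_mult_add_rdistrib matrix_vector_mult_diff_rdistrib uminus_matrix_vector matrix_vector_mul_assoc del: transpose_matrix_vector)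

lemma continuous_onT: "continuous_on {0..} f \<Longrightarrow> continuous_on {0..T::real} f"
  for f :: "real \<Rightarrow> 'b::topological_space"
  by (rule continuous_on_subset) auto

lemma R_measurable: "0 \<le> T \<Longrightarrow> R \<in> borel_measurable (lebesgue_on {0..T})"
  using R_int absolutely_integrable_measurable[of "{0..T}" R] by auto

lemma Kt_measurable:
  assumes "sol y" "0 \<le> T"
  shows "(\<lambda>t. Kt t *v y t) \<in> borel_measurable (lebesgue_on {0..T})"
proof -
  have "(\<lambda>t. matrix_inv (R t) *v (C t *v (\<Sigma> t *v y t))) \<in> borel_measurable (lebesgue_on {0..T})"
    by (intro measurable_matrix_inv_vector R_measurable assms continuous_on_imp_lebesgue_measurable
        bounded_bilinear.continuous_on[OF bounded_bilinear_matrix_vector] continuous_onT C_cont Sigma_continuous sol_continuous R_pos) auto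
  then show ?thesis
    by (rule measurable_cong[THEN iffD1, rotated]) (simp add: Kt_vector)
qed

lemma Q_form_integrable:
  assumes "sol y" "sol z" "0 \<le> T"
  shows "(\<lambda>t. y t \<bullet> (Q t *v z t)) absolutely_integrable_on {0..T}"
  by (intro abs_integrable_quadratic Q_int continuous_onT sol_continuous assms)

text \<open>A nonnegative function with a primitive is absolutely integrable; subtracting the part with \<open>Q\<close>
  leaves the part with \<open>R\<close>.\<close>

lemma R_form_integrable_diag:
  assumes "sol y" "0 \<le> T"
  shows "(\<lambda>t. (Kt t *v y t) \<bullet> (R t *v (Kt t *v y t))) absolutely_integrable_on {0..T}"
proof -
  have "(\<lambda>t. y t \<bullet> (Q t *v y t) + (Kt t *v y t) \<bullet> (R t *v (Kt t *v y t))) absolutely_integrable_on {0..T}"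
    using energy_has_integral[OF assms(1,1,2)]
    by (intro nonnegative_absolutely_integrable_1 add_nonneg_nonneg posdef_nonneg Q_pos R_pos)
       (auto intro: has_integral_integrable)
  from set_integral_diff(1)[OF this Q_form_integrable[OF assms(1,1,2)]]
  show ?thesis by simp
qed

lemma R_form_integrable:
  assumes "sol y" "sol z" "0 \<le> T"
  shows "(\<lambda>t. (Kt t *v y t) \<bullet> (R t *v (Kt t *v z t))) absolutely_integrable_on {0..T}"
proof -
  let ?q = "\<lambda>y t. (Kt t *v y t) \<bullet> (R t *v (Kt t *v y t))"
  have "(\<lambda>t. (1/2) *\<^sub>R (?q (\<lambda>t. y t + z t) t - ?q y t - ?q z t)) absolutely_integrable_on {0..T}"
    by (intro absolutely_integrable_scaleR_left set_integral_diff(1) R_form_integrable_diag sol_add assms)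
  then show ?thesis
  proof (rule absolutely_integrable_spike[OF _ negligible_empty])
    fix t assume "t \<in> {0..T} - {}"
    then have "(Kt t *v z t) \<bullet> (R t *v (Kt t *v y t)) = (Kt t *v y t) \<bullet> (R t *v (Kt t *v z t))"
      by (auto intro!: posdef_swap R_pos)
    then show "(Kt t *v y t) \<bullet> (R t *v (Kt t *v z t)) = (1/2) *\<^sub>R (?q (\<lambda>t. y t + z t) t - ?q y t - ?q z t)"
      by (simp add: matrix_vector_right_distrib inner_add_left inner_add_right)
  qed
qed

text \<open>The components of \<open>\<Phi>\<^sup>T \<Sigma> C\<^sup>T K\<^sup>T y\<close> are polarised energies \<open>K\<^sup>T z \<bullet> R K\<^sup>T y\<close>, with \<open>z\<close> a column of
  \<open>\<Phi>\<close>, and these are integrable. The matrices \<open>\<Phi>\<^sup>T \<Sigma>\<close> are uniformly invertible on the compact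
  interval, which bounds \<open>C\<^sup>T K\<^sup>T y\<close> itself.\<close>

lemma drift_integrable:
  assumes y: "sol y" and T: "0 \<le> T"
  shows "(\<lambda>t. transpose (C t) *v (Kt t *v y t)) absolutely_integrable_on {0..T}"
proof -
  let ?f = "\<lambda>t. transpose (C t) *v (Kt t *v y t)"
  define P where "P t = transpose (\<Phi> t 0) ** \<Sigma> t" for t
  have Pi: "(P t *v x) \<bullet> v = (\<Phi> t 0 *v v) \<bullet> (\<Sigma> t *v x)" for t x v
    by (simp add: P_def matrix_vector_mul_assoc[symmetric]) (metis dot_lmul_matrix inner_commute transpose_matrix_vector transpose_transpose)
  have Phic: "continuous_on {0..} (\<lambda>t. \<Phi> t 0)"
    using Phi unfolding transition_matrix_def
    by (metis has_vector_derivative_continuous continuous_on_eq_continuous_within atLeast_iff order_refl)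
  have trc: "continuous_on {0..T} (\<lambda>t. transpose (f t))" if "continuous_on {0..} f" for f :: "real \<Rightarrow> real^'p^'q"
    unfolding transpose_def
    by (intro continuous_intros continuous_onT that)
  have Pc: "continuous_on {0..T} P"
    unfolding P_def matrix_matrix_mult_def
    by (intro continuous_intros trc Phic continuous_onT Sigma_continuous)
  have "\<exists>\<kappa>>0. \<forall>t\<in>{0..T}. \<forall>x. \<kappa> * norm x \<le> norm (P t *v x)"
  proof (rule uniformly_injective[OF Pc])
    fix t x assume t: "t \<in> {0..T}" and 0: "P t *v x = 0"
    have "w \<bullet> (\<Sigma> t *v x) = 0" for w
      using transition_surj[OF Phi, of 0 t w] Pi[of t x] 0 t by auto
    then have "x \<bullet> (\<Sigma> t *v x) = 0" by blast
    then show "x = 0" using Sigma_pos[of t] t by (force simp: posdef_def)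
  qed
  then obtain \<kappa> where \<kappa>: "\<kappa> > 0" "\<And>t x. t \<in> {0..T} \<Longrightarrow> \<kappa> * norm x \<le> norm (P t *v x)" by blast
  have "(\<lambda>t. P t *v ?f t) absolutely_integrable_on {0..T}"
  proof (rule absolutely_integrable_componentwise)
    fix b :: "real^'d"
    have "(\<lambda>t. (Kt t *v (\<Phi> t 0 *v b)) \<bullet> (R t *v (Kt t *v y t))) absolutely_integrable_on {0..T}"
      by (intro R_form_integrable sol_Phi y T) simp
    then show "(\<lambda>t. (P t *v ?f t) \<bullet> b) absolutely_integrable_on {0..T}"
    proof (rule absolutely_integrable_spike[OF _ negligible_empty])
      fix t assume "t \<in> {0..T} - {}"
      then have t: "0 \<le> t" by simp
      have "(P t *v ?f t) \<bullet> b = (\<Sigma> t *v (\<Phi> t 0 *v b)) \<bullet> ?f t"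
        unfolding Pi by (rule posdef_sym[OF Sigma_pos[OF t]])
      also have "\<dots> = (C t *v (\<Sigma> t *v (\<Phi> t 0 *v b))) \<bullet> (Kt t *v y t)"
        by (simp only: inner_matrix_vector transpose_transpose)
      also have "\<dots> = (R t *v (Kt t *v (\<Phi> t 0 *v b))) \<bullet> (Kt t *v y t)"
        by (simp add: R_Kt t)
      finally show "(P t *v ?f t) \<bullet> b = (Kt t *v (\<Phi> t 0 *v b)) \<bullet> (R t *v (Kt t *v y t))"
        by (simp add: posdef_sym[OF R_pos[OF t]])
    qed
  qed
  then have "(\<lambda>t. (1/\<kappa>) *\<^sub>R norm (P t *v ?f t)) absolutely_integrable_on {0..T}"
    by (intro absolutely_integrable_scaleR_left absolutely_integrable_norm[unfolded o_def])
  then have g: "(\<lambda>t. (1/\<kappa>) *\<^sub>R norm (P t *v ?f t)) integrable_on {0..T}"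
    by (simp add: set_lebesgue_integral_eq_integral(1))
  show ?thesis
  proof (rule measurable_bounded_by_integrable_imp_absolutely_integrable[OF _ _ g])
    show "?f \<in> borel_measurable (lebesgue_on {0..T})"
      by (intro measurable_matrix_vector Kt_measurable y T continuous_on_imp_lebesgue_measurable trc C_cont)
    fix t assume "t \<in> {0..T}"
    then show "norm (?f t) \<le> (1/\<kappa>) *\<^sub>R norm (P t *v ?f t)"
      using \<kappa>(2)[of t "?f t"] \<kappa>(1) by (simp add: pos_le_divide_eq mult.commute del: transpose_matrix_vector)
  qed auto
qed

lemma gain_admissible:
  assumes "sol y" "0 \<le> T"
  shows "admissible C R T (\<lambda>t. Kt t *v y t)"
  unfolding admissible_def using assms Kt_measurable R_form_integrable_diag drift_integrable by auto

text \<open>The generator of \<open>\<Psi>\<close> is chosen such that \<open>r \<bullet> \<Sigma> r\<close> has derivative zero: the halved terms with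
  \<open>C\<^sup>T K\<^sup>T\<close> and \<open>\<Sigma>\<inverse> Q\<close>, counted twice, cancel the quadratic and the \<open>Q\<close> term of the Riccati equation.\<close>

lemma Psi_energy:
  assumes Psi: "transition_matrix
      (\<lambda>t. - transpose (A t) + (1/2) *\<^sub>R (transpose (C t) ** transpose (kalman_gain C R \<Sigma> t))
           - (1/2) *\<^sub>R (matrix_inv (\<Sigma> t) ** Q t)) \<Psi>" and T: "0 \<le> T"
  shows "(\<Psi> 0 T *v a) \<bullet> (\<Sigma> 0 *v (\<Psi> 0 T *v a)) = a \<bullet> (\<Sigma> T *v a)"
proof -
  define G where "G t = - transpose (A t) + (1/2) *\<^sub>R (transpose (C t) ** transpose (kalman_gain C R \<Sigma> t))
           - (1/2) *\<^sub>R (matrix_inv (\<Sigma> t) ** Q t)" for t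
  define r where "r t = \<Psi> t T *v a" for t
  have r: "(r has_vector_derivative G t *v r t) (at t within {0..})" if "0 \<le> t" for t
    using transition_vector(1)[OF Psi T that] unfolding r_def G_def .
  have rT: "r T = a" using transition_vector(2)[OF Psi T T] by (simp add: r_def)
  have "((\<lambda>s. r s \<bullet> (\<Sigma> s *v r s)) has_real_derivative 0) (at t within {0..})" if "t \<in> {0..}" for t
  proof -
    have t: "0 \<le> t" using that by simp
    let ?D = "A t ** \<Sigma> t + \<Sigma> t ** transpose (A t) + Q t - \<Sigma> t ** transpose (C t) ** matrix_inv (R t) ** C t ** \<Sigma> t"
    have "((\<lambda>s. r s \<bullet> (\<Sigma> s *v r s)) has_vector_derivative
       r t \<bullet> (\<Sigma> t *v (G t *v r t) + ?D *v r t) + (G t *v r t) \<bullet> (\<Sigma> t *v r t)) (at t within {0..})"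
      by (intro bounded_bilinear.has_vector_derivative[OF bounded_bilinear_inner]
          bounded_bilinear.has_vector_derivative[OF bounded_bilinear_matrix_vector] Sigma_derivative r t)
    moreover have "r t \<bullet> (\<Sigma> t *v (G t *v r t) + ?D *v r t) + (G t *v r t) \<bullet> (\<Sigma> t *v r t) = 0"
    proof -
      define v where "v = r t"
      define w where "w = \<Sigma> t *v v"
      have S: "v \<bullet> (\<Sigma> t *v x) = w \<bullet> x" for x unfolding w_def by (rule posdef_sym[OF Sigma_pos[OF t]])
      have Gv: "G t *v v = - (transpose (A t) *v v) + (1/2) *\<^sub>R (transpose (C t) *v (Kt t *v v)) - (1/2) *\<^sub>R (matrix_inv (\<Sigma> t) *v (Q t *v v))"
        by (simp add: G_def Kt_def matrix_vector_mult_add_rdistrib matrix_vector_mult_diff_rdistrib uminus_matrix_vector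
            matrix_vector_mul_assoc scaleR_matrix_vector_assoc[symmetric] del: transpose_matrix_vector)
      have wi: "w \<bullet> (matrix_inv (\<Sigma> t) *v x) = v \<bullet> x" for x
        using posdef_inv_sym[OF Sigma_pos[OF t]] posdef_inv(2)[OF Sigma_pos[OF t]] by (simp add: w_def)
      have Dv: "?D *v v = A t *v w + \<Sigma> t *v (transpose (A t) *v v) + Q t *v v - \<Sigma> t *v (transpose (C t) *v (Kt t *v v))"
        by (simp add: Kt_vector t matrix_vector_mult_add_rdistrib matrix_vector_mult_diff_rdistrib matrix_vector_mul_assoc[symmetric] w_def
           del: transpose_matrix_vector)
      have At: "v \<bullet> (A t *v w) = w \<bullet> (transpose (A t) *v v)"
        by (simp only: inner_matrix_vector[of v] inner_commute)
      have "v \<bullet> (\<Sigma> t *v (G t *v v) + ?D *v v) + (G t *v v) \<bullet> (\<Sigma> t *v v)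
         = 2 * (w \<bullet> (G t *v v)) + v \<bullet> (?D *v v)"
        by (simp add: inner_add_right S w_def[symmetric] inner_commute)
      also have "\<dots> = 0"
        unfolding Gv Dv
        by (simp add: inner_add_right inner_diff_right inner_minus_right S wi At algebra_simps del: transpose_matrix_vector)
      finally show ?thesis by (simp add: v_def)
    qed
    ultimately show ?thesis by (simp add: has_real_derivative_iff_has_vector_derivative)
  qed
  from DERIV_zero_half_line[OF this T] show ?thesis using rT by (simp add: r_def)
qed

end

section \<open>Normal laws and independence\<close>

text \<open>Every normal law, the degenerate one included, is an affine image of the standard one; this spares
  later arguments the case distinction.\<close>

lemma normal_law_std:
  assumes "0 \<le> v"
  shows "normal_law \<mu> v = distr std_normal_distribution borel (\<lambda>x. \<mu> + sqrt v * x)"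
proof (cases "v = 0")
  case True
  interpret S: prob_space std_normal_distribution by (intro prob_space_normal_density) simp
  have "distr std_normal_distribution borel (\<lambda>x. \<mu>) = return borel \<mu>"
    by (intro measure_eqI) (auto simp: emeasure_distr S.emeasure_space_1[simplified] split: split_indicator)
  then show ?thesis using True by (simp add: normal_law_def)
next
  case False
  interpret S: prob_space std_normal_distribution by (intro prob_space_normal_density) simp
  have "distributed std_normal_distribution lborel (\<lambda>x. x) std_normal_density"
    by (auto simp: distributed_def intro!: measure_eqI simp: emeasure_distr)
  from S.normal_density_affine[OF this, of "sqrt v" \<mu>] False assms
  have "distr std_normal_distribution lborel (\<lambda>x. \<mu> + sqrt v * x) = density lborel (normal_density \<mu> (sqrt v))"
    by (simp add: distributed_def)
  then show ?thesis using False
    by (simp add: normal_law_def distr_cong[OF refl sets_lborel refl, symmetric])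
qed

lemma prob_space_normal_law: "0 \<le> v \<Longrightarrow> prob_space (normal_law \<mu> v)"
  by (auto simp: normal_law_std intro!: prob_space.prob_space_distr prob_space_normal_density)

lemma sets_normal_law [simp, measurable_cong]: "sets (normal_law \<mu> v) = sets borel"
  by (simp add: normal_law_def)

lemma real_distribution_normal_law: "0 \<le> v \<Longrightarrow> real_distribution (normal_law \<mu> v)"
  by (simp add: real_distribution_def real_distribution_axioms_def prob_space_normal_law)

lemma char_normal_law:
  assumes "0 \<le> v"
  shows "char (normal_law \<mu> v) t = iexp (t * \<mu>) * complex_of_real (exp (- (v * t\<^sup>2) / 2))"
proof -
  have "char (normal_law \<mu> v) t = (CLINT x|std_normal_distribution. iexp (t * \<mu>) * iexp ((t * sqrt v) * x))"
    unfolding char_def normal_law_std[OF assms]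
    by (subst integral_distr) (auto simp: exp_add[symmetric] algebra_simps)
  also have "\<dots> = iexp (t * \<mu>) * char std_normal_distribution (t * sqrt v)"
    by (simp add: char_def)
  finally show ?thesis
    using assms by (simp add: char_std_normal_distribution power_mult_distrib mult.commute)
qed

lemma normal_law_moments:
  assumes "0 \<le> v"
  shows "integrable (normal_law \<mu> v) (\<lambda>x. x ^ k)"
    and "(\<integral>x. x \<partial>normal_law \<mu> v) = \<mu>"
    and "(\<integral>x. (x - \<mu>)\<^sup>2 \<partial>normal_law \<mu> v) = v"
proof -
  interpret S: prob_space std_normal_distribution by (intro prob_space_normal_density) simp
  have int: "integrable std_normal_distribution (\<lambda>x. x ^ k)" for k
    by (rule integrable_std_normal_distribution_moment)
  have "integrable std_normal_distribution (\<lambda>x. (\<mu> + sqrt v * x) ^ k)"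
    unfolding binomial_ring
    by (intro Bochner_Integration.integrable_sum) (auto simp: power_mult_distrib intro!: int)
  then show "integrable (normal_law \<mu> v) (\<lambda>x. x ^ k)"
    unfolding normal_law_std[OF assms] by (subst integrable_distr_eq) auto
  have m1: "(\<integral>x. x \<partial>std_normal_distribution) = 0"
    using integral_std_normal_distribution_moment_odd[of 1] by simp
  have m2: "(\<integral>x. x\<^sup>2 \<partial>std_normal_distribution) = 1"
  proof -
    have "fact (2 * 1) / (2 ^ 1 * fact 1) = (1::real)" by (simp add: fact_2)
    then show ?thesis using std_normal_distribution_even_moments(1)[of 1] by (simp only: mult_1_right)
  qed
  have i1: "integrable std_normal_distribution (\<lambda>x. sqrt v * x)"
    using int[of 1] by (simp only: power_one_right integrable_mult_right)
  have "(\<integral>x. x \<partial>normal_law \<mu> v) = (\<integral>x. \<mu> + sqrt v * x \<partial>std_normal_distribution)"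
    unfolding normal_law_std[OF assms] by (subst integral_distr) simp_all
  also have "\<dots> = (\<integral>x. \<mu> \<partial>std_normal_distribution) + (\<integral>x. sqrt v * x \<partial>std_normal_distribution)"
    by (rule Bochner_Integration.integral_add[OF S.integrable_const i1])
  also have "(\<integral>x. sqrt v * x \<partial>std_normal_distribution) = sqrt v * (\<integral>x. x \<partial>std_normal_distribution)"
    by (rule integral_mult_right_zero)
  finally show "(\<integral>x. x \<partial>normal_law \<mu> v) = \<mu>"
    by (simp only: m1 mult_zero_right add_0_right S.prob_space scaleR_one lebesgue_integral_const)
  have "(\<integral>x. (x - \<mu>)\<^sup>2 \<partial>normal_law \<mu> v) = (\<integral>x. v * x\<^sup>2 \<partial>std_normal_distribution)"
    unfolding normal_law_std[OF assms] using assms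
    by (subst integral_distr) (simp_all add: power_mult_distrib)
  also have "\<dots> = v * (\<integral>x. x\<^sup>2 \<partial>std_normal_distribution)"
    by (rule integral_mult_right_zero)
  finally show "(\<integral>x. (x - \<mu>)\<^sup>2 \<partial>normal_law \<mu> v) = v" by (simp only: m2 mult_1_right)
qed

context prob_space begin

lemma distr_char_unique:
  assumes "Y \<in> borel_measurable M" "real_distribution N"
    "\<And>s. (CLINT \<omega>|M. iexp (s * Y \<omega>)) = char N s"
  shows "distr M borel Y = N"
proof (rule Levy_uniqueness[OF _ assms(2)])
  show "real_distribution (distr M borel Y)" using assms(1) by (rule real_distribution_distr)
  show "char (distr M borel Y) = char N"
    using assms by (auto simp: char_def fun_eq_iff integral_distr)
qed

lemma normal_from_char:
  assumes "Y \<in> borel_measurable M" "0 \<le> v"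
    "\<And>s. (CLINT \<omega>|M. iexp (s * Y \<omega>)) = iexp (s * \<mu>) * complex_of_real (exp (- (v * s\<^sup>2) / 2))"
  shows "distr M borel Y = normal_law \<mu> v"
  using assms by (intro distr_char_unique real_distribution_normal_law) (simp_all add: char_normal_law)

lemma char_of_normal:
  assumes "Y \<in> borel_measurable M" "0 \<le> v" "distr M borel Y = normal_law \<mu> v"
  shows "(CLINT \<omega>|M. iexp (Y \<omega>)) = iexp \<mu> * complex_of_real (exp (- v / 2))"
proof -
  have "(CLINT \<omega>|M. iexp (Y \<omega>)) = char (distr M borel Y) 1"
    using assms(1) by (simp add: char_def integral_distr)
  then show ?thesis using assms by (simp add: char_normal_law)
qed

lemma normal_integrable_power:
  assumes "Y \<in> borel_measurable M" "0 \<le> v" "distr M borel Y = normal_law \<mu> v"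
  shows "integrable M (\<lambda>\<omega>. Y \<omega> ^ k)"
  using integrable_distr_eq[OF assms(1), of "\<lambda>x. x ^ k"] normal_law_moments(1)[OF assms(2)] assms(3)
  by simp

lemma normal_second_moment:
  assumes "Y \<in> borel_measurable M" "0 \<le> v" "distr M borel Y = normal_law 0 v"
  shows "(\<integral>\<^sup>+\<omega>. ennreal ((Y \<omega>)\<^sup>2) \<partial>M) = ennreal v"
proof -
  have "(\<integral>\<omega>. (Y \<omega>)\<^sup>2 \<partial>M) = v"
    using integral_distr[OF assms(1), of "\<lambda>x. x\<^sup>2"] normal_law_moments(3)[OF assms(2), of 0] assms(3) by simp
  then show ?thesis
    using normal_integrable_power[OF assms, of 2] by (simp add: nn_integral_eq_integral)
qed

lemma indep_vars_of_indep_sets: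
  assumes "indep_sets (\<lambda>i. sets (G i)) I"
    and "\<And>i. i \<in> I \<Longrightarrow> space (G i) = space M" "\<And>i. i \<in> I \<Longrightarrow> U i \<in> measurable (G i) (N i)"
  shows "indep_vars N U I"
  unfolding indep_vars_def2
proof (intro conjI ballI)
  have sub: "{U i -` A \<inter> space M |A. A \<in> sets (N i)} \<subseteq> sets (G i)" if "i \<in> I" for i
    using measurable_sets[OF assms(3)[OF that]] assms(2)[OF that] by auto
  show "indep_sets (\<lambda>i. {U i -` A \<inter> space M |A. A \<in> sets (N i)}) I"
    using assms(1) by (rule indep_sets_mono_sets) (use sub in auto)
  fix i assume i: "i \<in> I"
  have "sets (G i) \<subseteq> events" using assms(1) i by (simp add: indep_sets_def)
  then show "random_variable (N i) (U i)"
    using assms(2,3)[OF i] by (auto simp: measurable_def)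
qed

lemma iexp_integrable: "Y \<in> borel_measurable M \<Longrightarrow> integrable M (\<lambda>\<omega>. iexp (Y \<omega>))"
  by (intro integrable_iexp) auto

lemma iexp_indep_set:
  assumes ind: "indep_set (sets G1) (sets G2)" and sp: "space G1 = space M" "space G2 = space M"
    and U: "U \<in> borel_measurable G1" and V: "V \<in> borel_measurable G2"
  shows "(CLINT \<omega>|M. iexp (U \<omega> + V \<omega>)) = (CLINT \<omega>|M. iexp (U \<omega>)) * (CLINT \<omega>|M. iexp (V \<omega>))"
proof -
  have eq: "case_bool (sets G1) (sets G2) = (\<lambda>b. sets (case_bool G1 G2 b))"
    by (rule ext) (auto split: bool.split)
  have "indep_vars (case_bool borel borel) (case_bool U V) UNIV"
    by (rule indep_vars_of_indep_sets[OF ind[unfolded indep_set_def eq]])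
       (use sp U V in \<open>auto split: bool.split\<close>)
  then have iv: "indep_var borel U borel V" by (simp add: indep_var_def)
  have "indep_var borel ((\<lambda>x. iexp x) \<circ> U) borel ((\<lambda>x. iexp x) \<circ> V)"
    by (rule indep_var_compose[OF iv]) auto
  moreover have "U \<in> borel_measurable M" "V \<in> borel_measurable M"
    using indep_var_rv1[OF iv] indep_var_rv2[OF iv] by auto
  ultimately have "(CLINT \<omega>|M. iexp (U \<omega>) * iexp (V \<omega>)) = (CLINT \<omega>|M. iexp (U \<omega>)) * (CLINT \<omega>|M. iexp (V \<omega>))"
    using indep_var_lebesgue_integral[of "\<lambda>\<omega>. iexp (U \<omega>)" "\<lambda>\<omega>. iexp (V \<omega>)"] by (simp add: o_def iexp_integrable)
  then show ?thesis by (simp add: exp_add distrib_left)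
qed

end

lemma generated_algebra_simps:
  "space (generated_algebra M X I) = space M"
  "sets (generated_algebra M X I) = sigma_sets (space M) {X t -` A \<inter> space M | t A. t \<in> I \<and> A \<in> sets borel}"
  unfolding generated_algebra_def by (auto intro!: space_measure_of sets_measure_of)

lemma generated_algebra_measurable:
  assumes "t \<in> I" shows "X t \<in> borel_measurable (generated_algebra M X I)"
proof (rule measurableI)
  fix A :: "'b set" assume "A \<in> sets borel"
  then show "X t -` A \<inter> space (generated_algebra M X I) \<in> sets (generated_algebra M X I)"
    unfolding generated_algebra_simps using assms by (intro sigma_sets.Basic) auto
qed auto

section \<open>Elementary Wiener integrals\<close>

lemma partition_mono:
  assumes "partition_of T n \<tau>" "i \<le> j" "j \<le> n" shows "\<tau> i \<le> \<tau> j"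
  using assms(2,3)
proof (induction rule: dec_induct)
  case (step k)
  have "\<tau> k \<le> \<tau> (Suc k)" using assms(1) step.prems by (simp add: partition_of_def)
  then show ?case using step by simp
qed simp

lemma partition_range:
  assumes "partition_of T n \<tau>" "i \<le> n" shows "0 \<le> \<tau> i" "\<tau> i \<le> T"
  using partition_mono[OF assms(1), of 0 i] partition_mono[OF assms(1), of i n] assms
  by (auto simp: partition_of_def)

lemma step_function_on_piece:
  assumes p: "partition_of T n \<tau>" and i: "i < n" and t: "\<tau> i < t" "t \<le> \<tau> (Suc i)"
  shows "step_function n \<tau> x t = x i"
proof -
  have "indicator {\<tau> j<..\<tau> (Suc j)} t *\<^sub>R x j = (if j = i then x i else 0)" if "j < n" for j
    using partition_mono[OF p, of "Suc j" i] partition_mono[OF p, of "Suc i" j] that i t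
    by (cases j i rule: linorder_cases) (auto simp: indicator_def)
  then have "step_function n \<tau> x t = (\<Sum>j<n. if j = i then x i else 0)"
    unfolding step_function_def by (intro sum.cong) auto
  then show ?thesis using i by simp
qed

lemma step_function_borel: "step_function n \<tau> x \<in> borel_measurable borel"
  unfolding step_function_def[abs_def] by (intro borel_measurable_sum borel_measurable_scaleR borel_measurable_indicator) auto

lemma step_function_lebesgue: "step_function n \<tau> x \<in> borel_measurable (lebesgue_on S)"
  using step_function_borel by (intro measurable_restrict_space1 measurable_completion) auto

text \<open>The squared norm of \<open>L\<^sup>2(R dt)\<close>, the variance of the Wiener integral of \<open>f\<close>.\<close>

definition cov_form :: "(real \<Rightarrow> real^'n^'n) \<Rightarrow> real \<Rightarrow> (real \<Rightarrow> real^'n) \<Rightarrow> real" where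
  "cov_form R T f = integral {0..T} (\<lambda>t. f t \<bullet> (R t *v f t))"

lemma matrix_form_has_integral:
  fixes R :: "real \<Rightarrow> real^'n^'n"
  assumes "R integrable_on S"
  shows "((\<lambda>t. v \<bullet> (R t *v w)) has_integral v \<bullet> (integral S R *v w)) S"
proof -
  have "bounded_linear (\<lambda>M::real^'n^'n. v \<bullet> (M *v w))"
    by (rule bounded_linear_compose[OF bounded_linear_inner_right
        bounded_bilinear.bounded_linear_left[OF bounded_bilinear_matrix_vector]])
  from has_integral_linear[OF integrable_integral[OF assms] this]
  show ?thesis by (simp add: o_def)
qed

lemma step_function_form_integral:
  fixes R :: "real \<Rightarrow> real^'n^'n"
  assumes p: "partition_of T n \<tau>" and R: "R integrable_on {0..T}"
  shows "((\<lambda>t. step_function n \<tau> x t \<bullet> (R t *v step_function n \<tau> x t)) has_integral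
     (\<Sum>i<n. x i \<bullet> (integral {\<tau> i..\<tau> (Suc i)} R *v x i))) {0..T}"
proof -
  have "((\<lambda>t. step_function n \<tau> x t \<bullet> (R t *v step_function n \<tau> x t)) has_integral
     (\<Sum>i<k. x i \<bullet> (integral {\<tau> i..\<tau> (Suc i)} R *v x i))) {0..\<tau> k}" if "k \<le> n" for k
    using that
  proof (induction k)
    case 0
    then show ?case using p has_integral_refl(2) by (auto simp: partition_of_def)
  next
    case (Suc k)
    have r: "0 \<le> \<tau> k" "\<tau> k \<le> \<tau> (Suc k)" "\<tau> (Suc k) \<le> T"
      using partition_range[OF p] partition_mono[OF p, of k "Suc k"] Suc by auto
    have "R integrable_on {\<tau> k..\<tau> (Suc k)}"
      by (rule integrable_subinterval_real[OF R]) (use r in auto)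
    from matrix_form_has_integral[OF this]
    have "((\<lambda>t. step_function n \<tau> x t \<bullet> (R t *v step_function n \<tau> x t)) has_integral
      x k \<bullet> (integral {\<tau> k..\<tau> (Suc k)} R *v x k)) {\<tau> k..\<tau> (Suc k)}"
      by (rule has_integral_spike[of "{\<tau> k}", rotated -1])
         (use step_function_on_piece[OF p, of k _ x] Suc.prems in \<open>auto simp: less_le\<close>)
    from has_integral_combine[OF r(1,2) Suc.IH this]
    show ?case using Suc by simp
  qed
  from this[of n] p show ?thesis by (simp add: partition_of_def)
qed

text \<open>A step function together with its elementary integral. Keeping the two together makes the pairs a
  linear space, although the representation by a partition is not unique.\<close>

definition simple_pair ::
  "(real \<Rightarrow> 'a \<Rightarrow> real^'n) \<Rightarrow> real \<Rightarrow> (real \<Rightarrow> real^'n) \<Rightarrow> ('a \<Rightarrow> real) \<Rightarrow> bool" where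
  "simple_pair W T f I \<longleftrightarrow>
     (\<exists>n \<tau> x. partition_of T n \<tau> \<and> f = step_function n \<tau> x \<and> I = step_integral W n \<tau> x)"

text \<open>The sum telescopes. It is stated for an arbitrary \<open>G\<close> because it serves twice: for the paths of the
  process, and, with \<open>G\<close> the indicator of a half-line, for step functions.\<close>

lemma increment_refine:
  fixes G :: "real \<Rightarrow> 'b::real_vector"
  assumes \<rho>: "\<And>i j. i < j \<Longrightarrow> j \<le> N \<Longrightarrow> \<rho> i < (\<rho> j :: real)"
    and ab: "a \<le> b" "b \<le> N"
  shows "G (\<rho> b) - G (\<rho> a) = (\<Sum>j<N. indicator {\<rho> a<..\<rho> b} (\<rho> (Suc j)) *\<^sub>R (G (\<rho> (Suc j)) - G (\<rho> j)))"
proof -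
  have le: "\<rho> i \<le> \<rho> j \<longleftrightarrow> i \<le> j" if "i \<le> N" "j \<le> N" for i j
    using \<rho>[of i j] \<rho>[of j i] that by (cases i j rule: linorder_cases) auto
  have "indicator {\<rho> a<..\<rho> b} (\<rho> (Suc j)) = (if a \<le> j \<and> j < b then 1 else (0::real))" if "j < N" for j
    using le[of "Suc j" a] le[of "Suc j" b] that ab by (auto simp: indicator_def not_le[symmetric] Suc_le_eq)
  then have "(\<Sum>j<N. indicator {\<rho> a<..\<rho> b} (\<rho> (Suc j)) *\<^sub>R (G (\<rho> (Suc j)) - G (\<rho> j)))
     = (\<Sum>j<N. if a \<le> j \<and> j < b then G (\<rho> (Suc j)) - G (\<rho> j) else 0)"
    by (intro sum.cong) auto
  also have "\<dots> = (\<Sum>j\<in>{j\<in>{..<N}. a \<le> j \<and> j < b}. G (\<rho> (Suc j)) - G (\<rho> j))"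
    by (rule sum.inter_filter[symmetric]) simp
  also have "{j\<in>{..<N}. a \<le> j \<and> j < b} = {a..<b}" using ab by auto
  also have "(\<Sum>j\<in>{a..<b}. G (\<rho> (Suc j)) - G (\<rho> j)) = G (\<rho> b) - G (\<rho> a)"
    using sum_Suc_diff'[OF ab(1), of "\<lambda>j. G (\<rho> j)"] by simp
  finally show ?thesis ..
qed

text \<open>On a finer partition a step function takes on each piece its value at the right endpoint, as the
  pieces are left-open.\<close>

lemma refine_step:
  fixes W :: "real \<Rightarrow> 'a \<Rightarrow> real^'n" and x :: "nat \<Rightarrow> real^'n"
  assumes p: "partition_of T n \<tau>" and \<rho>: "\<And>i j. i < j \<Longrightarrow> j \<le> N \<Longrightarrow> \<rho> i < (\<rho> j :: real)"
    and sub: "\<tau> ` {..n} \<subseteq> \<rho> ` {..N}"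
  defines "y \<equiv> \<lambda>j. step_function n \<tau> x (\<rho> (Suc j))"
  shows "step_integral W n \<tau> x = step_integral W N \<rho> y" "step_function n \<tau> x = step_function N \<rho> y"
proof -
  have inc: "G (\<tau> (Suc i)) - G (\<tau> i) =
     (\<Sum>j<N. indicator {\<tau> i<..\<tau> (Suc i)} (\<rho> (Suc j)) *\<^sub>R (G (\<rho> (Suc j)) - G (\<rho> j)))"
    if "i < n" for i and G :: "real \<Rightarrow> 'c::real_vector"
  proof -
    have "\<tau> i \<in> \<rho> ` {..N}" "\<tau> (Suc i) \<in> \<rho> ` {..N}" using sub that by auto
    then obtain a b where ab: "\<tau> i = \<rho> a" "\<tau> (Suc i) = \<rho> b" "a \<le> N" "b \<le> N"
      by (metis atMost_iff imageE)
    have "\<tau> i \<le> \<tau> (Suc i)" using p that by (simp add: partition_of_def)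
    then have "a \<le> b" using \<rho>[of b a] ab by (cases "a \<le> b") auto
    then show ?thesis using increment_refine[OF \<rho>, where a=a and b=b and G=G] ab by simp
  qed
  show "step_integral W n \<tau> x = step_integral W N \<rho> y"
  proof
    fix \<omega>
    have "step_integral W n \<tau> x \<omega> =
       (\<Sum>i<n. \<Sum>j<N. (indicator {\<tau> i<..\<tau> (Suc i)} (\<rho> (Suc j)) *\<^sub>R x i) \<bullet> (W (\<rho> (Suc j)) \<omega> - W (\<rho> j) \<omega>))"
      unfolding step_integral_def
    proof (rule sum.cong[OF refl], goal_cases)
      case (1 i)
      then show ?case using inc[of i "\<lambda>s. W s \<omega>"] by (simp add: inner_sum_right)
    qed
    also have "\<dots> = step_integral W N \<rho> y \<omega>"
      unfolding step_integral_def y_def step_function_def inner_sum_left by (rule sum.swap)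
    finally show "step_integral W n \<tau> x \<omega> = step_integral W N \<rho> y \<omega>" .
  qed
  show "step_function n \<tau> x = step_function N \<rho> y"
  proof
    fix r :: real
    \<comment> \<open>an increment of \<open>G\<close> is the indicator of a left-open interval, evaluated at \<open>r\<close>\<close>
    define G where "G s = - (if r \<le> s then 0 else (1::real))" for s
    have ind: "indicator {s<..t} r = G t - G s" if "s \<le> t" for s t
      using that by (auto simp: G_def indicator_def)
    have \<rho>le: "\<rho> j \<le> \<rho> (Suc j)" if "j < N" for j using \<rho>[of j "Suc j"] that by simp
    have "step_function n \<tau> x r =
       (\<Sum>i<n. \<Sum>j<N. (G (\<rho> (Suc j)) - G (\<rho> j)) *\<^sub>R indicator {\<tau> i<..\<tau> (Suc i)} (\<rho> (Suc j)) *\<^sub>R x i)"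
      unfolding step_function_def
    proof (rule sum.cong[OF refl], goal_cases)
      case (1 i)
      then have "indicator {\<tau> i<..\<tau> (Suc i)} r = G (\<tau> (Suc i)) - G (\<tau> i)"
        using p by (intro ind) (auto simp: partition_of_def)
      also have "\<dots> = (\<Sum>j<N. indicator {\<tau> i<..\<tau> (Suc i)} (\<rho> (Suc j)) *\<^sub>R (G (\<rho> (Suc j)) - G (\<rho> j)))"
        using 1 by (intro inc) simp
      finally show ?case by (simp only: scaleR_sum_left scaleR_scaleR real_scaleR_def mult.commute)
    qed
    also have "\<dots> = (\<Sum>j<N. \<Sum>i<n. (G (\<rho> (Suc j)) - G (\<rho> j)) *\<^sub>R indicator {\<tau> i<..\<tau> (Suc i)} (\<rho> (Suc j)) *\<^sub>R x i)"
      by (rule sum.swap)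
    also have "\<dots> = step_function N \<rho> y r"
      unfolding step_function_def[of N] y_def
      by (rule sum.cong[OF refl]) (simp only: ind \<rho>le lessThan_iff scaleR_sum_right[symmetric] step_function_def)
    finally show "step_function n \<tau> x r = step_function N \<rho> y r" .
  qed
qed

text \<open>Both step functions are rewritten on the increasing enumeration of all their grid points.\<close>

lemma simple_pair_lincomb:
  fixes W :: "real \<Rightarrow> 'a \<Rightarrow> real^'n"
  assumes "simple_pair W T f I" "simple_pair W T g J"
  shows "simple_pair W T (\<lambda>t. c *\<^sub>R f t + g t) (\<lambda>\<omega>. c * I \<omega> + J \<omega>)"
proof -
  obtain n \<tau> x where f: "partition_of T n \<tau>" "f = step_function n \<tau> x" "I = step_integral W n \<tau> x"
    using assms(1) by (auto simp: simple_pair_def)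
  obtain n' \<tau>' x' where g: "partition_of T n' \<tau>'" "g = step_function n' \<tau>' x'" "J = step_integral W n' \<tau>' x'"
    using assms(2) by (auto simp: simple_pair_def)
  define P where "P = \<tau> ` {..n} \<union> \<tau>' ` {..n'}"
  define L where "L = sorted_list_of_set P"
  define N where "N = card P - 1"
  define \<rho> where "\<rho> i = L ! i" for i
  have P: "finite P" "\<tau> 0 \<in> P" by (auto simp: P_def)
  have cP: "card P > 0" using P by (auto simp: card_gt_0_iff)
  have L: "length L = Suc N" "set L = P" "sorted_wrt (<) L"
    using P cP by (auto simp: L_def N_def)
  have \<rho>: "\<rho> i < \<rho> j" if "i < j" "j \<le> N" for i j
    unfolding \<rho>_def by (rule sorted_wrt_nth_less[OF L(3)]) (use that L(1) in auto)
  have im: "\<rho> ` {..N} = P"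
    unfolding L(2)[symmetric] \<rho>_def set_conv_nth L(1) by (auto simp: less_Suc_eq_le)
  have Pr: "P \<subseteq> {0..T}" using partition_range[OF f(1)] partition_range[OF g(1)] by (auto simp: P_def)
  have "0 \<in> P" "T \<in> P" using f(1) unfolding P_def partition_of_def by (metis UnI1 atMost_iff imageI le0 order_refl)+
  then obtain a b where ab: "\<rho> a = 0" "a \<le> N" "\<rho> b = T" "b \<le> N" using im by (metis atMost_iff imageE)
  have mem: "\<rho> i \<in> {0..T}" if "i \<le> N" for i using im Pr that by auto
  have "a = 0" using \<rho>[of 0 a] mem[of 0] ab by (cases a) auto
  moreover have "b = N" using \<rho>[of b N] mem[of N] ab by (cases "b = N") auto
  ultimately have part: "partition_of T N \<rho>"
    using ab \<rho> by (auto simp: partition_of_def less_imp_le)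
  have sub: "\<tau> ` {..n} \<subseteq> \<rho> ` {..N}" "\<tau>' ` {..n'} \<subseteq> \<rho> ` {..N}" unfolding im by (auto simp: P_def)
  \<comment> \<open>both step functions on the common grid \<open>\<rho>\<close>\<close>
  define y z where "y j = step_function n \<tau> x (\<rho> (Suc j))" and "z j = step_function n' \<tau>' x' (\<rho> (Suc j))" for j
  have fy: "f = step_function N \<rho> y" "I = step_integral W N \<rho> y"
    and gz: "g = step_function N \<rho> z" "J = step_integral W N \<rho> z"
    unfolding f g y_def z_def
    using refine_step[OF f(1) \<rho> sub(1)] refine_step[OF g(1) \<rho> sub(2)] by auto
  show ?thesis
    unfolding simple_pair_def
  proof (intro exI conjI)
    show "(\<lambda>t. c *\<^sub>R f t + g t) = step_function N \<rho> (\<lambda>j. c *\<^sub>R y j + z j)"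
      unfolding fy gz step_function_def
      by (rule ext) (simp only: scaleR_right_distrib sum.distrib scaleR_sum_right scaleR_scaleR mult.commute)
    show "(\<lambda>\<omega>. c * I \<omega> + J \<omega>) = step_integral W N \<rho> (\<lambda>j. c *\<^sub>R y j + z j)"
      unfolding fy gz step_integral_def
      by (simp add: inner_add_left sum.distrib sum_distrib_left)
  qed (rule part)
qed

lemma simple_pair_zero: "0 \<le> T \<Longrightarrow> simple_pair W T (\<lambda>t. 0) (\<lambda>\<omega>. 0)"
  unfolding simple_pair_def
  by (intro exI[of _ 1] exI[of _ "\<lambda>i. if i = 0 then 0 else T"] exI[of _ "\<lambda>_. 0"])
     (auto simp: partition_of_def step_function_def[abs_def] step_integral_def[abs_def])

text \<open>The same squared norm with values in \<open>[0, \<infinity>]\<close>, which is meaningful before integrability is known.\<close>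

definition cov_nn :: "(real \<Rightarrow> real^'n^'n) \<Rightarrow> real \<Rightarrow> (real \<Rightarrow> real^'n) \<Rightarrow> ennreal" where
  "cov_nn R T f = (\<integral>\<^sup>+t. ennreal (f t \<bullet> (R t *v f t)) \<partial>lebesgue_on {0..T})"

lemma posdef_form_add_le:
  assumes "posdef S"
  shows "(v + w) \<bullet> (S *v (v + w)) \<le> 2 * (v \<bullet> (S *v v)) + 2 * (w \<bullet> (S *v w))"
proof -
  have "0 \<le> (v - w) \<bullet> (S *v (v - w))" by (rule posdef_nonneg[OF assms])
  then show ?thesis
    by (simp add: matrix_vector_mult_diff_distrib matrix_vector_right_distrib inner_add_left inner_add_right
        inner_diff_left inner_diff_right)
qed

locale covariance_rate =
  fixes R :: "real \<Rightarrow> real^'n^'n"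
  assumes R_pos: "0 \<le> t \<Longrightarrow> posdef (R t)"
    and R_int: "0 \<le> t \<Longrightarrow> R absolutely_integrable_on {0..t}"
begin

lemma R_integrable: "0 \<le> s \<Longrightarrow> R integrable_on {s..t}"
proof (cases "0 \<le> t")
  case True
  then have "R integrable_on {0..t}" using R_int[of t] by (simp add: set_lebesgue_integral_eq_integral(1))
  then show "0 \<le> s \<Longrightarrow> R integrable_on {s..t}" by (rule integrable_subinterval_real) auto
qed auto

lemma R_meas: "R \<in> borel_measurable (lebesgue_on {0..T})"
proof (cases "0 \<le> T")
  case True
  then show ?thesis using R_int absolutely_integrable_measurable[of "{0..T}" R] by auto
next
  case False
  then have "{0..T} = {}" by simp
  then show ?thesis by (auto simp: measurable_def space_restrict_space)
qed

lemma form_measurable: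
  assumes "f \<in> borel_measurable (lebesgue_on {0..T})" "g \<in> borel_measurable (lebesgue_on {0..T})"
  shows "(\<lambda>t. f t \<bullet> (R t *v g t)) \<in> borel_measurable (lebesgue_on {0..T})"
  using assms by (intro borel_measurable_inner measurable_matrix_vector R_meas)

lemma form_nonneg: "t \<in> space (lebesgue_on {0..T}) \<Longrightarrow> 0 \<le> v \<bullet> (R t *v v)"
  by (intro posdef_nonneg R_pos) (simp add: space_restrict_space)

lemma cov_nn_add_le:
  assumes "f \<in> borel_measurable (lebesgue_on {0..T})" "g \<in> borel_measurable (lebesgue_on {0..T})"
  shows "cov_nn R T (\<lambda>t. f t + g t) \<le> 2 * cov_nn R T f + 2 * cov_nn R T g"
proof -
  have "cov_nn R T (\<lambda>t. f t + g t) \<le> (\<integral>\<^sup>+t. 2 * ennreal (f t \<bullet> (R t *v f t)) + 2 * ennreal (g t \<bullet> (R t *v g t)) \<partial>lebesgue_on {0..T})"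
    unfolding cov_nn_def
  proof (rule nn_integral_mono)
    fix t assume t: "t \<in> space (lebesgue_on {0..T})"
    have "ennreal ((f t + g t) \<bullet> (R t *v (f t + g t))) \<le> ennreal (2 * (f t \<bullet> (R t *v f t)) + 2 * (g t \<bullet> (R t *v g t)))"
      by (intro ennreal_leI posdef_form_add_le R_pos) (use t in \<open>simp add: space_restrict_space\<close>)
    also have "\<dots> = 2 * ennreal (f t \<bullet> (R t *v f t)) + 2 * ennreal (g t \<bullet> (R t *v g t))"
      using form_nonneg[OF t] by (simp add: ennreal_mult')
    finally show "ennreal ((f t + g t) \<bullet> (R t *v (f t + g t))) \<le> 2 * ennreal (f t \<bullet> (R t *v f t)) + 2 * ennreal (g t \<bullet> (R t *v g t))" .
  qed
  also have "\<dots> = 2 * cov_nn R T f + 2 * cov_nn R T g"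
    unfolding cov_nn_def using form_measurable[OF assms(1,1)] form_measurable[OF assms(2,2)]
    by (subst nn_integral_add) (auto simp: nn_integral_cmult)
  finally show ?thesis .
qed

lemma cov_nn_scale: "cov_nn R T (\<lambda>t. c *\<^sub>R f t) = ennreal (c\<^sup>2) * cov_nn R T f"
  if "f \<in> borel_measurable (lebesgue_on {0..T})"
proof -
  have "cov_nn R T (\<lambda>t. c *\<^sub>R f t) = (\<integral>\<^sup>+t. ennreal (c\<^sup>2) * ennreal (f t \<bullet> (R t *v f t)) \<partial>lebesgue_on {0..T})"
    unfolding cov_nn_def
    by (intro nn_integral_cong) (simp add: matrix_vector_mult_scaleR ennreal_mult'[symmetric] power2_eq_square mult.assoc)
  then show ?thesis unfolding cov_nn_def
    using form_measurable[OF that that] by (simp add: nn_integral_cmult)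
qed

lemma cov_nn_eq_cov_form:
  assumes "(\<lambda>t. f t \<bullet> (R t *v f t)) absolutely_integrable_on {0..T}"
  shows "cov_nn R T f = ennreal (cov_form R T f)" "0 \<le> cov_form R T f"
proof -
  have int: "integrable (lebesgue_on {0..T}) (\<lambda>t. f t \<bullet> (R t *v f t))"
    using assms by (simp add: integrable_restrict_space set_integrable_def)
  have "cov_nn R T f = ennreal (\<integral>t. f t \<bullet> (R t *v f t) \<partial>lebesgue_on {0..T})"
    unfolding cov_nn_def by (rule nn_integral_eq_integral[OF int]) (auto intro!: AE_I2 form_nonneg)
  then show "cov_nn R T f = ennreal (cov_form R T f)"
    unfolding cov_form_def using lebesgue_integral_eq_integral[OF int] by simp
  show "0 \<le> cov_form R T f"
    unfolding cov_form_def using assms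
    by (intro integral_nonneg posdef_nonneg R_pos) (auto simp: set_lebesgue_integral_eq_integral(1))
qed

lemma form_integral_nonneg:
  assumes "0 \<le> s" shows "0 \<le> v \<bullet> (integral {s..t} R *v v)"
  using matrix_form_has_integral[OF R_integrable[OF assms], of v v]
  by (rule has_integral_nonneg) (use assms in \<open>auto intro!: posdef_nonneg R_pos\<close>)

lemma simple_form_integrable:
  assumes "simple_pair W T f I" "0 \<le> T"
  shows "(\<lambda>t. f t \<bullet> (R t *v f t)) absolutely_integrable_on {0..T}"
    and "f \<in> borel_measurable (lebesgue_on {0..T})"
proof -
  obtain n \<tau> x where f: "partition_of T n \<tau>" "f = step_function n \<tau> x"
    using assms(1) by (auto simp: simple_pair_def)
  show "(\<lambda>t. f t \<bullet> (R t *v f t)) absolutely_integrable_on {0..T}"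
    using step_function_form_integral[OF f(1) R_integrable[OF order_refl], of x] f(2)
    by (intro nonnegative_absolutely_integrable_1) (auto intro!: posdef_nonneg R_pos has_integral_integrable)
  show "f \<in> borel_measurable (lebesgue_on {0..T})" using f(2) step_function_lebesgue by auto
qed

end

locale wiener = prob_space M + covariance_rate R
  for M :: "'a measure" and R :: "real \<Rightarrow> real^'n^'n" +
  fixes W :: "real \<Rightarrow> 'a \<Rightarrow> real^'n"
  assumes W: "wiener_process M W R"
begin

lemma W_measurable: "0 \<le> t \<Longrightarrow> W t \<in> borel_measurable M"
  using W by (simp add: wiener_process_def)

lemma step_integral_measurable:
  assumes "\<And>i. i < n \<Longrightarrow> \<tau> i \<in> S \<and> \<tau> (Suc i) \<in> S"
  shows "step_integral W n \<tau> x \<in> borel_measurable (generated_algebra M W S)"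
  unfolding step_integral_def[abs_def]
  by (intro borel_measurable_sum borel_measurable_inner borel_measurable_const borel_measurable_diff
      generated_algebra_measurable) (use assms in auto)

lemma simple_measurable:
  assumes "simple_pair W T f I"
  shows "I \<in> borel_measurable (generated_algebra M W {0..})" "I \<in> borel_measurable M"
proof -
  obtain n \<tau> x where f: "partition_of T n \<tau>" "I = step_integral W n \<tau> x"
    using assms(1) by (auto simp: simple_pair_def)
  show "I \<in> borel_measurable (generated_algebra M W {0..})"
    unfolding f(2) by (rule step_integral_measurable) (use partition_range[OF f(1)] in auto)
  have "0 \<le> \<tau> i" "0 \<le> \<tau> (Suc i)" if "i < n" for i using partition_range[OF f(1)] that by auto
  then show "I \<in> borel_measurable M"
    unfolding f(2) step_integral_def[abs_def]
    by (intro borel_measurable_sum borel_measurable_inner borel_measurable_const borel_measurable_diff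
      W_measurable) auto
qed

text \<open>Induction over the pieces: the increment over the next piece is independent of the past, and its
  characteristic function contributes one summand to the exponent.\<close>

lemma simple_char:
  assumes "simple_pair W T f I" "0 \<le> T"
  shows "(CLINT \<omega>|M. iexp (I \<omega>)) = complex_of_real (exp (- cov_form R T f / 2))"
proof -
  obtain n \<tau> x where f: "partition_of T n \<tau>" "f = step_function n \<tau> x" "I = step_integral W n \<tau> x"
    using assms(1) by (auto simp: simple_pair_def)
  have "(CLINT \<omega>|M. iexp (step_integral W k \<tau> x \<omega>)) =
     complex_of_real (exp (- (\<Sum>i<k. x i \<bullet> (integral {\<tau> i..\<tau> (Suc i)} R *v x i)) / 2))" if "k \<le> n" for k
    using that
  proof (induction k)
    case 0
    then show ?case by (simp add: step_integral_def prob_space)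
  next
    case (Suc k)
    have r: "0 \<le> \<tau> k" "\<tau> k \<le> \<tau> (Suc k)"
      using partition_range[OF f(1)] partition_mono[OF f(1), of k "Suc k"] Suc.prems by auto
    define D where "D \<omega> = W (\<tau> (Suc k)) \<omega> - W (\<tau> k) \<omega>" for \<omega>
    have ind: "indep_set (sets (generated_algebra M W {0..\<tau> k})) (sets (vimage_algebra (space M) D borel))"
      and g: "gaussian_vector M D 0 (integral {\<tau> k..\<tau> (Suc k)} R)"
      using W r unfolding wiener_process_def D_def by blast+
    have U: "step_integral W k \<tau> x \<in> borel_measurable (generated_algebra M W {0..\<tau> k})"
    proof (rule step_integral_measurable)
      fix i assume "i < k"
      then show "\<tau> i \<in> {0..\<tau> k} \<and> \<tau> (Suc i) \<in> {0..\<tau> k}"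
        using partition_range[OF f(1)] partition_mono[OF f(1)] Suc.prems by auto
    qed
    have Dm: "D \<in> measurable (vimage_algebra (space M) D borel) borel"
      by (rule measurable_vimage_algebra1) auto
    then have V: "(\<lambda>\<omega>. x k \<bullet> D \<omega>) \<in> borel_measurable (vimage_algebra (space M) D borel)"
      by (intro borel_measurable_inner borel_measurable_const)
    have "D \<in> borel_measurable M" using g by (simp add: gaussian_vector_def)
    then have "(CLINT \<omega>|M. iexp (x k \<bullet> D \<omega>)) =
        iexp 0 * complex_of_real (exp (- (x k \<bullet> (integral {\<tau> k..\<tau> (Suc k)} R *v x k)) / 2))"
      using g r form_integral_nonneg
      by (intro char_of_normal borel_measurable_inner borel_measurable_const) (auto simp: gaussian_vector_def)
    moreover have "(CLINT \<omega>|M. iexp (step_integral W (Suc k) \<tau> x \<omega>)) =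
        (CLINT \<omega>|M. iexp (step_integral W k \<tau> x \<omega> + x k \<bullet> D \<omega>))"
      by (simp add: step_integral_def D_def)
    moreover have "\<dots> = (CLINT \<omega>|M. iexp (step_integral W k \<tau> x \<omega>)) * (CLINT \<omega>|M. iexp (x k \<bullet> D \<omega>))"
      by (rule iexp_indep_set[OF ind _ _ U V]) (auto simp: generated_algebra_simps)
    ultimately show ?case
      using Suc by (simp add: exp_add[symmetric] add_divide_distrib diff_divide_distrib exp_of_real[symmetric])
  qed
  moreover have "cov_form R T f = (\<Sum>i<n. x i \<bullet> (integral {\<tau> i..\<tau> (Suc i)} R *v x i))"
    unfolding cov_form_def f(2) by (intro integral_unique step_function_form_integral f(1) R_integrable) simp
  ultimately show ?thesis using f(3) by simp
qed

lemma cov_form_scale: "cov_form R T (\<lambda>t. c *\<^sub>R f t) = c\<^sup>2 * cov_form R T f"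
  unfolding cov_form_def
  by (simp add: matrix_vector_mult_scaleR power2_eq_square mult.assoc)

lemma simple_scale:
  assumes "simple_pair W T f I" "0 \<le> T"
  shows "simple_pair W T (\<lambda>t. c *\<^sub>R f t) (\<lambda>\<omega>. c * I \<omega>)"
  using simple_pair_lincomb[OF assms(1) simple_pair_zero[OF assms(2)]] by simp

text \<open>The Ito isometry, read off from the normal law of an elementary integral.\<close>

lemma simple_isometry:
  assumes "simple_pair W T f I" "0 \<le> T"
  shows "(\<integral>\<^sup>+\<omega>. ennreal ((I \<omega>)\<^sup>2) \<partial>M) = cov_nn R T f"
proof -
  note c = cov_nn_eq_cov_form[OF simple_form_integrable(1)[OF assms]]
  have "distr M borel I = normal_law 0 (cov_form R T f)"
  proof (rule normal_from_char[OF simple_measurable(2)[OF assms(1)] c(2)])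
    fix s
    show "(CLINT \<omega>|M. iexp (s * I \<omega>)) = iexp (s * 0) * complex_of_real (exp (- (cov_form R T f * s\<^sup>2) / 2))"
      using simple_char[OF simple_scale[OF assms], of s] assms(2) by (simp add: cov_form_scale mult.commute)
  qed
  then show ?thesis
    unfolding c(1) by (intro normal_second_moment simple_measurable(2)[OF assms(1)] c(2))
qed

end

section \<open>Wiener integrals as mean-square limits\<close>

lemma ennreal_tendsto_zero_le:
  fixes f g :: "'b \<Rightarrow> ennreal"
  assumes "(g \<longlongrightarrow> 0) F" "\<And>k. f k \<le> g k"
  shows "(f \<longlongrightarrow> 0) F"
  by (rule tendsto_sandwich[of "\<lambda>_. 0" f F g]) (use assms in auto)

lemma ennreal_lincomb_tendsto_zero:
  fixes f g :: "'b \<Rightarrow> ennreal"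
  assumes "(f \<longlongrightarrow> 0) F" "(g \<longlongrightarrow> 0) F" "a < top" "b < top"
  shows "((\<lambda>k. a * f k + b * g k) \<longlongrightarrow> 0) F"
proof -
  have "((\<lambda>k. a * f k + b * g k) \<longlongrightarrow> a * 0 + b * 0) F"
    by (intro tendsto_add ennreal_tendsto_cmult assms) 
  then show ?thesis by simp
qed

lemma square_add_le: "ennreal ((x + y)\<^sup>2) \<le> 2 * ennreal (x\<^sup>2) + 2 * ennreal (y\<^sup>2)"
proof -
  have "(x + y)\<^sup>2 \<le> 2 * x\<^sup>2 + 2 * y\<^sup>2" using sum_squares_bound[of x y] by (simp add: power2_sum)
  then have "ennreal ((x + y)\<^sup>2) \<le> ennreal (2 * x\<^sup>2 + 2 * y\<^sup>2)" by (rule ennreal_leI)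
  then show ?thesis by (simp add: ennreal_mult')
qed

lemma L2_add_le:
  fixes X Y :: "'a \<Rightarrow> real"
  assumes [measurable]: "X \<in> borel_measurable M" "Y \<in> borel_measurable M"
  shows "(\<integral>\<^sup>+\<omega>. ennreal ((X \<omega> + Y \<omega>)\<^sup>2) \<partial>M) \<le> 2 * (\<integral>\<^sup>+\<omega>. ennreal ((X \<omega>)\<^sup>2) \<partial>M) + 2 * (\<integral>\<^sup>+\<omega>. ennreal ((Y \<omega>)\<^sup>2) \<partial>M)"
proof -
  have "(\<integral>\<^sup>+\<omega>. ennreal ((X \<omega> + Y \<omega>)\<^sup>2) \<partial>M) \<le> (\<integral>\<^sup>+\<omega>. 2 * ennreal ((X \<omega>)\<^sup>2) + 2 * ennreal ((Y \<omega>)\<^sup>2) \<partial>M)"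
    by (intro nn_integral_mono square_add_le)
  also have "\<dots> = 2 * (\<integral>\<^sup>+\<omega>. ennreal ((X \<omega>)\<^sup>2) \<partial>M) + 2 * (\<integral>\<^sup>+\<omega>. ennreal ((Y \<omega>)\<^sup>2) \<partial>M)"
    by (subst nn_integral_add) (auto simp: nn_integral_cmult)
  finally show ?thesis .
qed

lemma L2_scale:
  fixes X :: "'a \<Rightarrow> real"
  assumes [measurable]: "X \<in> borel_measurable M"
  shows "(\<integral>\<^sup>+\<omega>. ennreal ((c * X \<omega>)\<^sup>2) \<partial>M) = ennreal (c\<^sup>2) * (\<integral>\<^sup>+\<omega>. ennreal ((X \<omega>)\<^sup>2) \<partial>M)"
  by (simp add: power_mult_distrib ennreal_mult' nn_integral_cmult)

lemma iexp_diff_le: "cmod (iexp x - iexp y) \<le> \<bar>x - y\<bar>"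
proof -
  have "iexp x - iexp y = iexp y * (iexp (x - y) - 1)"
    by (simp add: exp_add[symmetric] right_diff_distrib algebra_simps)
  then have "cmod (iexp x - iexp y) = cmod (iexp (x - y) - 1)" by (simp add: norm_mult)
  also have "\<dots> \<le> \<bar>x - y\<bar>" using iexp_approx1[of "x - y" 0] by simp
  finally show ?thesis .
qed

text \<open>Characteristic functions pass to mean-square limits: \<open>iexp\<close> is Lipschitz, and
  \<open>d \<le> e/2 + d\<^sup>2 / (2 e)\<close> bounds the first moment of the difference by its second moment.\<close>

lemma (in prob_space) iexp_L2_limit:
  assumes [measurable]: "U \<in> borel_measurable M" "\<And>k. S k \<in> borel_measurable M" "I \<in> borel_measurable M"
    and lim: "(\<lambda>k. \<integral>\<^sup>+\<omega>. ennreal ((S k \<omega> - I \<omega>)\<^sup>2) \<partial>M) \<longlonglongrightarrow> 0"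
  shows "(\<lambda>k. CLINT \<omega>|M. iexp (U \<omega> + S k \<omega>)) \<longlonglongrightarrow> (CLINT \<omega>|M. iexp (U \<omega> + I \<omega>))"
proof (rule LIMSEQ_I)
  fix e :: real assume e: "e > 0"
  have le: "ennreal (cmod ((CLINT \<omega>|M. iexp (U \<omega> + S k \<omega>)) - (CLINT \<omega>|M. iexp (U \<omega> + I \<omega>))))
      \<le> ennreal (e/2) + ennreal (1 / (2*e)) * (\<integral>\<^sup>+\<omega>. ennreal ((S k \<omega> - I \<omega>)\<^sup>2) \<partial>M)" for k
  proof -
    have int: "integrable M (\<lambda>\<omega>. iexp (U \<omega> + S k \<omega>))" "integrable M (\<lambda>\<omega>. iexp (U \<omega> + I \<omega>))"
      by (intro iexp_integrable; measurable)+
    have "ennreal (cmod ((CLINT \<omega>|M. iexp (U \<omega> + S k \<omega>)) - (CLINT \<omega>|M. iexp (U \<omega> + I \<omega>))))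
       = ennreal (cmod (CLINT \<omega>|M. iexp (U \<omega> + S k \<omega>) - iexp (U \<omega> + I \<omega>)))"
      using int by simp
    also have "\<dots> \<le> (\<integral>\<^sup>+\<omega>. ennreal (cmod (iexp (U \<omega> + S k \<omega>) - iexp (U \<omega> + I \<omega>))) \<partial>M)"
      by (rule integral_norm_bound_ennreal) (use int in \<open>auto intro!: Bochner_Integration.integrable_diff\<close>)
    also have "\<dots> \<le> (\<integral>\<^sup>+\<omega>. ennreal (e/2) + ennreal (1 / (2*e)) * ennreal ((S k \<omega> - I \<omega>)\<^sup>2) \<partial>M)"
    proof (rule nn_integral_mono)
      fix \<omega>
      define d where "d = \<bar>S k \<omega> - I \<omega>\<bar>"
      have "cmod (iexp (U \<omega> + S k \<omega>) - iexp (U \<omega> + I \<omega>)) \<le> d"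
        using iexp_diff_le[of "U \<omega> + S k \<omega>" "U \<omega> + I \<omega>"] by (simp add: d_def)
      also have "0 \<le> (e - d)\<^sup>2 / (2*e)" using e by simp
      then have "d \<le> e/2 + 1 / (2*e) * d\<^sup>2" using e by (simp add: power2_diff field_simps power2_eq_square)
      also have "d\<^sup>2 = (S k \<omega> - I \<omega>)\<^sup>2" by (simp add: d_def)
      finally have "ennreal (cmod (iexp (U \<omega> + S k \<omega>) - iexp (U \<omega> + I \<omega>))) \<le> ennreal (e/2 + 1/(2*e) * (S k \<omega> - I \<omega>)\<^sup>2)"
        by (rule ennreal_leI)
      also have "\<dots> = ennreal (e/2) + ennreal (1 / (2*e)) * ennreal ((S k \<omega> - I \<omega>)\<^sup>2)"
        using e by (simp add: ennreal_plus[symmetric] ennreal_mult'[symmetric] del: ennreal_plus)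
      finally show "ennreal (cmod (iexp (U \<omega> + S k \<omega>) - iexp (U \<omega> + I \<omega>))) \<le> \<dots>" .
    qed
    also have "\<dots> = ennreal (e/2) + ennreal (1 / (2*e)) * (\<integral>\<^sup>+\<omega>. ennreal ((S k \<omega> - I \<omega>)\<^sup>2) \<partial>M)"
      by (subst nn_integral_add) (auto simp: nn_integral_cmult emeasure_space_1)
    finally show ?thesis .
  qed
  have "(\<lambda>k. ennreal (e/2) + ennreal (1 / (2*e)) * (\<integral>\<^sup>+\<omega>. ennreal ((S k \<omega> - I \<omega>)\<^sup>2) \<partial>M)) \<longlonglongrightarrow> ennreal (e/2) + ennreal (1/(2*e)) * 0"
    by (intro tendsto_add tendsto_const ennreal_tendsto_cmult lim) auto
  moreover have "ennreal (e/2) + ennreal (1/(2*e)) * 0 < ennreal e" using e by (simp add: ennreal_lessI)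
  ultimately have "\<forall>\<^sub>F k in sequentially. ennreal (e/2) + ennreal (1 / (2*e)) * (\<integral>\<^sup>+\<omega>. ennreal ((S k \<omega> - I \<omega>)\<^sup>2) \<partial>M) < ennreal e"
    by (rule order_tendstoD(2))
  then obtain K where K: "\<And>k. k \<ge> K \<Longrightarrow> ennreal (e/2) + ennreal (1 / (2*e)) * (\<integral>\<^sup>+\<omega>. ennreal ((S k \<omega> - I \<omega>)\<^sup>2) \<partial>M) < ennreal e"
    by (auto simp: eventually_sequentially)
  show "\<exists>K. \<forall>k\<ge>K. norm ((CLINT \<omega>|M. iexp (U \<omega> + S k \<omega>)) - (CLINT \<omega>|M. iexp (U \<omega> + I \<omega>))) < e"
    using le_less_trans[OF le K] e by (auto simp: ennreal_less_iff intro!: exI[of _ K])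
qed

context covariance_rate begin

text \<open>Young's inequality for the form of \<open>R t\<close>, applied to the cross term of \<open>f = u + (f - u)\<close>.\<close>

lemma form_diff_bound:
  assumes t: "0 \<le> t" and d: "d > 0"
  shows "\<bar>f \<bullet> (R t *v f) - u \<bullet> (R t *v u)\<bar>
      \<le> (1 + 1/d) * ((f - u) \<bullet> (R t *v (f - u))) + d * (u \<bullet> (R t *v u))"
proof -
  define a where "a = f - u"
  have f: "f = u + a" by (simp add: a_def)
  have sw: "u \<bullet> (R t *v a) = a \<bullet> (R t *v u)" by (rule posdef_swap[OF R_pos[OF t]])
  define p q r where "p = a \<bullet> (R t *v a)" and "q = a \<bullet> (R t *v u)" and "r = u \<bullet> (R t *v u)"
  have "0 \<le> (d *\<^sub>R u - a) \<bullet> (R t *v (d *\<^sub>R u - a))" "0 \<le> (d *\<^sub>R u + a) \<bullet> (R t *v (d *\<^sub>R u + a))"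
    by (intro posdef_nonneg R_pos t)+
  then have "0 \<le> d * d * r - 2 * (d * q) + p" "0 \<le> d * d * r + 2 * (d * q) + p"
    unfolding p_def q_def r_def
    by (simp_all add: matrix_vector_mult_diff_distrib matrix_vector_right_distrib matrix_vector_mult_scaleR
        inner_diff_left inner_diff_right inner_add_left inner_add_right sw algebra_simps)
  then have 1: "2 * q \<le> d * r + p/d" "- (2 * q) \<le> d * r + p/d" using d by (simp_all add: field_simps)
  have "0 \<le> p" unfolding p_def by (intro posdef_nonneg R_pos t)
  moreover have "f \<bullet> (R t *v f) - u \<bullet> (R t *v u) = 2 * q + p"
    unfolding f by (simp add: matrix_vector_right_distrib inner_add_left inner_add_right sw p_def q_def)
  ultimately show ?thesis
    using 1 by (simp add: a_def[symmetric] p_def[symmetric] r_def[symmetric] abs_le_iff algebra_simps)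
qed

lemma form_diff_integrable:
  assumes T: "0 \<le> T" and f: "f \<in> borel_measurable (lebesgue_on {0..T})" "u \<in> borel_measurable (lebesgue_on {0..T})"
   and i: "(\<lambda>t. f t \<bullet> (R t *v f t)) absolutely_integrable_on {0..T}" "(\<lambda>t. u t \<bullet> (R t *v u t)) absolutely_integrable_on {0..T}"
  shows "(\<lambda>t. (c *\<^sub>R f t + u t) \<bullet> (R t *v (c *\<^sub>R f t + u t))) absolutely_integrable_on {0..T}"
proof (rule measurable_bounded_by_integrable_imp_absolutely_integrable)
  show "(\<lambda>t. (c *\<^sub>R f t + u t) \<bullet> (R t *v (c *\<^sub>R f t + u t))) \<in> borel_measurable (lebesgue_on {0..T})"
    by (intro form_measurable borel_measurable_add borel_measurable_scaleR borel_measurable_const f)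
  show "(\<lambda>t. (2 * c\<^sup>2) *\<^sub>R (f t \<bullet> (R t *v f t)) + 2 *\<^sub>R (u t \<bullet> (R t *v u t))) integrable_on {0..T}"
    by (intro integrable_add integrable_cmul) (use i in \<open>auto simp: set_lebesgue_integral_eq_integral(1)\<close>)
  fix t assume "t \<in> {0..T}"
  then have p: "posdef (R t)" by (simp add: R_pos)
  have "(c *\<^sub>R f t + u t) \<bullet> (R t *v (c *\<^sub>R f t + u t)) \<le> 2 * ((c *\<^sub>R f t) \<bullet> (R t *v (c *\<^sub>R f t))) + 2 * (u t \<bullet> (R t *v u t))"
    by (rule posdef_form_add_le[OF p])
  also have "(c *\<^sub>R f t) \<bullet> (R t *v (c *\<^sub>R f t)) = c\<^sup>2 * (f t \<bullet> (R t *v f t))"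
    by (simp add: matrix_vector_mult_scaleR power2_eq_square)
  finally show "norm ((c *\<^sub>R f t + u t) \<bullet> (R t *v (c *\<^sub>R f t + u t))) \<le>
      (2 * c\<^sup>2) *\<^sub>R (f t \<bullet> (R t *v f t)) + 2 *\<^sub>R (u t \<bullet> (R t *v u t))"
    using posdef_nonneg[OF p, of "c *\<^sub>R f t + u t"] by simp
qed auto

text \<open>Continuity of the squared norm: integrate the pointwise bound and choose \<open>d\<close> small in terms of the norm
  of \<open>u\<close>.\<close>

lemma cov_form_limit:
  assumes T: "0 \<le> T" and f: "\<And>k. f k \<in> borel_measurable (lebesgue_on {0..T})" and u: "u \<in> borel_measurable (lebesgue_on {0..T})"
   and fi: "\<And>k. (\<lambda>t. f k t \<bullet> (R t *v f k t)) absolutely_integrable_on {0..T}"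
   and ui: "(\<lambda>t. u t \<bullet> (R t *v u t)) absolutely_integrable_on {0..T}"
   and lim: "(\<lambda>k. cov_nn R T (\<lambda>t. f k t - u t)) \<longlonglongrightarrow> 0"
  shows "(\<lambda>k. cov_form R T (f k)) \<longlonglongrightarrow> cov_form R T u"
proof (rule LIMSEQ_I)
  fix e :: real assume e: "e > 0"
  define c where "c = cov_form R T u"
  have di: "(\<lambda>t. (f k t - u t) \<bullet> (R t *v (f k t - u t))) absolutely_integrable_on {0..T}" for k
  proof -
    have eq: "(f k t - u t) \<bullet> (R t *v (f k t - u t)) = ((-1) *\<^sub>R f k t + u t) \<bullet> (R t *v ((-1) *\<^sub>R f k t + u t))" for t
      by (simp add: matrix_vector_mult_diff_distrib inner_diff_left inner_diff_right)
    show ?thesis unfolding eq by (rule form_diff_integrable[OF T f u fi ui])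
  qed
  define a where "a k = cov_form R T (\<lambda>t. f k t - u t)" for k
  have "(\<lambda>k. ennreal (a k)) \<longlonglongrightarrow> ennreal 0"
    using lim by (simp add: a_def cov_nn_eq_cov_form(1)[OF di])
  then have a: "a \<longlonglongrightarrow> 0"
    by (subst (asm) tendsto_ennreal_iff) (auto simp: a_def cov_nn_eq_cov_form(2)[OF di])
  have c0: "c \<ge> 0" unfolding c_def by (rule cov_nn_eq_cov_form(2)[OF ui])
  define d where "d = e / (2 * (c + 1))"
  have d: "d > 0" "d * c < e / 2" using e c0 by (simp_all add: d_def field_simps)
  note int = set_lebesgue_integral_eq_integral(1)
  have bound: "\<bar>cov_form R T (f k) - c\<bar> \<le> (1 + 1/d) * a k + d * c" for k
  proof -
    have "cov_form R T (f k) - c = integral {0..T} (\<lambda>t. f k t \<bullet> (R t *v f k t) - u t \<bullet> (R t *v u t))"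
      unfolding cov_form_def c_def
      by (intro Henstock_Kurzweil_Integration.integral_diff[symmetric] int fi ui)
    also have "norm \<dots> \<le> integral {0..T} (\<lambda>t. (1 + 1/d) *\<^sub>R ((f k t - u t) \<bullet> (R t *v (f k t - u t))) + d *\<^sub>R (u t \<bullet> (R t *v u t)))"
      by (intro integral_norm_bound_integral integrable_diff integrable_add integrable_cmul int fi ui di)
         (use form_diff_bound[OF _ d(1)] in auto)
    also have "\<dots> = (1 + 1/d) * a k + d * c"
      unfolding a_def c_def cov_form_def
      by (subst integral_add) (auto intro!: integrable_cmul int ui di)
    finally show ?thesis by simp
  qed
  have "(\<lambda>k. (1 + 1/d) * a k + d * c) \<longlonglongrightarrow> (1 + 1/d) * 0 + d * c"
    by (intro tendsto_intros a)
  then have "\<forall>\<^sub>F k in sequentially. (1 + 1/d) * a k + d * c < e"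
    by (rule order_tendstoD(2)) (use d e in simp)
  then obtain K where "\<And>k. k \<ge> K \<Longrightarrow> (1 + 1/d) * a k + d * c < e" by (auto simp: eventually_sequentially)
  then show "\<exists>K. \<forall>k\<ge>K. norm (cov_form R T (f k) - cov_form R T u) < e"
    using bound unfolding c_def[symmetric] by (metis le_less_trans real_norm_def)
qed

end

context wiener begin

lemma has_wiener_integral_iff:
  "has_wiener_integral M W R T u I \<longleftrightarrow> I \<in> borel_measurable M \<and>
    (\<exists>f S. (\<forall>k. simple_pair W T (f k) (S k)) \<and>
      (\<lambda>k. cov_nn R T (\<lambda>t. f k t - u t)) \<longlonglongrightarrow> 0 \<and>
      (\<lambda>k. \<integral>\<^sup>+\<omega>. ennreal ((S k \<omega> - I \<omega>)\<^sup>2) \<partial>M) \<longlonglongrightarrow> 0)" (is "?L \<longleftrightarrow> ?R")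
proof
  assume ?L
  then obtain n \<tau> x where "I \<in> borel_measurable M" "\<And>k. partition_of T (n k) (\<tau> k)"
     "(\<lambda>k. cov_nn R T (\<lambda>t. step_function (n k) (\<tau> k) (x k) t - u t)) \<longlonglongrightarrow> 0"
     "(\<lambda>k. \<integral>\<^sup>+\<omega>. ennreal ((step_integral W (n k) (\<tau> k) (x k) \<omega> - I \<omega>)\<^sup>2) \<partial>M) \<longlonglongrightarrow> 0"
    unfolding has_wiener_integral_def cov_nn_def by blast
  then show ?R
    by (intro conjI exI[of _ "\<lambda>k. step_function (n k) (\<tau> k) (x k)"] exI[of _ "\<lambda>k. step_integral W (n k) (\<tau> k) (x k)"])
       (auto simp: simple_pair_def)
next
  assume ?R
  then obtain f S where fS: "I \<in> borel_measurable M" "\<And>k. simple_pair W T (f k) (S k)"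
      "(\<lambda>k. cov_nn R T (\<lambda>t. f k t - u t)) \<longlonglongrightarrow> 0"
      "(\<lambda>k. \<integral>\<^sup>+\<omega>. ennreal ((S k \<omega> - I \<omega>)\<^sup>2) \<partial>M) \<longlonglongrightarrow> 0" by blast
  from fS(2) obtain n \<tau> x where "\<And>k. partition_of T (n k) (\<tau> k)" "\<And>k. f k = step_function (n k) (\<tau> k) (x k)"
     "\<And>k. S k = step_integral W (n k) (\<tau> k) (x k)"
    unfolding simple_pair_def by metis
  then show ?L using fS unfolding has_wiener_integral_def cov_nn_def by auto
qed

lemma wiener_integral_lincomb:
  assumes T: "0 \<le> T" and u: "u \<in> borel_measurable (lebesgue_on {0..T})" "v \<in> borel_measurable (lebesgue_on {0..T})"
    and I: "has_wiener_integral M W R T u I" and J: "has_wiener_integral M W R T v J"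
  shows "has_wiener_integral M W R T (\<lambda>t. c *\<^sub>R u t + v t) (\<lambda>\<omega>. c * I \<omega> + J \<omega>)"
proof -
  obtain f S where f: "I \<in> borel_measurable M" "\<And>k. simple_pair W T (f k) (S k)"
      "(\<lambda>k. cov_nn R T (\<lambda>t. f k t - u t)) \<longlonglongrightarrow> 0"
      "(\<lambda>k. \<integral>\<^sup>+\<omega>. ennreal ((S k \<omega> - I \<omega>)\<^sup>2) \<partial>M) \<longlonglongrightarrow> 0"
    using I unfolding has_wiener_integral_iff by blast
  obtain g S' where g: "J \<in> borel_measurable M" "\<And>k. simple_pair W T (g k) (S' k)"
      "(\<lambda>k. cov_nn R T (\<lambda>t. g k t - v t)) \<longlonglongrightarrow> 0"
      "(\<lambda>k. \<integral>\<^sup>+\<omega>. ennreal ((S' k \<omega> - J \<omega>)\<^sup>2) \<partial>M) \<longlonglongrightarrow> 0"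
    using J unfolding has_wiener_integral_iff by blast
  note [measurable] = f(1) g(1) simple_measurable(2)[OF f(2)] simple_measurable(2)[OF g(2)]
     simple_form_integrable(2)[OF f(2) T] simple_form_integrable(2)[OF g(2) T] u
  show ?thesis
    unfolding has_wiener_integral_iff
  proof (intro conjI exI allI)
    show "(\<lambda>\<omega>. c * I \<omega> + J \<omega>) \<in> borel_measurable M" by measurable
    show "simple_pair W T (\<lambda>t. c *\<^sub>R f k t + g k t) (\<lambda>\<omega>. c * S k \<omega> + S' k \<omega>)" for k
      by (rule simple_pair_lincomb[OF f(2) g(2)])
    have z: "(\<lambda>k. (2 * ennreal (c\<^sup>2)) * F k + 2 * G k) \<longlonglongrightarrow> 0" if "F \<longlonglongrightarrow> 0" "G \<longlonglongrightarrow> 0" for F G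
      by (intro ennreal_lincomb_tendsto_zero that) (auto simp: ennreal_mult_less_top)
    show "(\<lambda>k. cov_nn R T (\<lambda>t. (c *\<^sub>R f k t + g k t) - (c *\<^sub>R u t + v t))) \<longlonglongrightarrow> 0"
    proof (rule ennreal_tendsto_zero_le[OF z[OF f(3) g(3)]])
      fix k
      have "cov_nn R T (\<lambda>t. c *\<^sub>R (f k t - u t) + (g k t - v t)) \<le>
         2 * cov_nn R T (\<lambda>t. c *\<^sub>R (f k t - u t)) + 2 * cov_nn R T (\<lambda>t. g k t - v t)"
        by (rule cov_nn_add_le) measurable
      then show "cov_nn R T (\<lambda>t. (c *\<^sub>R f k t + g k t) - (c *\<^sub>R u t + v t)) \<le>
         (2 * ennreal (c\<^sup>2)) * cov_nn R T (\<lambda>t. f k t - u t) + 2 * cov_nn R T (\<lambda>t. g k t - v t)"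
        by (subst (asm) cov_nn_scale) (simp_all add: algebra_simps)
    qed
    show "(\<lambda>k. \<integral>\<^sup>+\<omega>. ennreal ((c * S k \<omega> + S' k \<omega> - (c * I \<omega> + J \<omega>))\<^sup>2) \<partial>M) \<longlonglongrightarrow> 0"
    proof (rule ennreal_tendsto_zero_le[OF z[OF f(4) g(4)]])
      fix k
      have "(\<integral>\<^sup>+\<omega>. ennreal ((c * (S k \<omega> - I \<omega>) + (S' k \<omega> - J \<omega>))\<^sup>2) \<partial>M) \<le>
         2 * (\<integral>\<^sup>+\<omega>. ennreal ((c * (S k \<omega> - I \<omega>))\<^sup>2) \<partial>M) + 2 * (\<integral>\<^sup>+\<omega>. ennreal ((S' k \<omega> - J \<omega>)\<^sup>2) \<partial>M)"
        by (rule L2_add_le) measurable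
      then show "(\<integral>\<^sup>+\<omega>. ennreal ((c * S k \<omega> + S' k \<omega> - (c * I \<omega> + J \<omega>))\<^sup>2) \<partial>M) \<le>
        (2 * ennreal (c\<^sup>2)) * (\<integral>\<^sup>+\<omega>. ennreal ((S k \<omega> - I \<omega>)\<^sup>2) \<partial>M) + 2 * (\<integral>\<^sup>+\<omega>. ennreal ((S' k \<omega> - J \<omega>)\<^sup>2) \<partial>M)"
        by (subst (asm) L2_scale) (simp_all add: algebra_simps)
    qed
  qed
qed

text \<open>The difference of two versions is an integral of zero, hence, by the isometry, a limit of variables
  whose second moments tend to zero.\<close>

lemma wiener_integral_unique:
  assumes T: "0 \<le> T" and u: "u \<in> borel_measurable (lebesgue_on {0..T})"
    and I: "has_wiener_integral M W R T u I" and J: "has_wiener_integral M W R T u J"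
  shows "AE \<omega> in M. I \<omega> = J \<omega>"
proof -
  have "has_wiener_integral M W R T (\<lambda>t. (-1) *\<^sub>R u t + u t) (\<lambda>\<omega>. (-1) * I \<omega> + J \<omega>)"
    by (rule wiener_integral_lincomb[OF T u u I J])
  then obtain f S where f: "\<And>k. simple_pair W T (f k) (S k)"
      "(\<lambda>k. cov_nn R T (\<lambda>t. f k t)) \<longlonglongrightarrow> 0"
      "(\<lambda>k. \<integral>\<^sup>+\<omega>. ennreal ((S k \<omega> - (J \<omega> - I \<omega>))\<^sup>2) \<partial>M) \<longlonglongrightarrow> 0"
    unfolding has_wiener_integral_iff by auto
  have [measurable]: "I \<in> borel_measurable M" "J \<in> borel_measurable M" using I J by (auto simp: has_wiener_integral_def)
  note [measurable] = simple_measurable(2)[OF f(1)]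
  have "(\<integral>\<^sup>+\<omega>. ennreal ((J \<omega> - I \<omega>)\<^sup>2) \<partial>M) \<le> 2 * cov_nn R T (f k) + 2 * (\<integral>\<^sup>+\<omega>. ennreal ((S k \<omega> - (J \<omega> - I \<omega>))\<^sup>2) \<partial>M)" for k
    using L2_add_le[of "S k" M "\<lambda>\<omega>. (-1) * (S k \<omega> - (J \<omega> - I \<omega>))"]
    by (simp add: simple_isometry[OF f(1) T] L2_scale power2_commute)
  then have "(\<lambda>k. \<integral>\<^sup>+\<omega>. ennreal ((J \<omega> - I \<omega>)\<^sup>2) \<partial>M) \<longlonglongrightarrow> 0"
    by (intro ennreal_tendsto_zero_le[OF ennreal_lincomb_tendsto_zero[OF f(2,3), of 2 2]]) auto
  then have "(\<integral>\<^sup>+\<omega>. ennreal ((J \<omega> - I \<omega>)\<^sup>2) \<partial>M) = 0" by (simp add: LIMSEQ_const_iff)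
  then show ?thesis by (subst (asm) nn_integral_0_iff_AE) (auto simp: ennreal_eq_0_iff)
qed

lemma wiener_integral_approx:
  assumes T: "0 \<le> T" and u: "u \<in> borel_measurable (lebesgue_on {0..T})"
    and ui: "(\<lambda>t. u t \<bullet> (R t *v u t)) absolutely_integrable_on {0..T}"
    and I: "has_wiener_integral M W R T u I"
  obtains f S where "\<And>k. simple_pair W T (f k) (S k)" "(\<lambda>k. cov_form R T (f k)) \<longlonglongrightarrow> cov_form R T u"
    "(\<lambda>k. \<integral>\<^sup>+\<omega>. ennreal ((S k \<omega> - I \<omega>)\<^sup>2) \<partial>M) \<longlonglongrightarrow> 0"
proof -
  obtain f S where f: "\<And>k. simple_pair W T (f k) (S k)"
      "(\<lambda>k. cov_nn R T (\<lambda>t. f k t - u t)) \<longlonglongrightarrow> 0"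
      "(\<lambda>k. \<integral>\<^sup>+\<omega>. ennreal ((S k \<omega> - I \<omega>)\<^sup>2) \<partial>M) \<longlonglongrightarrow> 0"
    using I unfolding has_wiener_integral_iff by blast
  have "(\<lambda>k. cov_form R T (f k)) \<longlonglongrightarrow> cov_form R T u"
    by (rule cov_form_limit[OF T _ u _ ui f(2)]) (use simple_form_integrable[OF f(1) T] in auto)
  then show ?thesis using f that by blast
qed

lemma simple_cov_diff:
  assumes T: "0 \<le> T" and u[measurable]: "u \<in> borel_measurable (lebesgue_on {0..T})"
    and f: "simple_pair W T f S" and g: "simple_pair W T g S'"
  shows "(\<integral>\<^sup>+\<omega>. ennreal ((S \<omega> - S' \<omega>)\<^sup>2) \<partial>M) \<le> 2 * cov_nn R T (\<lambda>t. f t - u t) + 2 * cov_nn R T (\<lambda>t. g t - u t)"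
proof -
  note [measurable] = simple_form_integrable(2)[OF f T] simple_form_integrable(2)[OF g T]
  have "(\<integral>\<^sup>+\<omega>. ennreal ((S \<omega> - S' \<omega>)\<^sup>2) \<partial>M) = cov_nn R T (\<lambda>t. (f t - u t) + (-1) *\<^sub>R (g t - u t))"
    using simple_isometry[OF simple_pair_lincomb[OF g f, of "-1"] T] by (simp add: algebra_simps)
  also have "\<dots> \<le> 2 * cov_nn R T (\<lambda>t. f t - u t) + 2 * cov_nn R T (\<lambda>t. (-1) *\<^sub>R (g t - u t))"
    by (rule cov_nn_add_le) measurable
  also have "cov_nn R T (\<lambda>t. (-1) *\<^sub>R (g t - u t)) = cov_nn R T (\<lambda>t. g t - u t)"
    by (subst cov_nn_scale) auto
  finally show ?thesis .
qed

text \<open>By the isometry the elementary integrals form a Cauchy sequence in mean square, and Fatou's lemma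
  upgrades the almost sure limit to a mean-square limit.\<close>

lemma wiener_integral_from_AE_limit:
  assumes T: "0 \<le> T" and u: "u \<in> borel_measurable (lebesgue_on {0..T})"
    and f: "\<And>k. simple_pair W T (f k) (S k)" "(\<lambda>k. cov_nn R T (\<lambda>t. f k t - u t)) \<longlonglongrightarrow> 0"
    and I[measurable]: "I \<in> borel_measurable M" and ae: "AE \<omega> in M. (\<lambda>k. S k \<omega>) \<longlonglongrightarrow> I \<omega>"
  shows "has_wiener_integral M W R T u I"
proof -
  note [measurable] = simple_measurable(2)[OF f(1)]
  have "(\<lambda>k. \<integral>\<^sup>+\<omega>. ennreal ((S k \<omega> - I \<omega>)\<^sup>2) \<partial>M) \<longlonglongrightarrow> 0"
  proof (rule order_tendstoI)
    fix e :: ennreal assume "0 < e"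
    then obtain d where d: "0 < d" "4 * d < e" "d < top"
    proof -
      assume a: "\<And>d. 0 < d \<Longrightarrow> 4 * d < e \<Longrightarrow> d < top \<Longrightarrow> thesis"
      obtain r where r: "0 < r" "ennreal r < e"
        using \<open>0 < e\<close> by (metis ennreal_less_zero_iff dense ennreal_cases not_less_zero less_imp_le not_less top_greatest less_top)
      show thesis
        by (rule a[of "ennreal (r/4)"]) (use r in \<open>auto simp: ennreal_mult'[symmetric] ennreal_numeral[symmetric] simp del: ennreal_numeral\<close>)
    qed
    obtain K where K: "\<And>k. k \<ge> K \<Longrightarrow> cov_nn R T (\<lambda>t. f k t - u t) < d"
      using order_tendstoD(2)[OF f(2) d(1)] by (auto simp: eventually_sequentially)
    have "(\<integral>\<^sup>+\<omega>. ennreal ((S k \<omega> - I \<omega>)\<^sup>2) \<partial>M) < e" if k: "k \<ge> K" for k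
    proof -
      have "(\<integral>\<^sup>+\<omega>. ennreal ((S k \<omega> - I \<omega>)\<^sup>2) \<partial>M) = (\<integral>\<^sup>+\<omega>. liminf (\<lambda>n. ennreal ((S k \<omega> - S n \<omega>)\<^sup>2)) \<partial>M)"
      proof (rule nn_integral_cong_AE, use ae in eventually_elim)
        case (elim \<omega>)
        have "(\<lambda>n. ennreal ((S k \<omega> - S n \<omega>)\<^sup>2)) \<longlonglongrightarrow> ennreal ((S k \<omega> - I \<omega>)\<^sup>2)"
          by (intro tendsto_ennrealI tendsto_intros elim)
        then show ?case using lim_imp_Liminf[OF sequentially_bot] by metis
      qed
      also have "\<dots> \<le> liminf (\<lambda>n. \<integral>\<^sup>+\<omega>. ennreal ((S k \<omega> - S n \<omega>)\<^sup>2) \<partial>M)"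
        by (rule nn_integral_liminf) measurable
      also have "\<dots> \<le> 4 * d"
      proof (rule Liminf_le)
        show "\<forall>\<^sub>F n in sequentially. (\<integral>\<^sup>+\<omega>. ennreal ((S k \<omega> - S n \<omega>)\<^sup>2) \<partial>M) \<le> 4 * d"
          unfolding eventually_sequentially
        proof (intro exI[of _ K] allI impI)
          fix n assume n: "K \<le> n"
          have "(\<integral>\<^sup>+\<omega>. ennreal ((S k \<omega> - S n \<omega>)\<^sup>2) \<partial>M) \<le> 2 * cov_nn R T (\<lambda>t. f k t - u t) + 2 * cov_nn R T (\<lambda>t. f n t - u t)"
            by (rule simple_cov_diff[OF T u f(1) f(1)])
          also have "\<dots> \<le> 2 * d + 2 * d" by (intro add_mono mult_left_mono less_imp_le K k n) auto
          also have "\<dots> = 4 * d" by (simp add: distrib_right[symmetric])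
          finally show "(\<integral>\<^sup>+\<omega>. ennreal ((S k \<omega> - S n \<omega>)\<^sup>2) \<partial>M) \<le> 4 * d" .
        qed
      qed auto
      finally show ?thesis using d(2) by simp
    qed
    then show "\<forall>\<^sub>F k in sequentially. (\<integral>\<^sup>+\<omega>. ennreal ((S k \<omega> - I \<omega>)\<^sup>2) \<partial>M) < e"
      by (auto simp: eventually_sequentially)
  qed auto
  then show ?thesis unfolding has_wiener_integral_iff using I f by blast
qed

end

section \<open>Existence of Wiener integrals\<close>

lemma step_function_inner_integral:
  fixes g :: "real \<Rightarrow> real^'n"
  assumes p: "partition_of T n \<tau>" and g: "g integrable_on {0..T}"
  shows "((\<lambda>t. g t \<bullet> step_function n \<tau> x t) has_integral
     (\<Sum>i<n. integral {\<tau> i..\<tau> (Suc i)} g \<bullet> x i)) {0..T}"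
proof -
  have "((\<lambda>t. g t \<bullet> step_function n \<tau> x t) has_integral
     (\<Sum>i<k. integral {\<tau> i..\<tau> (Suc i)} g \<bullet> x i)) {0..\<tau> k}" if "k \<le> n" for k
    using that
  proof (induction k)
    case 0
    then show ?case using p has_integral_refl(2) by (auto simp: partition_of_def)
  next
    case (Suc k)
    have r: "0 \<le> \<tau> k" "\<tau> k \<le> \<tau> (Suc k)" "\<tau> (Suc k) \<le> T"
      using partition_range[OF p] partition_mono[OF p, of k "Suc k"] Suc by auto
    have "g integrable_on {\<tau> k..\<tau> (Suc k)}"
      by (rule integrable_subinterval_real[OF g]) (use r in auto)
    from has_integral_linear[OF integrable_integral[OF this] bounded_linear_inner_left, of "x k"]
    have "((\<lambda>t. g t \<bullet> step_function n \<tau> x t) has_integral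
      integral {\<tau> k..\<tau> (Suc k)} g \<bullet> x k) {\<tau> k..\<tau> (Suc k)}"
      by (rule has_integral_spike[of "{\<tau> k}", rotated -1])
         (use step_function_on_piece[OF p, of k _ x] Suc.prems in \<open>auto simp: less_le\<close>)
    from has_integral_combine[OF r(1,2) Suc.IH this]
    show ?case using Suc by simp
  qed
  from this[of n] p show ?thesis by (simp add: partition_of_def)
qed

definition uniform_grid :: "real \<Rightarrow> nat \<Rightarrow> nat \<Rightarrow> real" where
  "uniform_grid T n i = real i * T / real n"

lemma uniform_grid_partition: "0 \<le> T \<Longrightarrow> 0 < n \<Longrightarrow> partition_of T n (uniform_grid T n)"
  by (auto simp: partition_of_def uniform_grid_def divide_right_mono mult_right_mono)

text \<open>Left-open pieces cover the left-open interval.\<close>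

lemma partition_piece:
  assumes p: "partition_of T n \<tau>" and t: "0 < t" "t \<le> T"
  obtains i where "i < n" "\<tau> i < t" "t \<le> \<tau> (Suc i)"
proof -
  define j where "j = (LEAST j. t \<le> \<tau> j)"
  have ex: "t \<le> \<tau> n" using p t by (simp add: partition_of_def)
  have j: "t \<le> \<tau> j" unfolding j_def by (rule LeastI[of _ n]) (rule ex)
  have "j \<noteq> 0" using j p t by (auto simp: partition_of_def intro: ccontr)
  then obtain i where i: "j = Suc i" by (cases j) auto
  have "j \<le> n" unfolding j_def by (rule Least_le) (rule ex)
  moreover have "\<not> t \<le> \<tau> i" using not_less_Least[of i "\<lambda>j. t \<le> \<tau> j"] i by (simp add: j_def)
  ultimately show ?thesis using that[of i] i j by auto
qed

lemma uniform_step_approx: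
  fixes c :: "real \<Rightarrow> real^'n"
  assumes c: "continuous_on {0..T} c" and T: "0 \<le> T" and e: "0 < e"
  shows "\<exists>N>0. \<forall>n\<ge>N. \<forall>\<xi>. (\<forall>i<n. \<xi> i \<in> {uniform_grid T n i..uniform_grid T n (Suc i)}) \<longrightarrow>
     (\<forall>t\<in>{0<..T}. norm (step_function n (uniform_grid T n) (\<lambda>i. c (\<xi> i)) t - c t) \<le> e)"
proof -
  have "uniformly_continuous_on {0..T} c" by (intro compact_uniformly_continuous c) auto
  then obtain d where d: "d > 0" "\<And>s t. s \<in> {0..T} \<Longrightarrow> t \<in> {0..T} \<Longrightarrow> \<bar>s - t\<bar> < d \<Longrightarrow> norm (c s - c t) < e"
    using e unfolding uniformly_continuous_on_def dist_norm real_norm_def by metis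
  obtain N0 where N0: "T / d < real N0" using reals_Archimedean2 by blast
  define N where "N = Suc N0"
  have "norm (step_function n (uniform_grid T n) (\<lambda>i. c (\<xi> i)) t - c t) \<le> e"
    if n: "n \<ge> N" and \<xi>: "\<forall>i<n. \<xi> i \<in> {uniform_grid T n i..uniform_grid T n (Suc i)}" and t: "t \<in> {0<..T}" for n \<xi> t
  proof -
    have n0: "0 < n" using n by (simp add: N_def)
    note p = uniform_grid_partition[OF T n0]
    obtain i where i: "i < n" "uniform_grid T n i < t" "t \<le> uniform_grid T n (Suc i)"
      using partition_piece[OF p, of t] t by auto
    have "T / d < real n" using N0 n by (simp add: N_def)
    then have "T / real n < d" using d(1) n0 by (simp add: field_simps)
    moreover have "uniform_grid T n (Suc i) - uniform_grid T n i = T / real n"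
      by (simp add: uniform_grid_def add_divide_distrib distrib_right)
    ultimately have "\<bar>\<xi> i - t\<bar> < d" using \<xi> i by force
    moreover have "\<xi> i \<in> {0..T}" using \<xi> i partition_range[OF p, of i] partition_range[OF p, of "Suc i"] by force
    ultimately have "norm (c (\<xi> i) - c t) < e" using t d(2) by auto
    then show ?thesis using step_function_on_piece[OF p i, of "\<lambda>i. c (\<xi> i)"] by simp
  qed
  then show ?thesis by (intro exI[of _ N]) (auto simp: N_def)
qed

lemma AE_lebesgue_on_pos: "AE t in lebesgue_on {0..T::real}. 0 < t \<and> t \<le> T"
proof -
  have "AE t in lebesgue. t \<noteq> (0::real)"
    by (rule AE_I'[of "{0}"]) (auto simp: negligible_iff_null_sets[symmetric])
  then show ?thesis by (subst AE_restrict_space_iff) auto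
qed

context covariance_rate begin

lemma form_bound: "\<exists>K>0. \<forall>t v. \<bar>v \<bullet> (R t *v v)\<bar> \<le> K * norm (R t) * (norm v)\<^sup>2"
proof -
  obtain K where K: "K > 0" "\<And>(S::real^'n^'n) x. norm (S *v x) \<le> norm S * norm x * K"
    using bounded_bilinear.pos_bounded[OF bounded_bilinear_matrix_vector] by blast
  have "\<bar>v \<bullet> (R t *v v)\<bar> \<le> K * norm (R t) * (norm v)\<^sup>2" for t v
  proof -
    have "\<bar>v \<bullet> (R t *v v)\<bar> \<le> norm v * norm (R t *v v)" by (rule Cauchy_Schwarz_ineq2)
    also have "\<dots> \<le> norm v * (norm (R t) * norm v * K)" by (intro mult_left_mono K) auto
    finally show ?thesis by (simp add: power2_eq_square mult_ac)
  qed
  then show ?thesis using K(1) by blast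
qed

text \<open>The quantity that has to become small when an integrand is approximated: its first summand controls
  the noise part of the integral against the observations, its second summand the drift part.\<close>

definition cost :: "(real \<Rightarrow> real^'d^'n) \<Rightarrow> real \<Rightarrow> (real \<Rightarrow> real^'n) \<Rightarrow> ennreal" where
  "cost C T f = (\<integral>\<^sup>+t. ennreal (f t \<bullet> (R t *v f t) + norm (transpose (C t) *v f t)) \<partial>lebesgue_on {0..T})"

lemma transpose_continuous:
  fixes C :: "real \<Rightarrow> real^'d^'n"
  shows "continuous_on S C \<Longrightarrow> continuous_on S (\<lambda>t. transpose (C t))"
  unfolding transpose_def by (intro continuous_intros)

lemma cost_measurable:
  fixes C :: "real \<Rightarrow> real^'d^'n"
  assumes "continuous_on {0..T} C" "f \<in> borel_measurable (lebesgue_on {0..T})"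
  shows "(\<lambda>t. f t \<bullet> (R t *v f t) + norm (transpose (C t) *v f t)) \<in> borel_measurable (lebesgue_on {0..T})"
proof -
  have "(\<lambda>t. transpose (C t) *v f t) \<in> borel_measurable (lebesgue_on {0..T})"
    by (intro measurable_matrix_vector assms continuous_on_imp_lebesgue_measurable transpose_continuous)
  then have "(\<lambda>t. norm (transpose (C t) *v f t)) \<in> borel_measurable (lebesgue_on {0..T})"
    by measurable
  then show ?thesis by (intro borel_measurable_add form_measurable assms)
qed

text \<open>Dominated convergence; for integrands bounded by \<open>B\<close> the integrand of the cost is dominated by a
  multiple of \<open>norm (R t)\<close> plus a constant.\<close>

lemma cost_bounded_convergence:
  fixes C :: "real \<Rightarrow> real^'d^'n"
  assumes C: "continuous_on {0..T} C" and T: "0 \<le> T"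
    and f: "\<And>k. f k \<in> borel_measurable (lebesgue_on {0..T})"
    and bd: "\<And>k t. t \<in> {0<..T} \<Longrightarrow> norm (f k t) \<le> B"
    and lim: "AE t in lebesgue_on {0..T}. (\<lambda>k. f k t) \<longlonglongrightarrow> 0"
  shows "(\<lambda>k. cost C T (f k)) \<longlonglongrightarrow> 0"
proof (cases "T = 0")
  case True
  have "cost C T f = 0" for f
  proof -
    have "cost C T f = (\<integral>\<^sup>+t. 0 \<partial>lebesgue_on {0..T})"
      unfolding cost_def by (rule nn_integral_cong_AE) (use True AE_lebesgue_on_pos[of T] in auto)
    then show ?thesis by simp
  qed
  then show ?thesis by simp
next
  case False
  then have B: "0 \<le> B" using order_trans[OF norm_ge_zero bd[of T 0]] T by simp
  obtain K where K: "K > 0" "\<And>t v. \<bar>v \<bullet> (R t *v v)\<bar> \<le> K * norm (R t) * (norm v)\<^sup>2"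
    using form_bound by blast
  obtain K' where K': "K' > 0" "\<And>(S::real^'n^'d) x. norm (S *v x) \<le> norm S * norm x * K'"
    using bounded_bilinear.pos_bounded[OF bounded_bilinear_matrix_vector] by blast
  have "bounded ((\<lambda>t. transpose (C t)) ` {0..T})"
    by (intro compact_imp_bounded compact_continuous_image transpose_continuous C) auto
  then obtain L where "\<forall>x\<in>(\<lambda>t. transpose (C t)) ` {0..T}. norm x \<le> L" unfolding bounded_iff by blast
  then have L: "\<And>t. t \<in> {0..T} \<Longrightarrow> norm (transpose (C t)) \<le> L" by auto
  define \<kappa> where "\<kappa> t = K * norm (R t) * B\<^sup>2 + L * B * K'" for t
  have "integrable (lebesgue_on {0..T}) (\<lambda>t. norm (R t))"
    using R_int[OF T] absolutely_integrable_measurable[of "{0..T}" R] by (auto simp: o_def)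
  then have int: "integrable (lebesgue_on {0..T}) \<kappa>"
    unfolding \<kappa>_def by (intro Bochner_Integration.integrable_add integrable_mult_left integrable_mult_right
      finite_measure.integrable_const finite_measure_lebesgue_on) auto
  have \<kappa>0: "0 \<le> \<kappa> t" if "t \<in> {0..T}" for t
    unfolding \<kappa>_def using K K' B order_trans[OF norm_ge_zero L[OF that]] by (intro add_nonneg_nonneg mult_nonneg_nonneg) auto
  have "(\<lambda>k. cost C T (f k)) \<longlonglongrightarrow> (\<integral>\<^sup>+t. ennreal 0 \<partial>lebesgue_on {0..T})"
    unfolding cost_def
  proof (rule nn_integral_dominated_convergence[where w = "\<lambda>t. ennreal (\<kappa> t)"])
    show "(\<lambda>t. ennreal (f k t \<bullet> (R t *v f k t) + norm (transpose (C t) *v f k t))) \<in> borel_measurable (lebesgue_on {0..T})" for k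
      using cost_measurable[OF C f] by simp
    show "(\<lambda>t. ennreal (\<kappa> t)) \<in> borel_measurable (lebesgue_on {0..T})" using int by measurable
    show "(\<integral>\<^sup>+t. ennreal (\<kappa> t) \<partial>lebesgue_on {0..T}) < \<infinity>"
      using int \<kappa>0 by (subst nn_integral_eq_integral) (auto simp: space_restrict_space)
    show "AE t in lebesgue_on {0..T}. ennreal (f k t \<bullet> (R t *v f k t) + norm (transpose (C t) *v f k t)) \<le> ennreal (\<kappa> t)" for k
    proof (use AE_lebesgue_on_pos[of T] in eventually_elim)
      case (elim t)
      have n: "norm (f k t) \<le> B" using bd elim by auto
      have "f k t \<bullet> (R t *v f k t) \<le> K * norm (R t) * (norm (f k t))\<^sup>2" using K(2)[of "f k t" t] by linarith
      also have "\<dots> \<le> K * norm (R t) * B\<^sup>2" using n K(1) by (intro mult_left_mono power_mono) auto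
      finally have 1: "f k t \<bullet> (R t *v f k t) \<le> K * norm (R t) * B\<^sup>2" .
      have "norm (transpose (C t) *v f k t) \<le> norm (transpose (C t)) * norm (f k t) * K'" by (rule K')
      also have "\<dots> \<le> L * B * K'" using n L[of t] K'(1) B elim order_trans[OF norm_ge_zero L[of t]] by (intro mult_right_mono mult_mono) auto
      finally show ?case using 1 by (simp add: \<kappa>_def ennreal_leI)
    qed
    show "AE t in lebesgue_on {0..T}. (\<lambda>k. ennreal (f k t \<bullet> (R t *v f k t) + norm (transpose (C t) *v f k t))) \<longlonglongrightarrow> ennreal 0"
    proof (use lim in eventually_elim)
      case (elim t)
      have mv: "(\<lambda>k. S *v f k t) \<longlonglongrightarrow> S *v 0" for S :: "real^'n^'q"
        by (rule bounded_linear.tendsto[OF bounded_bilinear.bounded_linear_right[OF bounded_bilinear_matrix_vector] elim])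
      have "(\<lambda>k. f k t \<bullet> (R t *v f k t) + norm (transpose (C t) *v f k t)) \<longlonglongrightarrow> 0 \<bullet> (R t *v 0) + norm (transpose (C t) *v 0)"
        by (intro tendsto_intros elim mv)
      then have "(\<lambda>k. f k t \<bullet> (R t *v f k t) + norm (transpose (C t) *v f k t)) \<longlonglongrightarrow> 0" by simp
      then show ?case by (rule tendsto_ennrealI)
    qed
  qed auto
  then show ?thesis by simp
qed

lemma cost_add_le:
  fixes C :: "real \<Rightarrow> real^'d^'n"
  assumes C: "continuous_on {0..T} C"
    and f: "f \<in> borel_measurable (lebesgue_on {0..T})" "g \<in> borel_measurable (lebesgue_on {0..T})"
  shows "cost C T (\<lambda>t. f t + g t) \<le> 2 * cost C T f + 2 * cost C T g"
proof -
  let ?h = "\<lambda>f t. f t \<bullet> (R t *v f t) + norm (transpose (C t) *v f t)"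
  have "cost C T (\<lambda>t. f t + g t) \<le> (\<integral>\<^sup>+t. 2 * ennreal (?h f t) + 2 * ennreal (?h g t) \<partial>lebesgue_on {0..T})"
    unfolding cost_def
  proof (rule nn_integral_mono)
    fix t assume t: "t \<in> space (lebesgue_on {0..T})"
    have arith: "p + n1 \<le> 2 * (p1 + n2) + 2 * (p2 + n3)"
      if "n1 \<le> n2 + n3" "p \<le> 2 * p1 + 2 * p2" "0 \<le> n2" "0 \<le> n3" for p n1 n2 n3 p1 p2 :: real
      using that by simp
    have 1: "norm (transpose (C t) *v (f t + g t)) \<le> norm (transpose (C t) *v f t) + norm (transpose (C t) *v g t)"
      unfolding matrix_vector_right_distrib by (rule norm_triangle_ineq)
    have 2: "(f t + g t) \<bullet> (R t *v (f t + g t)) \<le> 2 * (f t \<bullet> (R t *v f t)) + 2 * (g t \<bullet> (R t *v g t))"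
      by (intro posdef_form_add_le R_pos) (use t in \<open>simp add: space_restrict_space\<close>)
    have "(f t + g t) \<bullet> (R t *v (f t + g t)) + norm (transpose (C t) *v (f t + g t)) \<le> 2 * ?h f t + 2 * ?h g t"
      by (rule arith[OF 1 2 norm_ge_zero norm_ge_zero])
    then have "ennreal ((f t + g t) \<bullet> (R t *v (f t + g t)) + norm (transpose (C t) *v (f t + g t))) \<le> ennreal (2 * ?h f t + 2 * ?h g t)"
      by (rule ennreal_leI)
    also have "\<dots> = 2 * ennreal (?h f t) + 2 * ennreal (?h g t)"
    proof -
      have "ennreal (2 * A + 2 * B) = 2 * ennreal A + 2 * ennreal B" if "0 \<le> A" "0 \<le> B" for A B :: real
        using that by (simp add: ennreal_mult')
      then show ?thesis using form_nonneg[OF t, of "f t"] form_nonneg[OF t, of "g t"] by (meson add_nonneg_nonneg norm_ge_zero)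
    qed
    finally show "ennreal ((f t + g t) \<bullet> (R t *v (f t + g t)) + norm (transpose (C t) *v (f t + g t)))
      \<le> 2 * ennreal (?h f t) + 2 * ennreal (?h g t)" .
  qed
  also have "\<dots> = 2 * cost C T f + 2 * cost C T g"
    unfolding cost_def using cost_measurable[OF C f(1)] cost_measurable[OF C f(2)]
    by (subst nn_integral_add) (auto simp: nn_integral_cmult)
  finally show ?thesis .
qed

lemma cov_nn_le_cost: "cov_nn R T f \<le> cost C T f"
  unfolding cov_nn_def cost_def by (intro nn_integral_mono ennreal_leI) simp

lemma drift_le_cost: "(\<integral>\<^sup>+t. ennreal (norm (transpose (C t) *v f t)) \<partial>lebesgue_on {0..T}) \<le> cost C T f"
  unfolding cost_def by (intro nn_integral_mono ennreal_leI) (use form_nonneg in auto)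

lemma cost_uniform_steps:
  fixes C :: "real \<Rightarrow> real^'d^'n"
  assumes T: "0 \<le> T" and C: "continuous_on {0..T} C" and c: "continuous_on {0..T} c"
  shows "(\<lambda>k. cost C T (\<lambda>t. step_function (Suc k) (uniform_grid T (Suc k)) (\<lambda>i. c (uniform_grid T (Suc k) i)) t - c t)) \<longlonglongrightarrow> 0"
proof -
  define s where "s k = step_function (Suc k) (uniform_grid T (Suc k)) (\<lambda>i. c (uniform_grid T (Suc k) i))" for k
  have part: "partition_of T (Suc k) (uniform_grid T (Suc k))" for k using T by (rule uniform_grid_partition) simp
  have "bounded (c ` {0..T})" by (intro compact_imp_bounded compact_continuous_image c) auto
  then obtain B where "\<forall>x\<in>c ` {0..T}. norm x \<le> B" unfolding bounded_iff by blast
  then have B: "\<And>t. t \<in> {0..T} \<Longrightarrow> norm (c t) \<le> B" by auto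
  have lim: "(\<lambda>k. s k t - c t) \<longlonglongrightarrow> 0" if t: "t \<in> {0<..T}" for t
  proof (rule LIMSEQ_I)
    fix e :: real assume e: "e > 0"
    then obtain N where N: "\<And>n. n \<ge> N \<Longrightarrow> \<forall>\<xi>. (\<forall>i<n. \<xi> i \<in> {uniform_grid T n i..uniform_grid T n (Suc i)}) \<longrightarrow>
     (\<forall>t\<in>{0<..T}. norm (step_function n (uniform_grid T n) (\<lambda>i. c (\<xi> i)) t - c t) \<le> e/2)"
      using uniform_step_approx[OF c T, of "e/2"] by auto
    have "norm (s k t - c t) \<le> e/2" if "k \<ge> N" for k
      unfolding s_def using N[of "Suc k"] that t part[of k] by (auto simp: partition_of_def)
    then show "\<exists>N. \<forall>k\<ge>N. norm (s k t - c t - 0) < e" using e by (intro exI[of _ N]) force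
  qed
  have bd: "norm (s k t - c t) \<le> B + B" if t: "t \<in> {0<..T}" for k t
  proof -
    obtain i where i: "i < Suc k" "uniform_grid T (Suc k) i < t" "t \<le> uniform_grid T (Suc k) (Suc i)"
      using partition_piece[OF part] t by auto
    have "norm (s k t) \<le> B"
      unfolding s_def step_function_on_piece[OF part i]
      using partition_range[OF part, of i k] i(1) by (intro B) auto
    then show ?thesis using B[of t] t norm_triangle_ineq4[of "s k t" "c t"] by auto
  qed
  have "(\<lambda>k. cost C T (\<lambda>t. s k t - c t)) \<longlonglongrightarrow> 0"
  proof (rule cost_bounded_convergence[OF C T _ bd])
    show "(\<lambda>t. s k t - c t) \<in> borel_measurable (lebesgue_on {0..T})" for k
      unfolding s_def by (intro borel_measurable_diff step_function_lebesgue continuous_on_imp_lebesgue_measurable c)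
    show "AE t in lebesgue_on {0..T}. (\<lambda>k. s k t - c t) \<longlonglongrightarrow> 0"
      using AE_lebesgue_on_pos by eventually_elim (use lim in auto)
  qed
  then show ?thesis by (simp add: s_def)
qed

text \<open>A measurable function is an almost everywhere limit of continuous ones. The radial retraction \<open>\<phi>\<close> onto
  the ball of radius \<open>m\<close> keeps these bounded without spoiling the limit, and continuous functions are
  uniform limits of step functions.\<close>

lemma bounded_cost_dense:
  fixes C :: "real \<Rightarrow> real^'d^'n"
  assumes T: "0 \<le> T" and C: "continuous_on {0..T} C" and v: "v \<in> borel_measurable (lebesgue_on {0..T})"
    and bd: "\<And>t. norm (v t) \<le> m" and m: "0 < m" and e: "0 < (e::real)"
  shows "\<exists>n \<tau> x. partition_of T n \<tau> \<and> cost C T (\<lambda>t. step_function n \<tau> x t - v t) < ennreal e"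
proof -
  have "v measurable_on {0..T}" using v by (subst measurable_on_iff_borel_measurable) auto
  then obtain N g where N: "negligible N" and g: "\<And>n. continuous_on UNIV (g n)"
     and lim: "\<And>t. t \<notin> N \<Longrightarrow> (\<lambda>n. g n t) \<longlonglongrightarrow> (if t \<in> {0..T} then v t else 0)"
    unfolding measurable_on_def by blast
  define \<phi> where "\<phi> x = (m / max m (norm x)) *\<^sub>R x" for x :: "real^'n"
  have \<phi>c: "continuous_on UNIV \<phi>" unfolding \<phi>_def using m by (intro continuous_intros) auto
  have \<phi>b: "norm (\<phi> x) \<le> m" for x using m by (auto simp: \<phi>_def field_simps max_def)
  have \<phi>id: "\<phi> x = x" if "norm x \<le> m" for x using m that by (simp add: \<phi>_def)
  define c where "c n t = \<phi> (g n t)" for n t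
  have cc: "continuous_on S (c n)" for n S
    unfolding c_def using continuous_on_compose2[OF \<phi>c g] continuous_on_subset by blast
  note cm = continuous_on_imp_lebesgue_measurable[OF cc]
  have "(\<lambda>n. cost C T (\<lambda>t. c n t - v t)) \<longlonglongrightarrow> 0"
  proof (rule cost_bounded_convergence[OF C T])
    show "(\<lambda>t. c n t - v t) \<in> borel_measurable (lebesgue_on {0..T})" for n
      by (intro borel_measurable_diff cm v)
    show "norm (c n t - v t) \<le> m + m" for n t
      using norm_triangle_ineq4[of "c n t" "v t"] \<phi>b[of "g n t"] bd[of t] by (simp add: c_def)
    have "N \<in> null_sets lebesgue" using N by (simp add: negligible_iff_null_sets)
    then have "AE t in lebesgue. t \<notin> N" by (rule AE_not_in)
    then have "AE t in lebesgue_on {0..T}. t \<in> {0..T} \<and> t \<notin> N" by (subst AE_restrict_space_iff) auto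
    then show "AE t in lebesgue_on {0..T}. (\<lambda>n. c n t - v t) \<longlonglongrightarrow> 0"
    proof eventually_elim
      case (elim t)
      then have "(\<lambda>n. g n t) \<longlonglongrightarrow> v t" using lim[of t] by auto
      moreover have "isCont \<phi> (v t)" using \<phi>c by (simp add: continuous_on_eq_continuous_at)
      ultimately have "(\<lambda>n. c n t) \<longlonglongrightarrow> \<phi> (v t)" unfolding c_def by (rule isCont_tendsto_compose[rotated])
      then show ?case using \<phi>id[OF bd, of t] by (simp add: LIM_zero_iff)
    qed
  qed
  moreover have e4: "0 < ennreal (e / 8)" using e by simp
  ultimately have "\<forall>\<^sub>F n in sequentially. cost C T (\<lambda>t. c n t - v t) < ennreal (e / 8)"
    by (rule order_tendstoD(2))
  then obtain n where n: "cost C T (\<lambda>t. c n t - v t) < ennreal (e / 8)" by (auto simp: eventually_sequentially)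
  have "\<forall>\<^sub>F k in sequentially. cost C T (\<lambda>t. step_function (Suc k) (uniform_grid T (Suc k)) (\<lambda>i. c n (uniform_grid T (Suc k) i)) t - c n t) < ennreal (e / 8)"
    by (rule order_tendstoD(2)[OF cost_uniform_steps[OF T C cc] e4])
  then obtain k where k: "cost C T (\<lambda>t. step_function (Suc k) (uniform_grid T (Suc k)) (\<lambda>i. c n (uniform_grid T (Suc k) i)) t - c n t) < ennreal (e / 8)"
    by (auto simp: eventually_sequentially)
  define s where "s = step_function (Suc k) (uniform_grid T (Suc k)) (\<lambda>i. c n (uniform_grid T (Suc k) i))"
  have "cost C T (\<lambda>t. (s t - c n t) + (c n t - v t)) \<le> 2 * cost C T (\<lambda>t. s t - c n t) + 2 * cost C T (\<lambda>t. c n t - v t)"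
    unfolding s_def by (intro cost_add_le[OF C] borel_measurable_diff step_function_lebesgue cm v)
  also have "\<dots> \<le> 2 * ennreal (e/8) + 2 * ennreal (e/8)"
    using n k unfolding s_def[symmetric] by (intro add_mono mult_left_mono less_imp_le) auto
  also have "\<dots> = ennreal (e/2)"
    using e by (simp add: ennreal_plus[symmetric] ennreal_mult'[symmetric] ennreal_numeral[symmetric] del: ennreal_plus ennreal_numeral)
  also have "\<dots> < ennreal e" using e by (simp add: ennreal_lessI)
  finally have "cost C T (\<lambda>t. s t - v t) < ennreal e" by simp
  then show ?thesis
    using uniform_grid_partition[OF T, of "Suc k"] unfolding s_def by blast
qed

text \<open>Truncation at large values reduces to bounded integrands.\<close>

lemma cost_dense:
  fixes C :: "real \<Rightarrow> real^'d^'n"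
  assumes T: "0 \<le> T" and C: "continuous_on {0..T} C" and u: "u \<in> borel_measurable (lebesgue_on {0..T})"
    and fin: "cost C T u < top" and e: "0 < (e::real)"
  shows "\<exists>n \<tau> x. partition_of T n \<tau> \<and> cost C T (\<lambda>t. step_function n \<tau> x t - u t) < ennreal e"
proof -
  define v where "v m t = (if norm (u t) \<le> real m then u t else 0)" for m t
  have vm: "v m \<in> borel_measurable (lebesgue_on {0..T})" for m
    unfolding v_def using u by measurable
  let ?h = "\<lambda>f t. ennreal (f t \<bullet> (R t *v f t) + norm (transpose (C t) *v f t))"
  have "(\<lambda>m. cost C T (\<lambda>t. v m t - u t)) \<longlonglongrightarrow> (\<integral>\<^sup>+t. 0 \<partial>lebesgue_on {0..T})"
    unfolding cost_def
  proof (rule nn_integral_dominated_convergence[where w = "?h u"])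
    show "?h (\<lambda>t. v m t - u t) \<in> borel_measurable (lebesgue_on {0..T})" for m
      using cost_measurable[OF C borel_measurable_diff[OF vm u]] by simp
    show "?h u \<in> borel_measurable (lebesgue_on {0..T})" using cost_measurable[OF C u] by simp
    show "(\<integral>\<^sup>+t. ?h u t \<partial>lebesgue_on {0..T}) < \<infinity>" using fin by (simp add: cost_def)
    have neg: "S *v (- x) = - (S *v x)" for S :: "real^'n^'q" and x
      using matrix_vector_mult_diff_distrib[of S 0 x] by simp
    show "AE t in lebesgue_on {0..T}. ?h (\<lambda>t. v m t - u t) t \<le> ?h u t" for m
      by (rule AE_I2) (auto simp: v_def neg ennreal_leI simp del: transpose_matrix_vector)
    show "AE t in lebesgue_on {0..T}. (\<lambda>m. ?h (\<lambda>t. v m t - u t) t) \<longlonglongrightarrow> 0"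
    proof (rule AE_I2, rule tendsto_eventually, unfold eventually_sequentially)
      fix t
      obtain m0 where "norm (u t) \<le> real m0" using real_arch_simple by blast
      then show "\<exists>N. \<forall>m\<ge>N. ?h (\<lambda>t. v m t - u t) t = 0" by (intro exI[of _ m0]) (auto simp: v_def)
    qed
  qed auto
  then have "(\<lambda>m. cost C T (\<lambda>t. v m t - u t)) \<longlonglongrightarrow> 0" by simp
  moreover have e4: "0 < ennreal (e / 8)" using e by simp
  ultimately have "\<forall>\<^sub>F m in sequentially. cost C T (\<lambda>t. v m t - u t) < ennreal (e / 8)"
    by (rule order_tendstoD(2))
  then obtain m where m: "cost C T (\<lambda>t. v m t - u t) < ennreal (e / 8)" by (auto simp: eventually_sequentially)
  have "norm (v m t) \<le> real m + 1" for t by (auto simp: v_def)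
  then obtain n \<tau> x where s: "partition_of T n \<tau>" "cost C T (\<lambda>t. step_function n \<tau> x t - v m t) < ennreal (e / 8)"
    using bounded_cost_dense[OF T C vm, of m "real m + 1" "e / 8"] e by auto
  have "cost C T (\<lambda>t. (step_function n \<tau> x t - v m t) + (v m t - u t)) \<le>
      2 * cost C T (\<lambda>t. step_function n \<tau> x t - v m t) + 2 * cost C T (\<lambda>t. v m t - u t)"
    by (intro cost_add_le[OF C] borel_measurable_diff step_function_lebesgue vm u)
  also have "\<dots> \<le> 2 * ennreal (e/8) + 2 * ennreal (e/8)"
    using m s by (intro add_mono mult_left_mono less_imp_le) auto
  also have "\<dots> = ennreal (e/2)"
    using e by (simp add: ennreal_plus[symmetric] ennreal_mult'[symmetric] ennreal_numeral[symmetric] del: ennreal_plus ennreal_numeral)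
  also have "\<dots> < ennreal e" using e by (simp add: ennreal_lessI)
  finally show ?thesis using s(1) by auto
qed

end

context wiener begin

text \<open>The approximations are chosen so fast that the first moments of the increments of the elementary
  integrals are summable; hence these integrals converge almost surely. The almost sure limit along the
  same sequence is part of the conclusion, as it later yields a version that depends on the observations
  only.\<close>

lemma wiener_integral_exists:
  fixes C :: "real \<Rightarrow> real^'d^'n"
  assumes T: "0 \<le> T" and C: "continuous_on {0..T} C" and u: "u \<in> borel_measurable (lebesgue_on {0..T})"
    and fin: "cost C T u < top"
  obtains n \<tau> x I where "\<And>k. partition_of T (n k) (\<tau> k)"
    "(\<lambda>k. cost C T (\<lambda>t. step_function (n k) (\<tau> k) (x k) t - u t)) \<longlonglongrightarrow> 0"
    "has_wiener_integral M W R T u I"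
    "AE \<omega> in M. (\<lambda>k. step_integral W (n k) (\<tau> k) (x k) \<omega>) \<longlonglongrightarrow> I \<omega>"
proof -
  have "\<forall>k. \<exists>n \<tau> x. partition_of T n \<tau> \<and> cost C T (\<lambda>t. step_function n \<tau> x t - u t) < ennreal ((1/4)^k)"
    using cost_dense[OF T C u fin] by simp
  then obtain n \<tau> x where p: "\<And>k. partition_of T (n k) (\<tau> k)"
    and c: "\<And>k. cost C T (\<lambda>t. step_function (n k) (\<tau> k) (x k) t - u t) < ennreal ((1/4)^k)"
    by metis
  define f where "f k = step_function (n k) (\<tau> k) (x k)" for k
  define S where "S k = step_integral W (n k) (\<tau> k) (x k)" for k
  have sp: "simple_pair W T (f k) (S k)" for k using p by (auto simp: simple_pair_def f_def S_def)
  note [measurable] = simple_measurable(2)[OF sp]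
  have "(\<lambda>k. (1/4)^k) \<longlonglongrightarrow> (0::real)" by (rule LIMSEQ_power_zero) simp
  then have "(\<lambda>k. ennreal ((1/4)^k)) \<longlonglongrightarrow> ennreal 0" by (rule tendsto_ennrealI)
  then have z: "(\<lambda>k. ennreal ((1/4)^k)) \<longlonglongrightarrow> 0" unfolding ennreal_0 .
  have climit: "(\<lambda>k. cost C T (\<lambda>t. f k t - u t)) \<longlonglongrightarrow> 0"
    by (rule ennreal_tendsto_zero_le[OF z less_imp_le]) (unfold f_def, rule c)
  have cv: "cov_nn R T (\<lambda>t. f k t - u t) \<le> ennreal ((1/4)^k)" for k
    by (rule order_trans[OF cov_nn_le_cost less_imp_le]) (unfold f_def, rule c)
  \<comment> \<open>the second moments decay like \<open>4\<^sup>-\<^sup>k\<close>, so Young's inequality with weight \<open>2\<^sup>k\<close> gives first moments like \<open>2\<^sup>-\<^sup>k\<close>\<close>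
  have L1: "(\<integral>\<^sup>+\<omega>. ennreal \<bar>S (Suc k) \<omega> - S k \<omega>\<bar> \<partial>M) \<le> ennreal (3 * (1/2)^k)" for k
  proof -
    have "(\<integral>\<^sup>+\<omega>. ennreal ((S (Suc k) \<omega> - S k \<omega>)\<^sup>2) \<partial>M) \<le> 2 * cov_nn R T (\<lambda>t. f (Suc k) t - u t) + 2 * cov_nn R T (\<lambda>t. f k t - u t)"
      by (rule simple_cov_diff[OF T u sp sp])
    also have "\<dots> \<le> 2 * ennreal ((1/4)^(Suc k)) + 2 * ennreal ((1/4)^k)"
      by (intro add_mono mult_left_mono cv) auto
    also have "\<dots> = ennreal (5/2 * (1/4)^k)"
      by (simp add: ennreal_plus[symmetric] ennreal_mult'[symmetric] ennreal_numeral[symmetric] del: ennreal_plus ennreal_numeral)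
    finally have sq: "(\<integral>\<^sup>+\<omega>. ennreal ((S (Suc k) \<omega> - S k \<omega>)\<^sup>2) \<partial>M) \<le> ennreal (5/2 * (1/4)^k)" .
    have "(\<integral>\<^sup>+\<omega>. ennreal \<bar>S (Suc k) \<omega> - S k \<omega>\<bar> \<partial>M) \<le>
       (\<integral>\<^sup>+\<omega>. ennreal ((1/2)^k) + ennreal (2^k / 2) * ennreal ((S (Suc k) \<omega> - S k \<omega>)\<^sup>2) \<partial>M)"
    proof (rule nn_integral_mono)
      fix \<omega>
      define d where "d = \<bar>S (Suc k) \<omega> - S k \<omega>\<bar>"
      have "0 \<le> (2^k * d - 1)\<^sup>2 / (2 * 2^k)" by simp
      then have "d \<le> 1/(2*2^k) + 2^k/2 * d\<^sup>2" by (simp add: power2_diff field_simps power2_eq_square)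
      also have "\<dots> \<le> (1/2)^k + 2^k/2 * d\<^sup>2" by (simp add: power_one_over field_simps)
      finally have "ennreal d \<le> ennreal ((1/2)^k + 2^k/2 * d\<^sup>2)" by (rule ennreal_leI)
      also have "\<dots> = ennreal ((1/2)^k) + ennreal (2^k / 2) * ennreal (d\<^sup>2)"
        by (simp add: ennreal_mult'[symmetric])
      finally show "ennreal \<bar>S (Suc k) \<omega> - S k \<omega>\<bar> \<le> ennreal ((1/2)^k) + ennreal (2^k / 2) * ennreal ((S (Suc k) \<omega> - S k \<omega>)\<^sup>2)"
        by (simp add: d_def)
    qed
    also have "\<dots> = ennreal ((1/2)^k) + ennreal (2^k / 2) * (\<integral>\<^sup>+\<omega>. ennreal ((S (Suc k) \<omega> - S k \<omega>)\<^sup>2) \<partial>M)"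
      by (subst nn_integral_add) (auto simp: nn_integral_cmult emeasure_space_1)
    also have "\<dots> \<le> ennreal ((1/2)^k) + ennreal (2^k / 2) * ennreal (5/2 * (1/4)^k)"
      by (intro add_left_mono mult_left_mono sq) auto
    also have "\<dots> = ennreal ((1/2)^k + 2^k/2 * (5/2 * (1/4)^k))"
      by (simp add: ennreal_mult'[symmetric])
    also have "\<dots> \<le> ennreal (3 * (1/2)^k)"
    proof (rule ennreal_leI)
      have "2^k * (1/4)^k = ((1/2)^k :: real)" by (simp add: power_mult_distrib[symmetric])
      moreover have "2^k/2 * (5/2 * (1/4)^k) = 5/4 * (2^k * (1/4)^k :: real)" by simp
      moreover have "(0::real) \<le> (1/2)^k" by simp
      ultimately show "(1/2)^k + 2^k/2 * (5/2 * (1/4)^k) \<le> (3 * (1/2)^k :: real)" by linarith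
    qed
    finally show ?thesis .
  qed
  have "(\<integral>\<^sup>+\<omega>. (\<Sum>k. ennreal \<bar>S (Suc k) \<omega> - S k \<omega>\<bar>) \<partial>M) = (\<Sum>k. \<integral>\<^sup>+\<omega>. ennreal \<bar>S (Suc k) \<omega> - S k \<omega>\<bar> \<partial>M)"
    by (rule nn_integral_suminf) measurable
  also have "\<dots> \<le> (\<Sum>k. ennreal (3 * (1/2)^k))" by (intro suminf_le L1) auto
  also have "\<dots> = ennreal (\<Sum>k. 3 * (1/2)^k)"
    by (rule suminf_ennreal2) (auto intro!: summable_mult summable_geometric)
  finally have "(\<integral>\<^sup>+\<omega>. (\<Sum>k. ennreal \<bar>S (Suc k) \<omega> - S k \<omega>\<bar>) \<partial>M) \<noteq> \<infinity>"
    using ennreal_less_top le_less_trans by (metis infinity_ennreal_def less_irrefl)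
  then have "AE \<omega> in M. (\<Sum>k. ennreal \<bar>S (Suc k) \<omega> - S k \<omega>\<bar>) \<noteq> \<infinity>"
    by (intro nn_integral_PInf_AE) measurable
  then have conv: "AE \<omega> in M. convergent (\<lambda>k. S k \<omega>)"
  proof eventually_elim
    case (elim \<omega>)
    then have "summable (\<lambda>k. \<bar>S (Suc k) \<omega> - S k \<omega>\<bar>)"
      by (intro summable_suminf_not_top) auto
    then have "summable (\<lambda>k. S (Suc k) \<omega> - S k \<omega>)" by (rule summable_rabs_cancel)
    moreover have "(\<Sum>i<k. S (Suc i) \<omega> - S i \<omega>) = S k \<omega> - S 0 \<omega>" for k
      by (rule sum_lessThan_telescope[of "\<lambda>i. S i \<omega>"])
    ultimately have "convergent (\<lambda>k. S k \<omega> - S 0 \<omega>)" by (simp add: summable_iff_convergent)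
    from convergent_add[OF this convergent_const[of "S 0 \<omega>"]]
    show "convergent (\<lambda>k. S k \<omega>)" by simp
  qed
  define I where "I \<omega> = lim (\<lambda>k. S k \<omega>)" for \<omega>
  have [measurable]: "I \<in> borel_measurable M"
    unfolding I_def by (rule borel_measurable_lim_metric) measurable
  have ae: "AE \<omega> in M. (\<lambda>k. S k \<omega>) \<longlonglongrightarrow> I \<omega>"
    using conv by eventually_elim (auto simp: I_def convergent_LIMSEQ_iff)
  have "has_wiener_integral M W R T u I"
    by (rule wiener_integral_from_AE_limit[OF T u sp ennreal_tendsto_zero_le[OF climit cov_nn_le_cost] _ ae]) measurable
  then show ?thesis using that[OF p climit[unfolded f_def]] ae[unfolded S_def] by blast
qed

lemma W_paths: "AE \<omega> in M. W 0 \<omega> = 0 \<and> continuous_on {0..T} (\<lambda>t. W t \<omega>)"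
proof -
  have "AE \<omega> in M. W 0 \<omega> = 0 \<and> continuous_on {0..} (\<lambda>t. W t \<omega>)"
    using W by (simp add: wiener_process_def)
  then show ?thesis by eventually_elim (auto intro: continuous_on_subset)
qed

text \<open>The step functions take the values of \<open>c\<close> at right endpoints and converge uniformly on the left-open
  interval.\<close>

lemma step_inner_integral_limit:
  fixes c :: "real \<Rightarrow> real^'n"
  assumes T: "0 \<le> T" and c: "continuous_on {0..T} c" and g: "g absolutely_integrable_on {0..T}"
  shows "(\<lambda>k. integral {0..T} (\<lambda>t. g t \<bullet> step_function (Suc k) (uniform_grid T (Suc k)) (\<lambda>i. c (uniform_grid T (Suc k) (Suc i))) t))
     \<longlonglongrightarrow> integral {0..T} (\<lambda>t. g t \<bullet> c t)"
proof (rule LIMSEQ_I)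
  fix e :: real assume e: "e > 0"
  let ?s = "\<lambda>k. step_function (Suc k) (uniform_grid T (Suc k)) (\<lambda>i. c (uniform_grid T (Suc k) (Suc i)))"
  define G where "G = integral {0..T} (\<lambda>t. norm (g t))"
  have gi: "g integrable_on {0..T}" "(\<lambda>t. norm (g t)) integrable_on {0..T}"
    using g by (auto simp: absolutely_integrable_on_def)
  have G0: "G \<ge> 0" unfolding G_def by (intro integral_nonneg gi) auto
  define d where "d = e / (2 * (G + 1))"
  have d: "d > 0" "G * d < e" using e G0 by (auto simp: d_def field_simps add_nonneg_pos)
  have part: "partition_of T (Suc k) (uniform_grid T (Suc k))" for k using T by (rule uniform_grid_partition) simp
  obtain N where N: "\<And>n. n \<ge> N \<Longrightarrow> \<forall>\<xi>. (\<forall>i<n. \<xi> i \<in> {uniform_grid T n i..uniform_grid T n (Suc i)}) \<longrightarrow>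
     (\<forall>t\<in>{0<..T}. norm (step_function n (uniform_grid T n) (\<lambda>i. c (\<xi> i)) t - c t) \<le> d)"
    using uniform_step_approx[OF c T d(1)] by auto
  have gci: "(\<lambda>t. g t \<bullet> c t) integrable_on {0..T}"
    using abs_integrable_inner[OF g c] by (simp add: inner_commute set_lebesgue_integral_eq_integral(1))
  have gsi: "(\<lambda>t. g t \<bullet> ?s k t) integrable_on {0..T}" for k
    using step_function_inner_integral[OF part gi(1)] by (rule has_integral_integrable)
  have "norm (integral {0..T} (\<lambda>t. g t \<bullet> ?s k t) - integral {0..T} (\<lambda>t. g t \<bullet> c t)) < e" if k: "k \<ge> N" for k
  proof -
    have "integral {0..T} (\<lambda>t. g t \<bullet> ?s k t) - integral {0..T} (\<lambda>t. g t \<bullet> c t) = integral {0..T} (\<lambda>t. g t \<bullet> ?s k t - g t \<bullet> c t)"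
      by (rule Henstock_Kurzweil_Integration.integral_diff[symmetric, OF gsi gci])
    also have "\<dots> = integral {0..T} (\<lambda>t. if t \<in> {0} then 0 else g t \<bullet> (?s k t - c t))"
      by (rule integral_spike[of "{0}"]) (auto simp: inner_diff_right)
    also have "norm \<dots> \<le> integral {0..T} (\<lambda>t. norm (g t) * d)"
    proof (rule integral_norm_bound_integral)
      have "(\<lambda>t. g t \<bullet> ?s k t - g t \<bullet> c t) integrable_on {0..T}" by (rule integrable_diff[OF gsi gci])
      then show "(\<lambda>t. if t \<in> {0} then 0 else g t \<bullet> (?s k t - c t)) integrable_on {0..T}"
        by (rule integrable_spike[of _ _ "{0}"]) (auto simp: inner_diff_right)
      show "(\<lambda>t. norm (g t) * d) integrable_on {0..T}"
        using integrable_on_mult_left[OF gi(2), of d] by (simp add: mult.commute)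
      fix t assume t: "t \<in> {0..T}"
      show "norm (if t \<in> {0} then 0 else g t \<bullet> (?s k t - c t)) \<le> norm (g t) * d"
      proof (cases "t = 0")
        case False
        have "norm (g t \<bullet> (?s k t - c t)) \<le> norm (g t) * norm (?s k t - c t)"
          using Cauchy_Schwarz_ineq2 by simp
        also have "norm (?s k t - c t) \<le> d"
          using N[of "Suc k"] k t False part[of k] by (auto simp: partition_of_def)
        finally show ?thesis using False by (simp add: mult_left_mono)
      qed (use d in auto)
    qed
    also have "\<dots> = G * d" unfolding G_def by (simp add: integral_mult_left)
    finally show ?thesis using d(2) by simp
  qed
  then show "\<exists>N. \<forall>k\<ge>N. norm (integral {0..T} (\<lambda>t. g t \<bullet> ?s k t) - integral {0..T} (\<lambda>t. g t \<bullet> c t)) < e" by blast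
qed

text \<open>Summation by parts turns the elementary integral into \<open>p T \<bullet> W T\<close> minus an integral of \<open>p'\<close> against a
  step approximation of the path. In this way stochastic integrals of absolutely continuous integrands
  are evaluated path by path.\<close>

lemma wiener_integral_by_parts:
  fixes p p' :: "real \<Rightarrow> real^'n"
  assumes T: "0 \<le> T" and p': "p' absolutely_integrable_on {0..T}"
    and p: "\<And>t. t \<in> {0..T} \<Longrightarrow> p t = p0 + integral {0..t} p'"
  obtains I where "has_wiener_integral M W R T p I"
    "AE \<omega> in M. I \<omega> = p T \<bullet> W T \<omega> - integral {0..T} (\<lambda>t. p' t \<bullet> W t \<omega>)"
proof -
  have p'i: "p' integrable_on {0..T}" using p' by (simp add: set_lebesgue_integral_eq_integral(1))
  have "continuous_on {0..T} (\<lambda>t. p0 + integral {0..t} p')"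
    by (intro continuous_intros indefinite_integral_continuous_1 p'i)
  then have pc: "continuous_on {0..T} p"
    by (rule continuous_on_eq) (use p in auto)
  let ?\<tau> = "\<lambda>k. uniform_grid T (Suc k)"
  have part: "partition_of T (Suc k) (?\<tau> k)" for k using T by (rule uniform_grid_partition) simp
  define f where "f k = step_function (Suc k) (?\<tau> k) (\<lambda>i. p (?\<tau> k i))" for k
  define S where "S k = step_integral W (Suc k) (?\<tau> k) (\<lambda>i. p (?\<tau> k i))" for k
  have sp: "simple_pair W T (f k) (S k)" for k using part by (auto simp: simple_pair_def f_def S_def)
  note [measurable] = simple_measurable(2)[OF sp]
  have cl: "(\<lambda>k. cov_nn R T (\<lambda>t. f k t - p t)) \<longlonglongrightarrow> 0"
  proof (rule ennreal_tendsto_zero_le[OF _ cov_nn_le_cost])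
    show "(\<lambda>k. cost (\<lambda>_. 0 :: real^'n^'n) T (\<lambda>t. f k t - p t)) \<longlonglongrightarrow> 0"
      unfolding f_def by (rule cost_uniform_steps[OF T continuous_on_const pc])
  qed
  have lim: "(\<lambda>k. S k \<omega>) \<longlonglongrightarrow> p T \<bullet> W T \<omega> - integral {0..T} (\<lambda>t. p' t \<bullet> W t \<omega>)"
    if w: "W 0 \<omega> = 0" "continuous_on {0..T} (\<lambda>t. W t \<omega>)" for \<omega>
  proof -
    have "S k \<omega> = p T \<bullet> W T \<omega> - integral {0..T} (\<lambda>t. p' t \<bullet> step_function (Suc k) (?\<tau> k) (\<lambda>i. W (?\<tau> k (Suc i)) \<omega>) t)" for k
    proof -
      have piece: "integral {?\<tau> k i..?\<tau> k (Suc i)} p' = p (?\<tau> k (Suc i)) - p (?\<tau> k i)" if "i < Suc k" for i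
      proof -
        have r: "0 \<le> ?\<tau> k i" "?\<tau> k i \<le> ?\<tau> k (Suc i)" "?\<tau> k (Suc i) \<le> T"
          using partition_range[OF part] partition_mono[OF part, of i "Suc i"] that by auto
        have "integral {0..?\<tau> k i} p' + integral {?\<tau> k i..?\<tau> k (Suc i)} p' = integral {0..?\<tau> k (Suc i)} p'"
          by (rule Henstock_Kurzweil_Integration.integral_combine[OF r(1,2) integrable_subinterval_real[OF p'i]]) (use r in auto)
        then show ?thesis using p[of "?\<tau> k i"] p[of "?\<tau> k (Suc i)"] r by (simp add: algebra_simps)
      qed
      have "integral {0..T} (\<lambda>t. p' t \<bullet> step_function (Suc k) (?\<tau> k) (\<lambda>i. W (?\<tau> k (Suc i)) \<omega>) t)
         = (\<Sum>i<Suc k. integral {?\<tau> k i..?\<tau> k (Suc i)} p' \<bullet> W (?\<tau> k (Suc i)) \<omega>)"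
        by (rule integral_unique[OF step_function_inner_integral[OF part p'i]])
      also have "\<dots> = (\<Sum>i<Suc k. (p (?\<tau> k (Suc i)) - p (?\<tau> k i)) \<bullet> W (?\<tau> k (Suc i)) \<omega>)"
        by (rule sum.cong[OF refl]) (subst piece, auto)
      also have "\<dots> + S k \<omega> = (\<Sum>i<Suc k. p (?\<tau> k (Suc i)) \<bullet> W (?\<tau> k (Suc i)) \<omega> - p (?\<tau> k i) \<bullet> W (?\<tau> k i) \<omega>)"
        unfolding S_def step_integral_def sum.distrib[symmetric]
        by (rule sum.cong[OF refl]) (simp add: inner_diff_left inner_diff_right)
      also have "\<dots> = p (?\<tau> k (Suc k)) \<bullet> W (?\<tau> k (Suc k)) \<omega> - p (?\<tau> k 0) \<bullet> W (?\<tau> k 0) \<omega>"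
        by (rule sum_lessThan_telescope[of "\<lambda>i. p (?\<tau> k i) \<bullet> W (?\<tau> k i) \<omega>"])
      also have "\<dots> = p T \<bullet> W T \<omega>" using part[of k] w(1) by (simp add: partition_of_def)
      finally show ?thesis by simp
    qed
    then show ?thesis
      by (simp only:) (intro tendsto_diff tendsto_const step_inner_integral_limit[OF T w(2) p'])
  qed
  define I where "I \<omega> = lim (\<lambda>k. S k \<omega>)" for \<omega>
  have [measurable]: "I \<in> borel_measurable M"
    unfolding I_def by (rule borel_measurable_lim_metric) measurable
  have Ieq: "AE \<omega> in M. I \<omega> = p T \<bullet> W T \<omega> - integral {0..T} (\<lambda>t. p' t \<bullet> W t \<omega>)"
    using W_paths[of T] by eventually_elim (use lim in \<open>auto simp: I_def limI\<close>)
  have ae: "AE \<omega> in M. (\<lambda>k. S k \<omega>) \<longlonglongrightarrow> I \<omega>"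
    using W_paths[of T] Ieq by eventually_elim (use lim in auto)
  have "has_wiener_integral M W R T p I"
    by (rule wiener_integral_from_AE_limit[OF T continuous_on_imp_lebesgue_measurable[OF pc] sp cl _ ae]) measurable
  then show ?thesis using Ieq that by blast
qed

end

section \<open>Independence from characteristic functions\<close>

context prob_space begin

lemma bounded_integrable:
  fixes f :: "'a \<Rightarrow> 'b::{banach,second_countable_topology}"
  assumes "f \<in> borel_measurable M" "\<And>\<omega>. norm (f \<omega>) \<le> K" shows "integrable M f"
  by (rule integrable_const_bound[of _ K]) (use assms in auto)

text \<open>The positive and the negative part of the weight, normalised, are two probability densities under which
  \<open>Y\<close> has the same characteristic function, hence the same law.\<close>

lemma weighted_char_zero_real:
  fixes h Y :: "'a \<Rightarrow> real"
  assumes [measurable]: "h \<in> borel_measurable M" "Y \<in> borel_measurable M" "D \<in> sets borel"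
    and K: "\<And>\<omega>. \<bar>h \<omega>\<bar> \<le> K"
    and z: "\<And>s. (CLINT \<omega>|M. complex_of_real (h \<omega>) * iexp (s * Y \<omega>)) = 0"
  shows "(\<integral>\<omega>. h \<omega> * indicator D (Y \<omega>) \<partial>M) = 0"
proof -
  define p where "p \<omega> = max (h \<omega>) 0" for \<omega>
  define n where "n \<omega> = max (- h \<omega>) 0" for \<omega>
  have [measurable]: "p \<in> borel_measurable M" "n \<in> borel_measurable M" unfolding p_def n_def by measurable
  have pn: "h \<omega> = p \<omega> - n \<omega>" "0 \<le> p \<omega>" "0 \<le> n \<omega>" "p \<omega> \<le> K" "n \<omega> \<le> K" for \<omega>
    using K[of \<omega>] by (auto simp: p_def n_def max_def)
  have pi: "integrable M p" "integrable M n"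
    by (rule bounded_integrable[of _ K]; use pn in auto)+
  have ci: "integrable M (\<lambda>\<omega>. complex_of_real (w \<omega>) * (iexp (s * Y \<omega>)))"
    if "w = p \<or> w = n" for w s
    by (rule bounded_integrable[of _ K]) (use that pn in \<open>auto simp: norm_mult\<close>)
  have eq: "(CLINT \<omega>|M. complex_of_real (p \<omega>) * iexp (s * Y \<omega>)) = (CLINT \<omega>|M. complex_of_real (n \<omega>) * iexp (s * Y \<omega>))" for s
  proof -
    have "(CLINT \<omega>|M. complex_of_real (p \<omega>) * iexp (s * Y \<omega>)) - (CLINT \<omega>|M. complex_of_real (n \<omega>) * iexp (s * Y \<omega>))
      = (CLINT \<omega>|M. complex_of_real (p \<omega>) * iexp (s * Y \<omega>) - complex_of_real (n \<omega>) * iexp (s * Y \<omega>))"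
      by (rule Bochner_Integration.integral_diff[symmetric]; rule ci) auto
    also have "\<dots> = (CLINT \<omega>|M. complex_of_real (h \<omega>) * iexp (s * Y \<omega>))"
      by (intro Bochner_Integration.integral_cong) (simp_all add: pn(1) left_diff_distrib)
    finally show ?thesis using z[of s] by simp
  qed
  define c where "c = (\<integral>\<omega>. p \<omega> \<partial>M)"
  have "complex_of_real (\<integral>\<omega>. p \<omega> \<partial>M) = complex_of_real (\<integral>\<omega>. n \<omega> \<partial>M)"
    using eq[of 0] by simp
  then have cn: "(\<integral>\<omega>. n \<omega> \<partial>M) = c" by (simp only: of_real_eq_iff c_def)
  have c0: "0 \<le> c" unfolding c_def by (intro integral_nonneg_AE) (simp add: pn)
  have pDi: "integrable M (\<lambda>\<omega>. w \<omega> * indicator D (Y \<omega>))" if "w = p \<or> w = n" for w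
    by (rule bounded_integrable[of _ K]) (use that pn K order_trans[OF abs_ge_zero K] in \<open>auto split: split_indicator\<close>)
  have split: "(\<integral>\<omega>. h \<omega> * indicator D (Y \<omega>) \<partial>M) = (\<integral>\<omega>. p \<omega> * indicator D (Y \<omega>) \<partial>M) - (\<integral>\<omega>. n \<omega> * indicator D (Y \<omega>) \<partial>M)"
    unfolding pn(1) left_diff_distrib by (rule Bochner_Integration.integral_diff; rule pDi) auto
  show ?thesis
  proof (cases "c = 0")
    case True
    have "AE \<omega> in M. p \<omega> = 0" "AE \<omega> in M. n \<omega> = 0"
      using True integral_nonneg_eq_0_iff_AE[OF pi(1)] integral_nonneg_eq_0_iff_AE[OF pi(2)] cn pn by (auto simp: c_def)
    then have "AE \<omega> in M. h \<omega> * indicator D (Y \<omega>) = 0" by eventually_elim (simp add: pn(1))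
    then show ?thesis by (rule integral_eq_zero_AE)
  next
    case False
    then have c: "c > 0" using c0 by simp
    define N where "N w = density M (\<lambda>\<omega>. ennreal (w \<omega> / c))" for w
    have prob: "prob_space (N w)" if "w = p \<or> w = n" for w
    proof
      have [measurable]: "w \<in> borel_measurable M" using that by auto
      have "emeasure (N w) (space (N w)) = (\<integral>\<^sup>+\<omega>. ennreal (w \<omega> / c) \<partial>M)"
        unfolding N_def by (simp add: emeasure_density)
      also have "\<dots> = ennreal (\<integral>\<omega>. w \<omega> / c \<partial>M)"
        using that pi pn c by (intro nn_integral_eq_integral) auto
      also have "(\<integral>\<omega>. w \<omega> / c \<partial>M) = 1" using that cn c by (auto simp: c_def)
      finally show "emeasure (N w) (space (N w)) = 1" by simp
    qed
    have int: "(\<integral>x. g x \<partial>distr (N w) borel Y) = (\<integral>\<omega>. (w \<omega> / c) *\<^sub>R g (Y \<omega>) \<partial>M)"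
      if "w = p \<or> w = n" and [measurable]: "g \<in> borel_measurable borel" for w and g :: "real \<Rightarrow> 'b::{banach,second_countable_topology}"
    proof -
      have [measurable]: "w \<in> borel_measurable M" using that by auto
      show ?thesis unfolding N_def
        by (subst integral_distr) (use that pn c in \<open>auto simp: integral_density intro!: AE_I2\<close>)
    qed
    have "distr (N p) borel Y = distr (N n) borel Y"
    proof (rule Levy_uniqueness)
      have "Y \<in> borel_measurable (N w)" for w by (simp add: N_def)
      then show "real_distribution (distr (N p) borel Y)" "real_distribution (distr (N n) borel Y)"
        by (auto intro!: prob_space.real_distribution_distr prob)
      show "char (distr (N p) borel Y) = char (distr (N n) borel Y)"
      proof
        fix s
        have "char (distr (N w) borel Y) s = (CLINT \<omega>|M. complex_of_real (w \<omega>) * iexp (s * Y \<omega>)) / complex_of_real c"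
          if "w = p \<or> w = n" for w
          unfolding char_def
          by (subst int[OF that]) (auto simp: scaleR_conv_of_real)
        then show "char (distr (N p) borel Y) s = char (distr (N n) borel Y) s" using eq[of s] by simp
      qed
    qed
    moreover have "(\<integral>x. (indicator D x :: real) \<partial>distr (N w) borel Y) = (\<integral>\<omega>. w \<omega> * indicator D (Y \<omega>) \<partial>M) / c"
      if "w = p \<or> w = n" for w
      by (subst int[OF that]) (auto simp del: integral_indicator)
    ultimately have "(\<integral>\<omega>. p \<omega> * indicator D (Y \<omega>) \<partial>M) / c = (\<integral>\<omega>. n \<omega> * indicator D (Y \<omega>) \<partial>M) / c"
      by metis
    then show ?thesis using c split by simp
  qed
qed

text \<open>Uniqueness of the Fourier transform for complex measures. Conjugation maps \<open>s\<close> to \<open>- s\<close>, so the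
  hypothesis is inherited by the real and the imaginary part of the weight.\<close>

lemma weighted_char_zero:
  fixes h :: "'a \<Rightarrow> complex" and Y :: "'a \<Rightarrow> real"
  assumes [measurable]: "h \<in> borel_measurable M" "Y \<in> borel_measurable M" "D \<in> sets borel"
    and K: "\<And>\<omega>. cmod (h \<omega>) \<le> K"
    and z: "\<And>s. (CLINT \<omega>|M. h \<omega> * iexp (s * Y \<omega>)) = 0"
  shows "(CLINT \<omega>|M. h \<omega> * indicator D (Y \<omega>)) = 0"
proof -
  have K0: "0 \<le> K" using order_trans[OF norm_ge_zero K] .
  have hi: "integrable M (\<lambda>\<omega>. h \<omega> * iexp (s * Y \<omega>))" for s
    by (rule bounded_integrable[of _ K]) (use K in \<open>auto simp: norm_mult\<close>)
  have cz: "(CLINT \<omega>|M. cnj (h \<omega>) * iexp (s * Y \<omega>)) = 0" for s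
  proof -
    have "(CLINT \<omega>|M. cnj (h \<omega>) * iexp (s * Y \<omega>)) = (CLINT \<omega>|M. cnj (h \<omega> * iexp ((- s) * Y \<omega>)))"
      by (intro Bochner_Integration.integral_cong) (simp_all add: exp_cnj)
    also have "\<dots> = cnj (CLINT \<omega>|M. h \<omega> * iexp ((- s) * Y \<omega>))" by (rule Bochner_Integration.integral_cnj)
    finally show ?thesis using z[of "- s"] by simp
  qed
  have ci: "integrable M (\<lambda>\<omega>. cnj (h \<omega>) * iexp (s * Y \<omega>))" for s
    using integrable_cnj[OF hi[of "- s"]] by (simp add: exp_cnj)
  have re: "(\<integral>\<omega>. Re (h \<omega>) * indicator D (Y \<omega>) \<partial>M) = 0"
  proof (rule weighted_char_zero_real[of _ _ _ K])
    fix s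
    have "(CLINT \<omega>|M. complex_of_real (Re (h \<omega>)) * iexp (s * Y \<omega>)) =
       (CLINT \<omega>|M. (h \<omega> * iexp (s * Y \<omega>) + cnj (h \<omega>) * iexp (s * Y \<omega>)) / 2)"
      by (intro Bochner_Integration.integral_cong refl) (simp add: complex_eq_iff algebra_simps)
    then show "(CLINT \<omega>|M. complex_of_real (Re (h \<omega>)) * iexp (s * Y \<omega>)) = 0"
      using z[of s] cz[of s] hi ci by simp
  qed (auto intro: order_trans[OF abs_Re_le_cmod K])
  have im: "(\<integral>\<omega>. Im (h \<omega>) * indicator D (Y \<omega>) \<partial>M) = 0"
  proof (rule weighted_char_zero_real[of _ _ _ K])
    fix s
    have "(CLINT \<omega>|M. complex_of_real (Im (h \<omega>)) * iexp (s * Y \<omega>)) =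
       (CLINT \<omega>|M. (h \<omega> * iexp (s * Y \<omega>) - cnj (h \<omega>) * iexp (s * Y \<omega>)) * (- \<i> / 2))"
      by (intro Bochner_Integration.integral_cong refl) (simp add: complex_eq_iff field_simps)
    then show "(CLINT \<omega>|M. complex_of_real (Im (h \<omega>)) * iexp (s * Y \<omega>)) = 0"
      using z[of s] cz[of s] hi ci by simp
  qed (auto intro: order_trans[OF abs_Im_le_cmod K])
  have "integrable M (\<lambda>\<omega>. h \<omega> * indicator D (Y \<omega>))"
    by (rule bounded_integrable[of _ K]) (use K K0 in \<open>auto simp: norm_mult split: split_indicator\<close>)
  then have "Re (CLINT \<omega>|M. h \<omega> * indicator D (Y \<omega>)) = (\<integral>\<omega>. Re (h \<omega> * indicator D (Y \<omega>)) \<partial>M)"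
    "Im (CLINT \<omega>|M. h \<omega> * indicator D (Y \<omega>)) = (\<integral>\<omega>. Im (h \<omega> * indicator D (Y \<omega>)) \<partial>M)"
    by (simp_all only: integral_Re integral_Im)
  moreover have "Re (h \<omega> * indicator D (Y \<omega>)) = Re (h \<omega>) * indicator D (Y \<omega>)"
    "Im (h \<omega> * indicator D (Y \<omega>)) = Im (h \<omega>) * indicator D (Y \<omega>)" for \<omega>
    by (auto split: split_indicator)
  ultimately show ?thesis using re im by (simp add: complex_eq_iff)
qed

definition cylinders :: "('a \<Rightarrow> real) set \<Rightarrow> 'a set set" where
  "cylinders V = {{\<omega>\<in>space M. \<forall>(Y, D)\<in>set L. Y \<omega> \<in> D} | L. \<forall>(Y, D)\<in>set L. Y \<in> V \<and> D \<in> sets borel}"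

lemma cylinders_Int_stable: "Int_stable (cylinders V)"
proof (rule Int_stableI)
  fix A B assume "A \<in> cylinders V" "B \<in> cylinders V"
  then obtain L L' where "A = {\<omega>\<in>space M. \<forall>(Y, D)\<in>set L. Y \<omega> \<in> D}" "\<forall>(Y, D)\<in>set L. Y \<in> V \<and> D \<in> sets borel"
     "B = {\<omega>\<in>space M. \<forall>(Y, D)\<in>set L'. Y \<omega> \<in> D}" "\<forall>(Y, D)\<in>set L'. Y \<in> V \<and> D \<in> sets borel"
    unfolding cylinders_def by blast
  then show "A \<inter> B \<in> cylinders V"
    unfolding cylinders_def by (intro CollectI exI[of _ "L @ L'"]) auto
qed

lemma cylinder_single: "Y \<in> V \<Longrightarrow> D \<in> sets borel \<Longrightarrow> Y -` D \<inter> space M \<in> cylinders V"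
  unfolding cylinders_def by (intro CollectI exI[of _ "[(Y, D)]"]) auto

text \<open>The one-dimensional statement is applied once for each constraint \<open>Y \<in> D\<close>; the indicators already
  obtained and the exponentials still needed are part of the weight. This replaces a uniqueness theorem
  for characteristic functions in several variables.\<close>

lemma cylinder_char_zero:
  fixes V :: "('a \<Rightarrow> real) set"
  assumes V: "\<And>Y. Y \<in> V \<Longrightarrow> Y \<in> borel_measurable M"
    and lin: "\<And>Y Z s. Y \<in> V \<Longrightarrow> Z \<in> V \<Longrightarrow> (\<lambda>\<omega>. s * Y \<omega> + Z \<omega>) \<in> V"
    and h: "h \<in> borel_measurable M" "\<And>\<omega>. cmod (h \<omega>) \<le> K"
    and z: "\<And>Y. Y \<in> V \<Longrightarrow> (CLINT \<omega>|M. h \<omega> * iexp (Y \<omega>)) = 0"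
    and L: "\<forall>(Y, D)\<in>set L. Y \<in> V \<and> D \<in> sets borel" and Z: "Z \<in> V"
  shows "(CLINT \<omega>|M. h \<omega> * (iexp (Z \<omega>) * indicator {\<omega>. \<forall>(Y, D)\<in>set L. Y \<omega> \<in> D} \<omega>)) = 0"
  using L Z
proof (induction L arbitrary: Z)
  case Nil
  then show ?case using z by simp
next
  case (Cons YD L)
  obtain Y D where YD: "YD = (Y, D)" by force
  have Y: "Y \<in> V" and D: "D \<in> sets borel" and L: "\<forall>(Y, D)\<in>set L. Y \<in> V \<and> D \<in> sets borel"
    using Cons.prems(1) YD by auto
  let ?A = "{\<omega>. \<forall>(Y, D)\<in>set L. Y \<omega> \<in> D}"
  define w where "w \<omega> = h \<omega> * (iexp (Z \<omega>) * indicator ?A \<omega>)" for \<omega>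
  have Am: "(\<lambda>\<omega>. indicator ?A \<omega> :: complex) \<in> borel_measurable M"
  proof -
    have "{\<omega>\<in>space M. \<forall>x\<in>set L. fst x \<omega> \<in> snd x} \<in> sets M"
    proof (intro sets.sets_Collect_finite_All)
      fix x assume "x \<in> set L"
      then have [measurable]: "fst x \<in> borel_measurable M" "snd x \<in> sets borel" using L V by auto
      show "{\<omega> \<in> space M. fst x \<omega> \<in> snd x} \<in> sets M" by measurable
    qed auto
    then have "?A \<inter> space M \<in> sets M" by (simp add: split_def Int_def conj_commute)
    then show ?thesis by (simp add: borel_measurable_indicator_iff)
  qed
  have "(CLINT \<omega>|M. w \<omega> * indicator D (Y \<omega>)) = 0"
  proof (rule weighted_char_zero[where K = K])
    show "w \<in> borel_measurable M" unfolding w_def using h(1) V[OF Cons.prems(2)] Am by measurable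
    show "Y \<in> borel_measurable M" by (rule V[OF Y])
    show "cmod (w \<omega>) \<le> K" for \<omega>
      using h(2)[of \<omega>] order_trans[OF norm_ge_zero h(2)] by (auto simp: w_def norm_mult split: split_indicator)
    fix s
    have "(CLINT \<omega>|M. w \<omega> * iexp (s * Y \<omega>)) = (CLINT \<omega>|M. h \<omega> * (iexp (s * Y \<omega> + Z \<omega>) * indicator ?A \<omega>))"
      by (intro Bochner_Integration.integral_cong refl) (simp add: w_def exp_add distrib_left mult_ac)
    also have "\<dots> = 0" by (rule Cons.IH[OF L lin[OF Y Cons.prems(2)]])
    finally show "(CLINT \<omega>|M. w \<omega> * iexp (s * Y \<omega>)) = 0" .
  qed (rule D)
  moreover have "h \<omega> * (iexp (Z \<omega>) * indicator {\<omega>. \<forall>(Y, D)\<in>set (YD # L). Y \<omega> \<in> D} \<omega>) = w \<omega> * indicator D (Y \<omega>)" for \<omega>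
    by (auto simp: w_def YD split: split_indicator)
  ultimately show ?case by simp
qed

text \<open>First \<open>iexp (Y \<omega>)\<close>, centred, is the weight and \<open>e\<close> the variable; then the centred indicator of \<open>e \<in> D\<close>
  is the weight and the elements of \<open>V\<close> are the variables.\<close>

theorem indep_of_char_product:
  fixes V :: "('a \<Rightarrow> real) set" and e :: "'a \<Rightarrow> real"
  assumes e: "e \<in> borel_measurable M" and V: "\<And>Y. Y \<in> V \<Longrightarrow> Y \<in> borel_measurable M"
    and V0: "(\<lambda>_. 0) \<in> V" and lin: "\<And>Y Z s. Y \<in> V \<Longrightarrow> Z \<in> V \<Longrightarrow> (\<lambda>\<omega>. s * Y \<omega> + Z \<omega>) \<in> V"
    and char: "\<And>Y s. Y \<in> V \<Longrightarrow> (CLINT \<omega>|M. iexp (s * e \<omega> + Y \<omega>)) = (CLINT \<omega>|M. iexp (s * e \<omega>)) * (CLINT \<omega>|M. iexp (Y \<omega>))"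
  shows "indep_set (sigma_sets (space M) (cylinders V)) {e -` D \<inter> space M | D. D \<in> sets borel}"
proof -
  have prod: "prob (A \<inter> (e -` D \<inter> space M)) = prob A * prob (e -` D \<inter> space M) \<and> A \<in> events"
    if A: "A \<in> cylinders V" and D[measurable]: "D \<in> sets borel" for A D
  proof -
    note [measurable] = e
    define q where "q = prob (e -` D \<inter> space M)"
    have qe: "q = (\<integral>\<omega>. indicator D (e \<omega>) \<partial>M)"
    proof -
      have "(\<integral>\<omega>. indicator D (e \<omega>) \<partial>M) = (\<integral>\<omega>. (indicator (e -` D \<inter> space M) \<omega> :: real) \<partial>M)"
        by (intro Bochner_Integration.integral_cong) (auto split: split_indicator)
      then show ?thesis by (simp add: q_def)
    qed
    \<comment> \<open>independence of \<open>A\<close> and \<open>e \<in> D\<close> says that this weight integrates to zero over \<open>A\<close>\<close>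
    define h where "h \<omega> = complex_of_real (indicator D (e \<omega>) - q)" for \<omega>
    have hm: "h \<in> borel_measurable M" unfolding h_def by measurable
    have hK: "cmod (h \<omega>) \<le> 1" for \<omega>
      unfolding h_def norm_of_real q_def using prob_le_1[of "e -` D \<inter> space M"] by (auto split: split_indicator)
    have z: "(CLINT \<omega>|M. h \<omega> * iexp (Y \<omega>)) = 0" if Y: "Y \<in> V" for Y
    proof -
      note [measurable] = V[OF Y]
      define a where "a = (CLINT \<omega>|M. iexp (Y \<omega>))"
      have ii: "integrable M (\<lambda>\<omega>. iexp (Y \<omega>))" by (rule iexp_integrable) measurable
      have "cmod a \<le> (\<integral>\<omega>. cmod (iexp (Y \<omega>)) \<partial>M)" unfolding a_def by (rule integral_norm_bound)
      then have a1: "cmod a \<le> 1" by (simp add: prob_space)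
      have "(CLINT \<omega>|M. (iexp (Y \<omega>) - a) * indicator D (e \<omega>)) = 0"
      proof (rule weighted_char_zero[where K = 2])
        show "cmod (iexp (Y \<omega>) - a) \<le> 2" for \<omega>
          using norm_triangle_ineq4[of "iexp (Y \<omega>)" a] a1 by simp
        fix s
        have i1: "integrable M (\<lambda>\<omega>. iexp (s * e \<omega> + Y \<omega>))" and i2: "integrable M (\<lambda>\<omega>. iexp (s * e \<omega>))"
          by (rule iexp_integrable; measurable)+
        have "(CLINT \<omega>|M. (iexp (Y \<omega>) - a) * iexp (s * e \<omega>)) = (CLINT \<omega>|M. iexp (s * e \<omega> + Y \<omega>) - a * iexp (s * e \<omega>))"
          by (intro Bochner_Integration.integral_cong refl) (simp add: exp_add algebra_simps)
        also have "\<dots> = (CLINT \<omega>|M. iexp (s * e \<omega> + Y \<omega>)) - a * (CLINT \<omega>|M. iexp (s * e \<omega>))"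
          using i1 i2 by (subst Bochner_Integration.integral_diff) auto
        also have "\<dots> = 0" using char[OF Y, of s] by (simp add: a_def mult.commute)
        finally show "(CLINT \<omega>|M. (iexp (Y \<omega>) - a) * iexp (s * e \<omega>)) = 0" .
      qed (measurable)
      then have "(CLINT \<omega>|M. iexp (Y \<omega>) * indicator D (e \<omega>) - a * indicator D (e \<omega>)) = 0"
        by (simp add: left_diff_distrib)
      moreover have j1: "integrable M (\<lambda>\<omega>. iexp (Y \<omega>) * indicator D (e \<omega>))"
        by (rule bounded_integrable[of _ 1]) (auto simp: norm_mult split: split_indicator)
      moreover have j2: "integrable M (\<lambda>\<omega>. complex_of_real (indicator D (e \<omega>)))"
        by (rule bounded_integrable[of _ 1]) (auto split: split_indicator)
      ultimately have k: "(CLINT \<omega>|M. iexp (Y \<omega>) * indicator D (e \<omega>)) = a * (CLINT \<omega>|M. complex_of_real (indicator D (e \<omega>)))"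
        by (subst (asm) Bochner_Integration.integral_diff) (auto simp: of_real_indicator)
      have "(CLINT \<omega>|M. h \<omega> * iexp (Y \<omega>)) = (CLINT \<omega>|M. iexp (Y \<omega>) * indicator D (e \<omega>) - complex_of_real q * iexp (Y \<omega>))"
        by (intro Bochner_Integration.integral_cong refl) (simp add: h_def algebra_simps of_real_indicator)
      also have "\<dots> = (CLINT \<omega>|M. iexp (Y \<omega>) * indicator D (e \<omega>)) - complex_of_real q * a"
        unfolding a_def using j1 ii by (subst Bochner_Integration.integral_diff) auto
      also have "(CLINT \<omega>|M. complex_of_real (indicator D (e \<omega>))) = complex_of_real q" unfolding qe by (rule integral_complex_of_real)
      with k have "(CLINT \<omega>|M. iexp (Y \<omega>) * indicator D (e \<omega>)) - complex_of_real q * a = 0" by simp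
      finally show ?thesis .
    qed
    obtain L where L: "A = {\<omega>\<in>space M. \<forall>(Y, D)\<in>set L. Y \<omega> \<in> D}" "\<forall>(Y, D)\<in>set L. Y \<in> V \<and> D \<in> sets borel"
      using A unfolding cylinders_def by blast
    have "{\<omega>\<in>space M. \<forall>x\<in>set L. fst x \<omega> \<in> snd x} \<in> sets M"
    proof (intro sets.sets_Collect_finite_All)
      fix x assume "x \<in> set L"
      then have [measurable]: "fst x \<in> borel_measurable M" "snd x \<in> sets borel" using L(2) V by auto
      show "{\<omega> \<in> space M. fst x \<omega> \<in> snd x} \<in> sets M" by measurable
    qed auto
    then have Am: "A \<in> events" unfolding L(1) by (simp add: split_def)
    have "(CLINT \<omega>|M. h \<omega> * (iexp 0 * indicator {\<omega>. \<forall>(Y, D)\<in>set L. Y \<omega> \<in> D} \<omega>)) = 0"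
      by (rule cylinder_char_zero[OF V lin hm hK z L(2) V0])
    moreover have "(CLINT \<omega>|M. h \<omega> * (iexp 0 * indicator {\<omega>. \<forall>(Y, D)\<in>set L. Y \<omega> \<in> D} \<omega>)) =
       (CLINT \<omega>|M. complex_of_real (indicator (A \<inter> (e -` D \<inter> space M)) \<omega> - q * indicator A \<omega>))"
      by (intro Bochner_Integration.integral_cong refl) (auto simp: h_def L(1) split: split_indicator)
    ultimately have "(\<integral>\<omega>. indicator (A \<inter> (e -` D \<inter> space M)) \<omega> - q * indicator A \<omega> \<partial>M) = 0"
      by (simp only: integral_complex_of_real of_real_eq_0_iff)
    moreover have "(\<integral>\<omega>. indicator (A \<inter> (e -` D \<inter> space M)) \<omega> - q * indicator A \<omega> \<partial>M) = prob (A \<inter> (e -` D \<inter> space M)) - q * prob A"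
      using Am by (subst Bochner_Integration.integral_diff) (auto intro!: integrable_real_indicator simp: emeasure_eq_measure)
    ultimately show ?thesis using Am by (simp add: q_def)
  qed
  have Dst: "Int_stable {e -` D \<inter> space M | D. D \<in> sets borel}"
  proof (rule Int_stableI)
    fix a b assume "a \<in> {e -` D \<inter> space M | D. D \<in> sets borel}" "b \<in> {e -` D \<inter> space M | D. D \<in> sets borel}"
    then obtain D D' where "a = e -` D \<inter> space M" "b = e -` D' \<inter> space M" "D \<in> sets borel" "D' \<in> sets borel" by auto
    then show "a \<inter> b \<in> {e -` D \<inter> space M | D. D \<in> sets borel}"
      by (intro CollectI exI[of _ "D \<inter> D'"]) auto
  qed
  have "indep_set (cylinders V) {e -` D \<inter> space M | D. D \<in> sets borel}"
  proof (rule indep_setI)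
    show "cylinders V \<subseteq> events" using prod[of _ UNIV] by auto
    show "{e -` D \<inter> space M | D. D \<in> sets borel} \<subseteq> events" using measurable_sets[OF e] by auto
    show "prob (a \<inter> b) = prob a * prob b" if "a \<in> cylinders V" "b \<in> {e -` D \<inter> space M | D. D \<in> sets borel}" for a b
      using that prod by auto
  qed
  from indep_set_sigma_sets[OF this cylinders_Int_stable Dst]
  show ?thesis unfolding indep_set_def
    by (rule indep_sets_mono_sets) (auto split: bool.splits)
qed

end

section \<open>Conditional expectations and the mean-square error\<close>

context prob_space begin

lemma sigma_finite_subalgebraI: "subalgebra M F \<Longrightarrow> sigma_finite_subalgebra M F"
proof -
  assume "subalgebra M F"
  then interpret finite_measure_subalgebra M F by unfold_locales
  show ?thesis by unfold_locales
qed

text \<open>The joint law of the observations and an independent variable is a product, so the conditional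
  expectation integrates out the independent variable with the other one held fixed.\<close>

lemma nn_cond_exp_indep_sum:
  fixes f :: "real \<Rightarrow> ennreal"
  assumes F: "subalgebra M F" and Y: "Y \<in> borel_measurable F" and e: "e \<in> borel_measurable M"
    and ind: "indep_set (sets F) {e -` D \<inter> space M | D. D \<in> sets borel}"
    and f[measurable]: "f \<in> borel_measurable borel"
  shows "AE \<omega> in M. (\<integral>\<^sup>+x. f (Y \<omega> + x) \<partial>distr M borel e) = nn_cond_exp M F (\<lambda>\<omega>. f (Y \<omega> + e \<omega>)) \<omega>"
proof -
  interpret S: sigma_finite_subalgebra M F by (rule sigma_finite_subalgebraI[OF F])
  interpret E: prob_space "distr M borel e" by (rule prob_space_distr[OF e])
  have YM: "Y \<in> borel_measurable M" by (rule measurable_from_subalg[OF F Y])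
  note [measurable] = Y e YM
  have idm: "(\<lambda>\<omega>. \<omega>) \<in> measurable M F" using F by (auto simp: subalgebra_def measurable_def)
  have pm: "(\<lambda>\<omega>. (\<omega>, e \<omega>)) \<in> measurable M (F \<Otimes>\<^sub>M borel)" by (intro measurable_Pair idm e)
  have joint: "distr M F (\<lambda>\<omega>. \<omega>) \<Otimes>\<^sub>M distr M borel e = distr M (F \<Otimes>\<^sub>M borel) (\<lambda>\<omega>. (\<omega>, e \<omega>))"
  proof (rule pair_measure_eqI)
    show "sigma_finite_measure (distr M F (\<lambda>\<omega>. \<omega>))" "sigma_finite_measure (distr M borel e)"
      using prob_space_distr[OF idm] prob_space_distr[OF e] by (auto intro!: prob_space_imp_sigma_finite)
    show "sets (distr M F (\<lambda>\<omega>. \<omega>) \<Otimes>\<^sub>M distr M borel e) = sets (distr M (F \<Otimes>\<^sub>M borel) (\<lambda>\<omega>. (\<omega>, e \<omega>)))"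
      by (simp cong: sets_pair_measure_cong)
    fix A B assume "A \<in> sets (distr M F (\<lambda>\<omega>. \<omega>))" "B \<in> sets (distr M borel e)"
    then have A: "A \<in> sets F" and B: "B \<in> sets borel" by auto
    have AM: "A \<in> events" "A \<subseteq> space M" using A F sets.sets_into_space[of A F] by (auto simp: subalgebra_def)
    have "prob (A \<inter> (e -` B \<inter> space M)) = prob A * prob (e -` B \<inter> space M)"
      by (rule indep_setD[OF ind A]) (use B in auto)
    moreover have "(\<lambda>\<omega>. (\<omega>, e \<omega>)) -` (A \<times> B) \<inter> space M = A \<inter> (e -` B \<inter> space M)" using AM by auto
    moreover have "(\<lambda>\<omega>. \<omega>) -` A \<inter> space M = A" using AM by auto
    ultimately show "emeasure (distr M F (\<lambda>\<omega>. \<omega>)) A * emeasure (distr M borel e) B =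
        emeasure (distr M (F \<Otimes>\<^sub>M borel) (\<lambda>\<omega>. (\<omega>, e \<omega>))) (A \<times> B)"
      using A B by (simp add: emeasure_distr[OF idm] emeasure_distr[OF e] emeasure_distr[OF pm] pair_measureI
          emeasure_eq_measure ennreal_mult'[symmetric])
  qed
  have Hm: "(\<lambda>\<omega>. \<integral>\<^sup>+x. f (Y \<omega> + x) \<partial>distr M borel e) \<in> borel_measurable F"
    by (rule E.borel_measurable_nn_integral) measurable
  show ?thesis
  proof (rule S.nn_cond_exp_charact[OF _ _ Hm])
    show "(\<lambda>\<omega>. f (Y \<omega> + e \<omega>)) \<in> borel_measurable M" by measurable
    fix A assume A[measurable]: "A \<in> sets F"
    let ?g = "\<lambda>z. f (Y (fst z) + snd z) * indicator A (fst z)"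
    have gm: "?g \<in> borel_measurable (F \<Otimes>\<^sub>M borel)" by measurable
    have "sets (distr M F (\<lambda>\<omega>. \<omega>) \<Otimes>\<^sub>M distr M borel e) = sets (F \<Otimes>\<^sub>M borel)"
      by (intro sets_pair_measure_cong) simp_all
    then have gm': "?g \<in> borel_measurable (distr M F (\<lambda>\<omega>. \<omega>) \<Otimes>\<^sub>M distr M borel e)"
      using gm measurable_cong_sets by blast
    have "(\<integral>\<^sup>+\<omega>. f (Y \<omega> + e \<omega>) * indicator A \<omega> \<partial>M) = (\<integral>\<^sup>+z. ?g z \<partial>distr M (F \<Otimes>\<^sub>M borel) (\<lambda>\<omega>. (\<omega>, e \<omega>)))"
      by (subst nn_integral_distr[OF pm]) (use gm in simp_all)
    also have "\<dots> = (\<integral>\<^sup>+\<omega>. \<integral>\<^sup>+x. ?g (\<omega>, x) \<partial>distr M borel e \<partial>distr M F (\<lambda>\<omega>. \<omega>))"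
      unfolding joint[symmetric] by (rule E.nn_integral_fst[symmetric, OF gm'])
    also have "\<dots> = (\<integral>\<^sup>+\<omega>. (\<integral>\<^sup>+x. f (Y \<omega> + x) \<partial>distr M borel e) * indicator A \<omega> \<partial>distr M F (\<lambda>\<omega>. \<omega>))"
      by (intro nn_integral_cong) (simp add: nn_integral_multc)
    also have "\<dots> = (\<integral>\<^sup>+\<omega>. (\<integral>\<^sup>+x. f (Y \<omega> + x) \<partial>distr M borel e) * indicator A \<omega> \<partial>M)"
      by (rule nn_integral_distr[OF idm]) (use Hm in simp)
    finally show "(\<integral>\<^sup>+\<omega>\<in>A. f (Y \<omega> + e \<omega>) \<partial>M) = (\<integral>\<^sup>+\<omega>\<in>A. (\<integral>\<^sup>+x. f (Y \<omega> + x) \<partial>distr M borel e) \<partial>M)" .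
  qed
qed

text \<open>The right-hand side depends on the law of \<open>e\<close> only, and it is meaningful for test functions that are not
  integrable; this is why it is not written as a Bochner integral.\<close>

lemma real_cond_exp_indep_sum:
  fixes g :: "real \<Rightarrow> real"
  assumes F: "subalgebra M F" and Y: "Y \<in> borel_measurable F" and e: "e \<in> borel_measurable M"
    and ind: "indep_set (sets F) {e -` D \<inter> space M | D. D \<in> sets borel}"
    and g[measurable]: "g \<in> borel_measurable borel"
    and S: "S \<in> borel_measurable M" "AE \<omega> in M. S \<omega> = Y \<omega> + e \<omega>"
  shows "AE \<omega> in M. real_cond_exp M F (\<lambda>\<omega>. g (S \<omega>)) \<omega> =
     enn2real (\<integral>\<^sup>+x. ennreal (g (Y \<omega> + x)) \<partial>distr M borel e) - enn2real (\<integral>\<^sup>+x. ennreal (- g (Y \<omega> + x)) \<partial>distr M borel e)"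
proof -
  interpret S: sigma_finite_subalgebra M F by (rule sigma_finite_subalgebraI[OF F])
  note [measurable] = e measurable_from_subalg[OF F Y] S(1)
  have "AE \<omega> in M. real_cond_exp M F (\<lambda>\<omega>. g (S \<omega>)) \<omega> = real_cond_exp M F (\<lambda>\<omega>. g (Y \<omega> + e \<omega>)) \<omega>"
    by (rule S.real_cond_exp_cong) (use S(2) in \<open>auto elim: eventually_mono\<close>)
  moreover have "AE \<omega> in M. (\<integral>\<^sup>+x. ennreal (g (Y \<omega> + x)) \<partial>distr M borel e) = nn_cond_exp M F (\<lambda>\<omega>. ennreal (g (Y \<omega> + e \<omega>))) \<omega>"
    by (rule nn_cond_exp_indep_sum[OF F Y e ind]) measurable
  moreover have "AE \<omega> in M. (\<integral>\<^sup>+x. ennreal (- g (Y \<omega> + x)) \<partial>distr M borel e) = nn_cond_exp M F (\<lambda>\<omega>. ennreal (- g (Y \<omega> + e \<omega>))) \<omega>"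
    by (rule nn_cond_exp_indep_sum[OF F Y e ind]) measurable
  ultimately show ?thesis by eventually_elim (simp add: real_cond_exp_def)
qed

lemma real_cond_exp_indep_normal:
  assumes F: "subalgebra M F" and Y: "Y \<in> borel_measurable F" and e: "e \<in> borel_measurable M"
    and ind: "indep_set (sets F) {e -` D \<inter> space M | D. D \<in> sets borel}"
    and law: "distr M borel e = normal_law 0 v" "0 \<le> v"
    and S: "S \<in> borel_measurable M" "AE \<omega> in M. S \<omega> = Y \<omega> + e \<omega>"
  shows "AE \<omega> in M. real_cond_exp M F S \<omega> = Y \<omega>"
    and "AE \<omega> in M. real_cond_exp M F (\<lambda>\<omega>. (S \<omega>)\<^sup>2) \<omega> = (Y \<omega>)\<^sup>2 + v"
proof -
  interpret N: prob_space "normal_law 0 v" by (rule prob_space_normal_law[OF law(2)])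
  have m: "integrable (normal_law 0 v) (\<lambda>x. x)" "(\<integral>x. x \<partial>normal_law 0 v) = 0"
    "integrable (normal_law 0 v) (\<lambda>x. x\<^sup>2)" "(\<integral>x. x\<^sup>2 \<partial>normal_law 0 v) = v"
    using normal_law_moments(1)[OF law(2), of 0 1] normal_law_moments(1)[OF law(2), of 0 2] normal_law_moments(2,3)[OF law(2), of 0]
    by simp_all
  have int: "enn2real (\<integral>\<^sup>+x. ennreal (h x) \<partial>normal_law 0 v) - enn2real (\<integral>\<^sup>+x. ennreal (- h x) \<partial>normal_law 0 v) = (\<integral>x. h x \<partial>normal_law 0 v)"
    if "integrable (normal_law 0 v) h" for h
    using real_lebesgue_integral_def[OF that] by simp
  have 1: "(\<integral>x. y + x \<partial>normal_law 0 v) = y" "integrable (normal_law 0 v) (\<lambda>x. y + x)" for y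
    using m N.prob_space by (simp_all add: Bochner_Integration.integral_add)
  have sq: "(y + x)\<^sup>2 = y\<^sup>2 + (2 * y * x + x\<^sup>2)" for x y :: real by (simp add: power2_sum)
  have 2: "(\<integral>x. (y + x)\<^sup>2 \<partial>normal_law 0 v) = y\<^sup>2 + v" "integrable (normal_law 0 v) (\<lambda>x. (y + x)\<^sup>2)" for y
    unfolding sq using m N.prob_space by (simp_all add: Bochner_Integration.integral_add)
  have "AE \<omega> in M. real_cond_exp M F (\<lambda>\<omega>. S \<omega>) \<omega> =
     enn2real (\<integral>\<^sup>+x. ennreal (Y \<omega> + x) \<partial>distr M borel e) - enn2real (\<integral>\<^sup>+x. ennreal (- (Y \<omega> + x)) \<partial>distr M borel e)"
    by (rule real_cond_exp_indep_sum[OF F Y e ind _ S]) measurable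
  then show "AE \<omega> in M. real_cond_exp M F S \<omega> = Y \<omega>"
    unfolding law(1) int[OF 1(2)] 1(1) .
  have "AE \<omega> in M. real_cond_exp M F (\<lambda>\<omega>. (S \<omega>)\<^sup>2) \<omega> =
     enn2real (\<integral>\<^sup>+x. ennreal ((Y \<omega> + x)\<^sup>2) \<partial>distr M borel e) - enn2real (\<integral>\<^sup>+x. ennreal (- (Y \<omega> + x)\<^sup>2) \<partial>distr M borel e)"
    by (rule real_cond_exp_indep_sum[OF F Y e ind _ S, of "\<lambda>x. x\<^sup>2"]) measurable
  then show "AE \<omega> in M. real_cond_exp M F (\<lambda>\<omega>. (S \<omega>)\<^sup>2) \<omega> = (Y \<omega>)\<^sup>2 + v"
    unfolding law(1) int[OF 2(2)] 2(1) .
qed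

lemma integrable_mult_of_squares:
  fixes f g :: "'a \<Rightarrow> real"
  assumes [measurable]: "f \<in> borel_measurable M" "g \<in> borel_measurable M"
    and i: "integrable M (\<lambda>\<omega>. (f \<omega>)\<^sup>2)" "integrable M (\<lambda>\<omega>. (g \<omega>)\<^sup>2)"
  shows "integrable M (\<lambda>\<omega>. f \<omega> * g \<omega>)"
proof (rule Bochner_Integration.integrable_bound[of M "\<lambda>\<omega>. (f \<omega>)\<^sup>2 + (g \<omega>)\<^sup>2"])
  show "AE \<omega> in M. norm (f \<omega> * g \<omega>) \<le> norm ((f \<omega>)\<^sup>2 + (g \<omega>)\<^sup>2)"
  proof (rule AE_I2)
    fix \<omega>
    have "2 * (\<bar>f \<omega>\<bar> * \<bar>g \<omega>\<bar>) \<le> (f \<omega>)\<^sup>2 + (g \<omega>)\<^sup>2" using sum_squares_bound[of "\<bar>f \<omega>\<bar>" "\<bar>g \<omega>\<bar>"] by simp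
    moreover have "0 \<le> \<bar>f \<omega>\<bar> * \<bar>g \<omega>\<bar>" by simp
    ultimately have "\<bar>f \<omega>\<bar> * \<bar>g \<omega>\<bar> \<le> (f \<omega>)\<^sup>2 + (g \<omega>)\<^sup>2" by linarith
    then show "norm (f \<omega> * g \<omega>) \<le> norm ((f \<omega>)\<^sup>2 + (g \<omega>)\<^sup>2)" by (simp add: abs_mult)
  qed
qed (use i in auto)

text \<open>\<open>G - P\<close> is measurable with respect to \<open>F\<close>, hence orthogonal to \<open>P - U\<close>. If \<open>G - P\<close> is not square
  integrable, both sides are infinite.\<close>

lemma cond_exp_pythagoras:
  assumes F: "subalgebra M F" and U[measurable]: "U \<in> borel_measurable M" and U2: "integrable M (\<lambda>\<omega>. (U \<omega>)\<^sup>2)"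
    and G: "G \<in> borel_measurable F"
  defines "P \<equiv> real_cond_exp M F U"
  shows "(\<integral>\<^sup>+\<omega>. ennreal ((G \<omega> - U \<omega>)\<^sup>2) \<partial>M) = (\<integral>\<^sup>+\<omega>. ennreal ((G \<omega> - P \<omega>)\<^sup>2) \<partial>M) + (\<integral>\<^sup>+\<omega>. ennreal ((P \<omega> - U \<omega>)\<^sup>2) \<partial>M)"
    and "(\<integral>\<^sup>+\<omega>. ennreal ((P \<omega> - U \<omega>)\<^sup>2) \<partial>M) < top"
proof -
  interpret S: sigma_finite_subalgebra M F by (rule sigma_finite_subalgebraI[OF F])
  have PF: "P \<in> borel_measurable F" unfolding P_def by (rule borel_measurable_cond_exp)
  have PM[measurable]: "P \<in> borel_measurable M" and GM[measurable]: "G \<in> borel_measurable M"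
    using measurable_from_subalg[OF F] PF G by auto
  have U1: "integrable M U"
    using integrable_mult_of_squares[OF U, of "\<lambda>_. 1"] U2 by simp
  have P2: "integrable M (\<lambda>\<omega>. (P \<omega>)\<^sup>2)"
    unfolding P_def
    by (rule S.integrable_convex_cond_exp[OF U1, of UNIV]) (use U2 emeasure_space_1 convex_power2 in auto)
  have PU: "integrable M (\<lambda>\<omega>. (P \<omega> - U \<omega>)\<^sup>2)"
    unfolding power2_diff
    using P2 U2 integrable_mult_of_squares[OF PM U P2 U2] by (simp add: mult.assoc)
  have PUn: "(\<integral>\<^sup>+\<omega>. ennreal ((P \<omega> - U \<omega>)\<^sup>2) \<partial>M) = ennreal (\<integral>\<omega>. (P \<omega> - U \<omega>)\<^sup>2 \<partial>M)"
    using PU by (intro nn_integral_eq_integral) auto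
  then show "(\<integral>\<^sup>+\<omega>. ennreal ((P \<omega> - U \<omega>)\<^sup>2) \<partial>M) < top" by simp
  define D where "D \<omega> = G \<omega> - P \<omega>" for \<omega>
  have DF: "D \<in> borel_measurable F" unfolding D_def[abs_def] using G PF by measurable
  have DM[measurable]: "D \<in> borel_measurable M" by (rule measurable_from_subalg[OF F DF])
  show "(\<integral>\<^sup>+\<omega>. ennreal ((G \<omega> - U \<omega>)\<^sup>2) \<partial>M) = (\<integral>\<^sup>+\<omega>. ennreal ((G \<omega> - P \<omega>)\<^sup>2) \<partial>M) + (\<integral>\<^sup>+\<omega>. ennreal ((P \<omega> - U \<omega>)\<^sup>2) \<partial>M)"
  proof (cases "(\<integral>\<^sup>+\<omega>. ennreal ((D \<omega>)\<^sup>2) \<partial>M) = top")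
    case True
    have "(\<integral>\<^sup>+\<omega>. ennreal ((D \<omega>)\<^sup>2) \<partial>M) \<le> 2 * (\<integral>\<^sup>+\<omega>. ennreal ((G \<omega> - U \<omega>)\<^sup>2) \<partial>M) + 2 * (\<integral>\<^sup>+\<omega>. ennreal ((U \<omega> - P \<omega>)\<^sup>2) \<partial>M)"
      using L2_add_le[of "\<lambda>\<omega>. G \<omega> - U \<omega>" M "\<lambda>\<omega>. U \<omega> - P \<omega>"] by (simp add: D_def)
    then have "(\<integral>\<^sup>+\<omega>. ennreal ((G \<omega> - U \<omega>)\<^sup>2) \<partial>M) = top"
      using True PUn by (auto simp: power2_commute[of "U _"] top_unique ennreal_mult_eq_top_iff)
    then show ?thesis using True by (simp add: D_def)
  next
    case False
    then have D2: "integrable M (\<lambda>\<omega>. (D \<omega>)\<^sup>2)"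
      by (intro integrableI_nonneg) (auto simp: less_top)
    have iDU: "integrable M (\<lambda>\<omega>. D \<omega> * U \<omega>)" by (rule integrable_mult_of_squares[OF DM U D2 U2])
    have iDP: "integrable M (\<lambda>\<omega>. D \<omega> * P \<omega>)" by (rule integrable_mult_of_squares[OF DM PM D2 P2])
    have orth: "(\<integral>\<omega>. D \<omega> * P \<omega> \<partial>M) = (\<integral>\<omega>. D \<omega> * U \<omega> \<partial>M)"
      unfolding P_def by (rule S.real_cond_exp_intg(2)[OF iDU DF U])
    have eq: "(G \<omega> - U \<omega>)\<^sup>2 = (D \<omega>)\<^sup>2 + (P \<omega> - U \<omega>)\<^sup>2 + 2 * (D \<omega> * P \<omega> - D \<omega> * U \<omega>)" for \<omega>
      by (simp add: D_def power2_eq_square algebra_simps)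
    have i: "integrable M (\<lambda>\<omega>. (G \<omega> - U \<omega>)\<^sup>2)" unfolding eq using D2 PU iDU iDP by simp
    have "(\<integral>\<omega>. (G \<omega> - U \<omega>)\<^sup>2 \<partial>M) = (\<integral>\<omega>. (D \<omega>)\<^sup>2 \<partial>M) + (\<integral>\<omega>. (P \<omega> - U \<omega>)\<^sup>2 \<partial>M)"
      unfolding eq using D2 PU iDU iDP orth by simp
    then have "ennreal (\<integral>\<omega>. (G \<omega> - U \<omega>)\<^sup>2 \<partial>M) = ennreal (\<integral>\<omega>. (D \<omega>)\<^sup>2 \<partial>M) + ennreal (\<integral>\<omega>. (P \<omega> - U \<omega>)\<^sup>2 \<partial>M)"
      by simp
    then show ?thesis
      using i D2 PU by (simp add: nn_integral_eq_integral D_def)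
  qed
qed

text \<open>The bound holds for every \<open>S\<close> whatsoever, since a conditional expectation is measurable with respect
  to \<open>F\<close> by construction.\<close>

lemma cond_mse_ge:
  assumes F: "subalgebra M F" and U: "U \<in> borel_measurable M" "integrable M (\<lambda>\<omega>. (U \<omega>)\<^sup>2)"
  shows "cond_mse M F U U \<le> cond_mse M F S U"
    and "cond_mse M F S U \<le> cond_mse M F U U \<Longrightarrow> AE \<omega> in M. real_cond_exp M F S \<omega> = real_cond_exp M F U \<omega>"
proof -
  let ?G = "real_cond_exp M F S" and ?P = "real_cond_exp M F U"
  have G: "?G \<in> borel_measurable F" "?P \<in> borel_measurable F" by (rule borel_measurable_cond_exp)+
  note pyth = cond_exp_pythagoras[OF F U G(1)]
  have eq: "cond_mse M F S U = (\<integral>\<^sup>+\<omega>. ennreal ((?G \<omega> - ?P \<omega>)\<^sup>2) \<partial>M) + cond_mse M F U U"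
    unfolding cond_mse_def power2_abs using pyth(1) .
  then show "cond_mse M F U U \<le> cond_mse M F S U" by simp
  have [measurable]: "?G \<in> borel_measurable M" "?P \<in> borel_measurable M" using G measurable_from_subalg[OF F] by auto
  assume le: "cond_mse M F S U \<le> cond_mse M F U U"
  have fin: "cond_mse M F U U < top" unfolding cond_mse_def power2_abs using pyth(2) .
  have "(\<integral>\<^sup>+\<omega>. ennreal ((?G \<omega> - ?P \<omega>)\<^sup>2) \<partial>M) = 0"
    using le fin ennreal_add_left_cancel_le[of "cond_mse M F U U" "\<integral>\<^sup>+\<omega>. ennreal ((?G \<omega> - ?P \<omega>)\<^sup>2) \<partial>M" 0]
    unfolding eq by (auto simp: add.commute)
  then show "AE \<omega> in M. ?G \<omega> = ?P \<omega>"
    by (subst (asm) nn_integral_0_iff_AE) (auto simp: ennreal_eq_0_iff)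
qed

end

section \<open>Gaussian functionals of the noises\<close>

context covariance_rate begin

definition L2 :: "real \<Rightarrow> (real \<Rightarrow> real^'n) \<Rightarrow> bool" where
  "L2 T f \<longleftrightarrow> f \<in> borel_measurable (lebesgue_on {0..T}) \<and> (\<lambda>t. f t \<bullet> (R t *v f t)) absolutely_integrable_on {0..T}"

definition cov_inner :: "real \<Rightarrow> (real \<Rightarrow> real^'n) \<Rightarrow> (real \<Rightarrow> real^'n) \<Rightarrow> real" where
  "cov_inner T f g = integral {0..T} (\<lambda>t. f t \<bullet> (R t *v g t))"

lemma L2_lincomb: "0 \<le> T \<Longrightarrow> L2 T f \<Longrightarrow> L2 T g \<Longrightarrow> L2 T (\<lambda>t. c *\<^sub>R f t + g t)"
  unfolding L2_def by (auto intro!: form_diff_integrable borel_measurable_add borel_measurable_scaleR)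

lemma L2_zero: "L2 T (\<lambda>_. 0)" by (simp add: L2_def)

lemma cross_integrable:
  assumes T: "0 \<le> T" and f: "L2 T f" and g: "L2 T g"
  shows "(\<lambda>t. f t \<bullet> (R t *v g t)) integrable_on {0..T}"
proof -
  let ?q = "\<lambda>f t. f t \<bullet> (R t *v f t)"
  have "(\<lambda>t. (1/2) *\<^sub>R (?q (\<lambda>t. 1 *\<^sub>R f t + g t) t - ?q f t - ?q g t)) integrable_on {0..T}"
    using L2_lincomb[OF T f g, of 1] f g
    by (intro integrable_cmul integrable_diff) (auto simp: L2_def set_lebesgue_integral_eq_integral(1))
  then show ?thesis
  proof (rule integrable_spike[OF _ negligible_empty])
    fix t assume "t \<in> {0..T} - {}"
    then have "g t \<bullet> (R t *v f t) = f t \<bullet> (R t *v g t)" by (intro posdef_swap R_pos) simp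
    then show "f t \<bullet> (R t *v g t) = (1/2) *\<^sub>R (?q (\<lambda>t. 1 *\<^sub>R f t + g t) t - ?q f t - ?q g t)"
      by (simp add: matrix_vector_right_distrib inner_add_left inner_add_right)
  qed
qed

lemma cov_inner_lincomb:
  assumes T: "0 \<le> T" and "L2 T f" "L2 T g" "L2 T h"
  shows "cov_inner T h (\<lambda>t. c *\<^sub>R f t + g t) = c * cov_inner T h f + cov_inner T h g"
proof -
  have "cov_inner T h (\<lambda>t. c *\<^sub>R f t + g t) = integral {0..T} (\<lambda>t. c *\<^sub>R (h t \<bullet> (R t *v f t)) + h t \<bullet> (R t *v g t))"
    unfolding cov_inner_def by (simp add: matrix_vector_right_distrib matrix_vector_mult_scaleR inner_add_right)
  also have "\<dots> = c * cov_inner T h f + cov_inner T h g"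
    unfolding cov_inner_def
    by (subst Henstock_Kurzweil_Integration.integral_add[OF integrable_cmul]) (auto intro!: cross_integrable assms)
  finally show ?thesis .
qed

lemma cov_inner_swap: "cov_inner T f g = cov_inner T g f"
  unfolding cov_inner_def by (intro integral_cong posdef_swap R_pos) simp

lemma cov_form_lincomb:
  assumes T: "0 \<le> T" and f: "L2 T f" and g: "L2 T g"
  shows "cov_form R T (\<lambda>t. c *\<^sub>R f t + g t) = c\<^sup>2 * cov_form R T f + 2 * c * cov_inner T f g + cov_form R T g"
proof -
  have cf: "cov_form R T f = cov_inner T f f" for f by (simp add: cov_form_def cov_inner_def)
  define h where "h = (\<lambda>t. c *\<^sub>R f t + g t)"
  have h: "L2 T h" unfolding h_def by (rule L2_lincomb[OF assms])
  have "cov_inner T k h = c * cov_inner T k f + cov_inner T k g" if "L2 T k" for k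
    unfolding h_def by (rule cov_inner_lincomb[OF T f g that])
  from this[OF h] this[OF f] this[OF g]
  have "cov_inner T h h = c * (c * cov_inner T f f + cov_inner T f g) + (c * cov_inner T f g + cov_inner T g g)"
    using cov_inner_swap[of T h f] cov_inner_swap[of T h g] cov_inner_swap[of T g f] by simp
  then show ?thesis unfolding cf h_def[symmetric] by (simp add: power2_eq_square algebra_simps)
qed

end

context wiener begin

lemma wiener_integral_simple:
  assumes "simple_pair W T f I" "0 \<le> T"
  shows "has_wiener_integral M W R T f I"
  by (rule wiener_integral_from_AE_limit[of T f "\<lambda>_. f" "\<lambda>_. I"])
     (use assms simple_form_integrable[OF assms] simple_measurable(2)[OF assms(1)] in \<open>auto simp: cov_nn_def\<close>)

end

locale kalman_bucy_model = riccati_flow A C Q R \<Sigma> \<Phi> + prob_space M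
  for A :: "real \<Rightarrow> real^'d^'d" and C :: "real \<Rightarrow> real^'d^'m"
    and Q :: "real \<Rightarrow> real^'d^'d" and R :: "real \<Rightarrow> real^'m^'m"
    and \<Sigma> :: "real \<Rightarrow> real^'d^'d" and \<Phi> :: "real \<Rightarrow> real \<Rightarrow> real^'d^'d"
    and M :: "'a measure" +
  fixes B X :: "real \<Rightarrow> 'a \<Rightarrow> real^'d" and W Z :: "real \<Rightarrow> 'a \<Rightarrow> real^'m"
    and Xbar0 :: "'a \<Rightarrow> real^'d" and m0 :: "real^'d" and T :: real
  assumes B: "wiener_process M B Q" and W: "wiener_process M W R"
    and X0: "gaussian_vector M (X 0) m0 (\<Sigma> 0)"
    and Xbar0: "gaussian_vector M Xbar0 m0 (\<Sigma> 0)"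
    and indep: "indep_sets
      (nth [sets (vimage_algebra (space M) (X 0) borel),
            sets (vimage_algebra (space M) Xbar0 borel),
            sets (generated_algebra M B {0..}),
            sets (generated_algebra M W {0..})]) {..<4}"
    and X_meas: "\<And>t. 0 \<le> t \<Longrightarrow> X t \<in> borel_measurable M"
    and Z_meas: "\<And>t. 0 \<le> t \<Longrightarrow> Z t \<in> borel_measurable M"
    and X_eq: "AE \<omega> in M. continuous_on {0..} (\<lambda>t. X t \<omega>) \<and>
      (\<forall>t\<ge>0. X t \<omega> = X 0 \<omega> + integral {0..t} (\<lambda>s. A s *v X s \<omega>) + B t \<omega>)"
    and Z_eq: "AE \<omega> in M. \<forall>t\<ge>0. Z t \<omega> = integral {0..t} (\<lambda>s. C s *v X s \<omega>) + W t \<omega>"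
    and T_pos: "0 < T"
begin

sublocale NB: wiener M Q B
  by unfold_locales (use Q_pos Q_int B in auto)

sublocale NW: wiener M R W
  by unfold_locales (use R_pos R_int W in auto)

lemma T0: "0 \<le> T" using T_pos by simp

lemma gaussian_char:
  assumes "gaussian_vector M Y m0 (\<Sigma> 0)"
  shows "(CLINT \<omega>|M. iexp (v \<bullet> (Y \<omega> - m0))) = complex_of_real (exp (- (v \<bullet> (\<Sigma> 0 *v v)) / 2))"
proof -
  have [measurable]: "Y \<in> borel_measurable M" using assms by (simp add: gaussian_vector_def)
  have "(CLINT \<omega>|M. iexp (v \<bullet> Y \<omega>)) = iexp (v \<bullet> m0) * complex_of_real (exp (- (v \<bullet> (\<Sigma> 0 *v v)) / 2))"
    using assms posdef_nonneg[OF Sigma0_pos] by (intro char_of_normal) (auto simp: gaussian_vector_def)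
  moreover have "(CLINT \<omega>|M. iexp (v \<bullet> (Y \<omega> - m0))) = (CLINT \<omega>|M. iexp (- (v \<bullet> m0)) * iexp (v \<bullet> Y \<omega>))"
    by (intro Bochner_Integration.integral_cong refl) (simp add: exp_add[symmetric] inner_diff_right right_diff_distrib)
  moreover have "iexp (- (v \<bullet> m0)) * iexp (v \<bullet> m0) = 1" by (simp add: exp_add[symmetric])
  ultimately show ?thesis by (simp add: mult.assoc[symmetric])
qed

definition gauss_var :: "real^'d \<Rightarrow> real^'d \<Rightarrow> (real \<Rightarrow> real^'d) \<Rightarrow> (real \<Rightarrow> real^'m) \<Rightarrow> real" where
  "gauss_var \<gamma> \<alpha> f g = \<gamma> \<bullet> (\<Sigma> 0 *v \<gamma>) + \<alpha> \<bullet> (\<Sigma> 0 *v \<alpha>) + cov_form Q T f + cov_form R T g"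

definition gauss_cov :: "real^'d \<Rightarrow> real^'d \<Rightarrow> (real \<Rightarrow> real^'d) \<Rightarrow> (real \<Rightarrow> real^'m) \<Rightarrow>
    real^'d \<Rightarrow> real^'d \<Rightarrow> (real \<Rightarrow> real^'d) \<Rightarrow> (real \<Rightarrow> real^'m) \<Rightarrow> real" where
  "gauss_cov \<gamma> \<alpha> f g \<gamma>' \<alpha>' f' g' =
    \<gamma> \<bullet> (\<Sigma> 0 *v \<gamma>') + \<alpha> \<bullet> (\<Sigma> 0 *v \<alpha>') + NB.cov_inner T f f' + NW.cov_inner T g g'"

text \<open>\<open>Y\<close> is the sum of the constant \<open>c\<close>, the linear functionals \<open>\<gamma>\<close> and \<open>\<alpha>\<close> of the two centred initial
  conditions, and the Wiener integrals of \<open>f\<close> and \<open>g\<close> against the two noises. The parameters form a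
  Hilbert space with squared norm \<open>gauss_var\<close> and inner product \<open>gauss_cov\<close>, of which the variables
  are an isometric image.\<close>

definition gauss :: "real \<Rightarrow> real^'d \<Rightarrow> real^'d \<Rightarrow> (real \<Rightarrow> real^'d) \<Rightarrow> (real \<Rightarrow> real^'m) \<Rightarrow> ('a \<Rightarrow> real) \<Rightarrow> bool" where
  "gauss c \<gamma> \<alpha> f g Y \<longleftrightarrow> Y \<in> borel_measurable M \<and> NB.L2 T f \<and> NW.L2 T g \<and>
    (\<exists>I J. has_wiener_integral M B Q T f I \<and> has_wiener_integral M W R T g J \<and>
      (AE \<omega> in M. Y \<omega> = c + \<gamma> \<bullet> (Xbar0 \<omega> - m0) + \<alpha> \<bullet> (X 0 \<omega> - m0) + I \<omega> + J \<omega>))"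

lemma gauss_lincomb:
  assumes "gauss c \<gamma> \<alpha> f g Y" "gauss c' \<gamma>' \<alpha>' f' g' Y'"
  shows "gauss (s * c + c') (s *\<^sub>R \<gamma> + \<gamma>') (s *\<^sub>R \<alpha> + \<alpha>') (\<lambda>t. s *\<^sub>R f t + f' t) (\<lambda>t. s *\<^sub>R g t + g' t) (\<lambda>\<omega>. s * Y \<omega> + Y' \<omega>)"
proof -
  obtain I J where 1: "Y \<in> borel_measurable M" "NB.L2 T f" "NW.L2 T g"
    "has_wiener_integral M B Q T f I" "has_wiener_integral M W R T g J"
    "AE \<omega> in M. Y \<omega> = c + \<gamma> \<bullet> (Xbar0 \<omega> - m0) + \<alpha> \<bullet> (X 0 \<omega> - m0) + I \<omega> + J \<omega>"
    using assms(1) unfolding gauss_def by blast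
  obtain I' J' where 2: "Y' \<in> borel_measurable M" "NB.L2 T f'" "NW.L2 T g'"
    "has_wiener_integral M B Q T f' I'" "has_wiener_integral M W R T g' J'"
    "AE \<omega> in M. Y' \<omega> = c' + \<gamma>' \<bullet> (Xbar0 \<omega> - m0) + \<alpha>' \<bullet> (X 0 \<omega> - m0) + I' \<omega> + J' \<omega>"
    using assms(2) unfolding gauss_def by blast
  show ?thesis
    unfolding gauss_def
  proof (intro conjI exI)
    show "(\<lambda>\<omega>. s * Y \<omega> + Y' \<omega>) \<in> borel_measurable M" using 1(1) 2(1) by measurable
    show "NB.L2 T (\<lambda>t. s *\<^sub>R f t + f' t)" "NW.L2 T (\<lambda>t. s *\<^sub>R g t + g' t)"
      by (intro NB.L2_lincomb NW.L2_lincomb 1 2 T0)+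
    show "has_wiener_integral M B Q T (\<lambda>t. s *\<^sub>R f t + f' t) (\<lambda>\<omega>. s * I \<omega> + I' \<omega>)"
      using 1 2 T0 by (intro NB.wiener_integral_lincomb) (auto simp: NB.L2_def)
    show "has_wiener_integral M W R T (\<lambda>t. s *\<^sub>R g t + g' t) (\<lambda>\<omega>. s * J \<omega> + J' \<omega>)"
      using 1 2 T0 by (intro NW.wiener_integral_lincomb) (auto simp: NW.L2_def)
    show "AE \<omega> in M. s * Y \<omega> + Y' \<omega> = (s * c + c') + (s *\<^sub>R \<gamma> + \<gamma>') \<bullet> (Xbar0 \<omega> - m0) + (s *\<^sub>R \<alpha> + \<alpha>') \<bullet> (X 0 \<omega> - m0)
        + (s * I \<omega> + I' \<omega>) + (s * J \<omega> + J' \<omega>)"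
      using 1(6) 2(6) by eventually_elim (simp add: inner_add_left distrib_left)
  qed
qed

lemma gauss_zero: "gauss 0 0 0 (\<lambda>_. 0) (\<lambda>_. 0) (\<lambda>_. 0)"
  unfolding gauss_def
  using NB.wiener_integral_simple[OF simple_pair_zero[OF T0] T0] NW.wiener_integral_simple[OF simple_pair_zero[OF T0] T0]
  by (intro conjI exI[of _ "\<lambda>_. 0"]) (auto simp: NB.L2_zero NW.L2_zero)

text \<open>The four summands are independent, each of them being measurable with respect to one of the four
  independent sigma-algebras.\<close>

lemma simple_char_product:
  assumes f: "simple_pair B T f I" and g: "simple_pair W T g J"
  shows "(CLINT \<omega>|M. iexp (\<gamma> \<bullet> (Xbar0 \<omega> - m0) + \<alpha> \<bullet> (X 0 \<omega> - m0) + (I \<omega> + J \<omega>)))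
     = complex_of_real (exp (- gauss_var \<gamma> \<alpha> f g / 2))"
proof -
  define G where "G i = [vimage_algebra (space M) (X 0) borel, vimage_algebra (space M) Xbar0 borel,
      generated_algebra M B {0..}, generated_algebra M W {0..}] ! i" for i :: nat
  define U where "U i = [\<lambda>\<omega>. \<alpha> \<bullet> (X 0 \<omega> - m0), \<lambda>\<omega>. \<gamma> \<bullet> (Xbar0 \<omega> - m0), I, J] ! i" for i :: nat
  have four: "i \<in> {0, 1, 2, 3}" if "i \<in> {..<4::nat}" for i using that by auto
  have ind: "indep_sets (\<lambda>i. sets (G i)) {..<4}"
  proof (rule indep_sets_mono_sets[OF indep])
    fix i :: nat assume "i \<in> {..<4}"
    from four[OF this] show "sets (G i) \<subseteq> [sets (vimage_algebra (space M) (X 0) borel),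
            sets (vimage_algebra (space M) Xbar0 borel),
            sets (generated_algebra M B {0..}),
            sets (generated_algebra M W {0..})] ! i" by (auto simp: G_def)
  qed
  have sp: "space (G i) = space M" if "i \<in> {..<4}" for i
    using four[OF that] by (auto simp: G_def generated_algebra_simps)
  have Xv: "(\<lambda>\<omega>. v \<bullet> (Y \<omega> - m0)) \<in> borel_measurable (vimage_algebra (space M) Y borel)" for v and Y :: "'a \<Rightarrow> real^'d"
    by (intro borel_measurable_inner borel_measurable_diff borel_measurable_const measurable_vimage_algebra1) auto
  have Um: "U i \<in> borel_measurable (G i)" if "i \<in> {..<4}" for i
    using four[OF that] Xv NB.simple_measurable(1)[OF f] NW.simple_measurable(1)[OF g] by (auto simp: G_def U_def)
  have iv: "indep_vars (\<lambda>_. borel) U {..<4}"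
    by (rule indep_vars_of_indep_sets[OF ind sp Um])
  have iv2: "indep_vars (\<lambda>_. borel) (\<lambda>i \<omega>. iexp (U i \<omega>)) {..<4}"
    by (rule indep_vars_compose2[OF iv]) measurable
  have UM: "U i \<in> borel_measurable M" if "i \<in> {..<4}" for i
    using iv that by (simp add: indep_vars_def)
  have exp4: "(\<Prod>i\<in>{..<4}. h i) = h 0 * h 1 * h 2 * h 3" for h :: "nat \<Rightarrow> complex"
    by (simp add: numeral_eq_Suc lessThan_Suc mult_ac)
  have "(CLINT \<omega>|M. \<Prod>i\<in>{..<4}. iexp (U i \<omega>)) = (\<Prod>i\<in>{..<4}. CLINT \<omega>|M. iexp (U i \<omega>))"
    by (rule indep_vars_lebesgue_integral[OF _ iv2]) (auto intro!: iexp_integrable UM)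
  moreover have "(\<Prod>i\<in>{..<4}. iexp (U i \<omega>)) = iexp (\<gamma> \<bullet> (Xbar0 \<omega> - m0) + \<alpha> \<bullet> (X 0 \<omega> - m0) + (I \<omega> + J \<omega>))" for \<omega>
    unfolding exp4 by (simp add: U_def exp_add[symmetric] distrib_left add_ac)
  moreover have "(\<Prod>i\<in>{..<4}. CLINT \<omega>|M. iexp (U i \<omega>)) = complex_of_real (exp (- gauss_var \<gamma> \<alpha> f g / 2))"
  proof -
    have ex: "exp (- a / 2) * exp (- b / 2) * exp (- c / 2) * exp (- d / 2) = exp (- (b + a + c + d) / 2)" for a b c d :: real
      unfolding exp_add[symmetric] by (rule arg_cong[of _ _ exp]) (simp add: field_simps)
    show ?thesis
      unfolding exp4 gauss_var_def ex[symmetric] of_real_mult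
      using gaussian_char[OF X0, of \<alpha>] gaussian_char[OF Xbar0, of \<gamma>] NB.simple_char[OF f T0] NW.simple_char[OF g T0]
      by (simp add: U_def)
  qed
  ultimately show ?thesis by simp
qed

lemma gauss_char:
  assumes "gauss c \<gamma> \<alpha> f g Y"
  shows "(CLINT \<omega>|M. iexp (Y \<omega>)) = iexp c * complex_of_real (exp (- gauss_var \<gamma> \<alpha> f g / 2))"
proof -
  obtain I J where 1: "Y \<in> borel_measurable M" "NB.L2 T f" "NW.L2 T g"
    "has_wiener_integral M B Q T f I" "has_wiener_integral M W R T g J"
    "AE \<omega> in M. Y \<omega> = c + \<gamma> \<bullet> (Xbar0 \<omega> - m0) + \<alpha> \<bullet> (X 0 \<omega> - m0) + I \<omega> + J \<omega>"
    using assms(1) unfolding gauss_def by blast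
  obtain fk Sk where f: "\<And>k. simple_pair B T (fk k) (Sk k)" "(\<lambda>k. cov_form Q T (fk k)) \<longlonglongrightarrow> cov_form Q T f"
    "(\<lambda>k. \<integral>\<^sup>+\<omega>. ennreal ((Sk k \<omega> - I \<omega>)\<^sup>2) \<partial>M) \<longlonglongrightarrow> 0"
    using NB.wiener_integral_approx[OF T0 _ _ 1(4)] 1(2) unfolding NB.L2_def by blast
  obtain gk Rk where g: "\<And>k. simple_pair W T (gk k) (Rk k)" "(\<lambda>k. cov_form R T (gk k)) \<longlonglongrightarrow> cov_form R T g"
    "(\<lambda>k. \<integral>\<^sup>+\<omega>. ennreal ((Rk k \<omega> - J \<omega>)\<^sup>2) \<partial>M) \<longlonglongrightarrow> 0"
    using NW.wiener_integral_approx[OF T0 _ _ 1(5)] 1(3) unfolding NW.L2_def by blast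
  note [measurable] = NB.simple_measurable(2)[OF f(1)] NW.simple_measurable(2)[OF g(1)]
  have [measurable]: "I \<in> borel_measurable M" "J \<in> borel_measurable M" using 1(4,5) by (auto simp: has_wiener_integral_def)
  have [measurable]: "X 0 \<in> borel_measurable M" "Xbar0 \<in> borel_measurable M" using X0 Xbar0 by (auto simp: gaussian_vector_def)
  let ?U = "\<lambda>\<omega>. \<gamma> \<bullet> (Xbar0 \<omega> - m0) + \<alpha> \<bullet> (X 0 \<omega> - m0)"
  have "(\<lambda>k. \<integral>\<^sup>+\<omega>. ennreal ((Sk k \<omega> + Rk k \<omega> - (I \<omega> + J \<omega>))\<^sup>2) \<partial>M) \<longlonglongrightarrow> 0"
  proof (rule ennreal_tendsto_zero_le[OF ennreal_lincomb_tendsto_zero[OF f(3) g(3), of 2 2]])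
    fix k
    have "(\<integral>\<^sup>+\<omega>. ennreal (((Sk k \<omega> - I \<omega>) + (Rk k \<omega> - J \<omega>))\<^sup>2) \<partial>M) \<le>
      2 * (\<integral>\<^sup>+\<omega>. ennreal ((Sk k \<omega> - I \<omega>)\<^sup>2) \<partial>M) + 2 * (\<integral>\<^sup>+\<omega>. ennreal ((Rk k \<omega> - J \<omega>)\<^sup>2) \<partial>M)"
      by (rule L2_add_le) measurable
    then show "(\<integral>\<^sup>+\<omega>. ennreal ((Sk k \<omega> + Rk k \<omega> - (I \<omega> + J \<omega>))\<^sup>2) \<partial>M) \<le>
      2 * (\<integral>\<^sup>+\<omega>. ennreal ((Sk k \<omega> - I \<omega>)\<^sup>2) \<partial>M) + 2 * (\<integral>\<^sup>+\<omega>. ennreal ((Rk k \<omega> - J \<omega>)\<^sup>2) \<partial>M)"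
      by (simp add: algebra_simps)
  qed auto
  then have "(\<lambda>k. CLINT \<omega>|M. iexp (?U \<omega> + (Sk k \<omega> + Rk k \<omega>))) \<longlonglongrightarrow> (CLINT \<omega>|M. iexp (?U \<omega> + (I \<omega> + J \<omega>)))"
    by (intro iexp_L2_limit) measurable
  moreover have "(\<lambda>k. complex_of_real (exp (- gauss_var \<gamma> \<alpha> (fk k) (gk k) / 2))) \<longlonglongrightarrow> complex_of_real (exp (- gauss_var \<gamma> \<alpha> f g / 2))"
    unfolding gauss_var_def by (intro tendsto_intros f g) simp
  ultimately have lim: "(CLINT \<omega>|M. iexp (?U \<omega> + (I \<omega> + J \<omega>))) = complex_of_real (exp (- gauss_var \<gamma> \<alpha> f g / 2))"
    unfolding simple_char_product[OF f(1) g(1)] by (rule LIMSEQ_unique)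
  have "(CLINT \<omega>|M. iexp (Y \<omega>)) = (CLINT \<omega>|M. iexp c * iexp (?U \<omega> + (I \<omega> + J \<omega>)))"
  proof (rule integral_cong_AE)
    show "(\<lambda>\<omega>. iexp (Y \<omega>)) \<in> borel_measurable M" using 1(1) by measurable
    show "AE \<omega> in M. iexp (Y \<omega>) = iexp c * iexp (?U \<omega> + (I \<omega> + J \<omega>))"
      using 1(6) by eventually_elim (simp add: exp_add[symmetric] distrib_left add_ac)
  qed measurable
  then show ?thesis using lim by simp
qed

lemma gauss_var_lincomb:
  assumes "gauss c \<gamma> \<alpha> f g Y" "gauss c' \<gamma>' \<alpha>' f' g' Y'"
  shows "gauss_var (s *\<^sub>R \<gamma> + \<gamma>') (s *\<^sub>R \<alpha> + \<alpha>') (\<lambda>t. s *\<^sub>R f t + f' t) (\<lambda>t. s *\<^sub>R g t + g' t)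
     = s\<^sup>2 * gauss_var \<gamma> \<alpha> f g + 2 * s * gauss_cov \<gamma> \<alpha> f g \<gamma>' \<alpha>' f' g' + gauss_var \<gamma>' \<alpha>' f' g'"
proof -
  have L: "NB.L2 T f" "NB.L2 T f'" "NW.L2 T g" "NW.L2 T g'" using assms by (auto simp: gauss_def)
  have v: "(s *\<^sub>R v + w) \<bullet> (\<Sigma> 0 *v (s *\<^sub>R v + w)) = s\<^sup>2 * (v \<bullet> (\<Sigma> 0 *v v)) + 2 * s * (v \<bullet> (\<Sigma> 0 *v w)) + w \<bullet> (\<Sigma> 0 *v w)" for v w
    using posdef_swap[OF Sigma0_pos, of w v]
    by (simp add: matrix_vector_right_distrib matrix_vector_mult_scaleR inner_add_left inner_add_right power2_eq_square algebra_simps)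
  show ?thesis
    unfolding gauss_var_def gauss_cov_def v NB.cov_form_lincomb[OF T0 L(1,2)] NW.cov_form_lincomb[OF T0 L(3,4)]
    by (simp add: algebra_simps)
qed

lemma gauss_var_nonneg: "gauss c \<gamma> \<alpha> f g Y \<Longrightarrow> 0 \<le> gauss_var \<gamma> \<alpha> f g"
  unfolding gauss_def gauss_var_def NB.L2_def NW.L2_def
  by (auto intro!: add_nonneg_nonneg posdef_nonneg[OF Sigma0_pos] NB.cov_nn_eq_cov_form(2) NW.cov_nn_eq_cov_form(2))

lemma gauss_cov_zero: "gauss_cov \<gamma> \<alpha> f g 0 0 (\<lambda>_. 0) (\<lambda>_. 0) = 0"
  by (simp add: gauss_cov_def NB.cov_inner_def NW.cov_inner_def)

lemma gauss_var_zero: "gauss_var 0 0 (\<lambda>_. 0) (\<lambda>_. 0) = 0"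
  by (simp add: gauss_var_def cov_form_def)

lemma gauss_law:
  assumes Y: "gauss c \<gamma> \<alpha> f g Y"
  shows "distr M borel Y = normal_law c (gauss_var \<gamma> \<alpha> f g)"
proof (rule normal_from_char)
  show "Y \<in> borel_measurable M" using Y by (simp add: gauss_def)
  show "0 \<le> gauss_var \<gamma> \<alpha> f g" by (rule gauss_var_nonneg[OF Y])
  fix s
  show "(CLINT \<omega>|M. iexp (s * Y \<omega>)) = iexp (s * c) * complex_of_real (exp (- (gauss_var \<gamma> \<alpha> f g * s\<^sup>2) / 2))"
    using gauss_char[OF gauss_lincomb[OF Y gauss_zero, of s]] gauss_var_lincomb[OF Y gauss_zero, of s]
    by (simp add: gauss_cov_zero gauss_var_zero mult.commute)
qed

lemma gauss_cov_lincomb: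
  assumes "gauss c \<gamma> \<alpha> f g Y" "gauss c' \<gamma>' \<alpha>' f' g' Y'" "gauss c'' \<gamma>'' \<alpha>'' f'' g'' Y''"
  shows "gauss_cov \<gamma>'' \<alpha>'' f'' g'' (s *\<^sub>R \<gamma> + \<gamma>') (s *\<^sub>R \<alpha> + \<alpha>') (\<lambda>t. s *\<^sub>R f t + f' t) (\<lambda>t. s *\<^sub>R g t + g' t)
     = s * gauss_cov \<gamma>'' \<alpha>'' f'' g'' \<gamma> \<alpha> f g + gauss_cov \<gamma>'' \<alpha>'' f'' g'' \<gamma>' \<alpha>' f' g'"
proof -
  have L: "NB.L2 T f" "NB.L2 T f'" "NB.L2 T f''" "NW.L2 T g" "NW.L2 T g'" "NW.L2 T g''" using assms by (auto simp: gauss_def)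
  show ?thesis
    unfolding gauss_cov_def NB.cov_inner_lincomb[OF T0 L(1-3)] NW.cov_inner_lincomb[OF T0 L(4-6)]
    by (simp add: matrix_vector_right_distrib matrix_vector_mult_scaleR inner_add_right algebra_simps)
qed

text \<open>Orthogonality to \<open>e\<close> is a linear condition, so it passes from the coordinates of the observations to
  the linear space \<open>V\<close> which contains them, and there it makes characteristic functions factorise.\<close>

lemma gauss_orthogonal_indep:
  assumes e: "gauss 0 \<gamma> \<alpha> f g e"
    and Z: "\<And>t w. 0 \<le> t \<Longrightarrow> t \<le> T \<Longrightarrow> \<exists>c \<gamma>' \<alpha>' f' g'. gauss c \<gamma>' \<alpha>' f' g' (\<lambda>\<omega>. w \<bullet> Z t \<omega>) \<and> gauss_cov \<gamma> \<alpha> f g \<gamma>' \<alpha>' f' g' = 0"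
  shows "indep_set (sets (generated_algebra M Z {0..T})) {e -` D \<inter> space M | D. D \<in> sets borel}"
proof -
  define V where "V = {Y. \<exists>c \<gamma>' \<alpha>' f' g'. gauss c \<gamma>' \<alpha>' f' g' Y \<and> gauss_cov \<gamma> \<alpha> f g \<gamma>' \<alpha>' f' g' = 0}"
  have Vm: "Y \<in> borel_measurable M" if "Y \<in> V" for Y using that by (auto simp: V_def gauss_def)
  have em: "e \<in> borel_measurable M" using e by (simp add: gauss_def)
  have ind: "indep_set (sigma_sets (space M) (cylinders V)) {e -` D \<inter> space M | D. D \<in> sets borel}"
  proof (rule indep_of_char_product[OF em Vm])
    show "(\<lambda>_. 0) \<in> V" unfolding V_def using gauss_zero gauss_cov_zero by blast
    fix Y s
    assume "Y \<in> V"
    then obtain c \<gamma>' \<alpha>' f' g' where Y: "gauss c \<gamma>' \<alpha>' f' g' Y" "gauss_cov \<gamma> \<alpha> f g \<gamma>' \<alpha>' f' g' = 0" by (auto simp: V_def)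
    show "(\<lambda>\<omega>. s * Y \<omega> + Y' \<omega>) \<in> V" if Y'V: "Y' \<in> V" for Y'
    proof -
      obtain c2 \<gamma>2 \<alpha>2 f2 g2 where Y': "gauss c2 \<gamma>2 \<alpha>2 f2 g2 Y'" "gauss_cov \<gamma> \<alpha> f g \<gamma>2 \<alpha>2 f2 g2 = 0"
        using Y'V by (auto simp: V_def)
      show ?thesis unfolding V_def mem_Collect_eq
      proof (intro exI conjI)
        show "gauss (s * c + c2) (s *\<^sub>R \<gamma>' + \<gamma>2) (s *\<^sub>R \<alpha>' + \<alpha>2) (\<lambda>t. s *\<^sub>R f' t + f2 t) (\<lambda>t. s *\<^sub>R g' t + g2 t) (\<lambda>\<omega>. s * Y \<omega> + Y' \<omega>)"
          by (rule gauss_lincomb[OF Y(1) Y'(1)])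
        show "gauss_cov \<gamma> \<alpha> f g (s *\<^sub>R \<gamma>' + \<gamma>2) (s *\<^sub>R \<alpha>' + \<alpha>2) (\<lambda>t. s *\<^sub>R f' t + f2 t) (\<lambda>t. s *\<^sub>R g' t + g2 t) = 0"
          using gauss_cov_lincomb[OF Y(1) Y'(1) e, of s] Y(2) Y'(2) by simp
      qed
    qed
    have ex: "exp (- (a + b) / 2) = exp (- a / 2) * exp (- b / 2)" for a b :: real
      unfolding exp_add[symmetric] by (rule arg_cong[of _ _ exp]) (simp add: field_simps)
    have "(CLINT \<omega>|M. iexp (s * e \<omega> + Y \<omega>)) = iexp c * complex_of_real (exp (- (s\<^sup>2 * gauss_var \<gamma> \<alpha> f g + gauss_var \<gamma>' \<alpha>' f' g') / 2))"
      using gauss_char[OF gauss_lincomb[OF e Y(1), of s]] gauss_var_lincomb[OF e Y(1), of s] Y(2) by simp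
    moreover have "(CLINT \<omega>|M. iexp (s * e \<omega>)) = complex_of_real (exp (- (s\<^sup>2 * gauss_var \<gamma> \<alpha> f g) / 2))"
      using gauss_char[OF gauss_lincomb[OF e gauss_zero, of s]] gauss_var_lincomb[OF e gauss_zero, of s]
      by (simp add: gauss_cov_zero gauss_var_zero)
    ultimately show "(CLINT \<omega>|M. iexp (s * e \<omega> + Y \<omega>)) = (CLINT \<omega>|M. iexp (s * e \<omega>)) * (CLINT \<omega>|M. iexp (Y \<omega>))"
      unfolding gauss_char[OF Y(1)] ex by simp
  qed
  define N where "N = sigma (space M) (cylinders V)"
  \<comment> \<open>the observations are measurable with respect to the sigma-algebra of cylinders, coordinate by coordinate\<close>
  have cyl: "cylinders V \<subseteq> Pow (space M)" by (auto simp: cylinders_def)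
  have N: "space N = space M" "sets N = sigma_sets (space M) (cylinders V)"
    unfolding N_def using cyl by (auto intro: space_measure_of sets_measure_of)
  have Zm: "Z t \<in> borel_measurable N" if t: "t \<in> {0..T}" for t
  proof (subst borel_measurable_euclidean_space, intro ballI)
    fix b :: "real^'m"
    have "(\<lambda>\<omega>. b \<bullet> Z t \<omega>) \<in> V" using Z[of t b] t by (auto simp: V_def)
    then have "(\<lambda>\<omega>. b \<bullet> Z t \<omega>) -` D \<inter> space M \<in> cylinders V" if "D \<in> sets borel" for D
      using that by (rule cylinder_single)
    then have "(\<lambda>\<omega>. b \<bullet> Z t \<omega>) \<in> borel_measurable N"
      by (intro measurableI) (auto simp: N)
    then show "(\<lambda>\<omega>. Z t \<omega> \<bullet> b) \<in> borel_measurable N" by (simp add: inner_commute)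
  qed
  have "sets (generated_algebra M Z {0..T}) \<subseteq> sets N"
    unfolding generated_algebra_simps N(1)[symmetric]
    by (rule sets.sigma_sets_subset) (use measurable_sets[OF Zm] in auto)
  then show ?thesis
    using ind unfolding indep_set_def N(2)
    by (elim indep_sets_mono_sets) (auto split: bool.splits)
qed

end

section \<open>Duality and integration against the observations\<close>

context riccati_flow begin

text \<open>\<open>\<Sigma> p\<close> is the covariance of the state with the error; it moves with the uncontrolled dynamics, driven
  by \<open>Q\<close>.\<close>

lemma Sigma_sol_derivative:
  assumes "sol p" "0 \<le> t"
  shows "((\<lambda>s. \<Sigma> s *v p s) has_vector_derivative A t *v (\<Sigma> t *v p t) + Q t *v p t) (at t within {0..})"
proof -
  let ?D = "A t ** \<Sigma> t + \<Sigma> t ** transpose (A t) + Q t - \<Sigma> t ** transpose (C t) ** matrix_inv (R t) ** C t ** \<Sigma> t"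
  have "((\<lambda>s. \<Sigma> s *v p s) has_vector_derivative \<Sigma> t *v (F t *v p t) + ?D *v p t) (at t within {0..})"
    using assms by (intro bounded_bilinear.has_vector_derivative[OF bounded_bilinear_matrix_vector] Sigma_derivative) (auto simp: sol_def)
  moreover have neg: "\<Sigma> t *v (- x) = - (\<Sigma> t *v x)" for x
    using matrix_vector_mult_diff_distrib[of "\<Sigma> t" 0 x] by simp
  have "\<Sigma> t *v (F t *v p t) + ?D *v p t = A t *v (\<Sigma> t *v p t) + Q t *v p t"
    by (simp add: F_vector Kt_vector assms neg matrix_vector_right_distrib matrix_vector_mult_add_rdistrib
        matrix_vector_mult_diff_rdistrib matrix_vector_mult_diff_distrib matrix_vector_mul_assoc[symmetric]
        del: transpose_matrix_vector)
  ultimately show ?thesis by simp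
qed

text \<open>\<open>x - b\<close> is continuously differentiable with derivative \<open>A x\<close>, so the fundamental theorem of calculus
  applies to \<open>p \<bullet> (x - b)\<close> for each path. The bracket on the right is \<open>\<integral> p \<bullet> db\<close>, integrated by parts.\<close>

lemma path_duality:
  fixes x b p k :: "real \<Rightarrow> real^'d"
  assumes t: "0 \<le> t" and x: "continuous_on {0..} x" and b: "continuous_on {0..} b"
    and eq: "\<And>s. 0 \<le> s \<Longrightarrow> x s = x 0 + integral {0..s} (\<lambda>r. A r *v x r) + b s"
    and p: "\<And>s. s \<in> {0..t} \<Longrightarrow> (p has_vector_derivative - (transpose (A s) *v p s) + k s) (at s within {0..t})"
    and k: "k absolutely_integrable_on {0..t}"
  shows "p t \<bullet> x t = p 0 \<bullet> x 0 + integral {0..t} (\<lambda>s. x s \<bullet> k s)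
     + (p t \<bullet> b t - integral {0..t} (\<lambda>s. (- (transpose (A s) *v p s) + k s) \<bullet> b s))"
proof -
  define p' where "p' s = - (transpose (A s) *v p s) + k s" for s
  have pc: "continuous_on {0..t} p"
    by (metis p has_vector_derivative_continuous continuous_on_eq_continuous_within)
  have trc: "continuous_on {0..t} (\<lambda>s. transpose (A s))"
    unfolding transpose_def by (intro continuous_intros continuous_onT A_cont)
  have "(\<lambda>s. - (transpose (A s) *v p s)) absolutely_integrable_on {0..t}"
    by (intro absolutely_integrable_continuous_real continuous_on_minus bounded_bilinear.continuous_on[OF bounded_bilinear_matrix_vector] trc pc)
  then have p'i: "p' absolutely_integrable_on {0..t}"
    unfolding p'_def using k by (rule set_integral_add(1))
  have Ax: "continuous_on {0..t} (\<lambda>r. A r *v x r)"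
    by (intro bounded_bilinear.continuous_on[OF bounded_bilinear_matrix_vector] continuous_onT A_cont x)
  \<comment> \<open>the differentiable part \<open>x - b\<close> of the path\<close>
  define v where "v s = x 0 + integral {0..s} (\<lambda>r. A r *v x r)" for s
  have xv: "x s - b s = v s" if "0 \<le> s" for s using eq[OF that] by (simp add: v_def)
  have v': "(v has_vector_derivative A s *v x s) (at s within {0..t})" if "s \<in> {0..t}" for s
    unfolding v_def
    using has_vector_derivative_add[OF has_vector_derivative_const integral_has_vector_derivative[OF Ax that]] by simp
  have "((\<lambda>s. p s \<bullet> v s) has_vector_derivative x s \<bullet> k s - p' s \<bullet> b s) (at s within {0..t})" if s: "s \<in> {0..t}" for s
  proof -
    have "((\<lambda>s. p s \<bullet> v s) has_vector_derivative p s \<bullet> (A s *v x s) + p' s \<bullet> v s) (at s within {0..t})"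
      unfolding p'_def by (intro bounded_bilinear.has_vector_derivative[OF bounded_bilinear_inner] p v' s)
    moreover have "p s \<bullet> (A s *v x s) + p' s \<bullet> v s = x s \<bullet> k s - p' s \<bullet> b s"
      using s by (simp add: xv[symmetric] p'_def inner_add_left inner_diff_left inner_diff_right inner_matrix_vector inner_commute[of "x s"]
          del: transpose_matrix_vector)
    ultimately show ?thesis by simp
  qed
  then have int: "((\<lambda>s. x s \<bullet> k s - p' s \<bullet> b s) has_integral (p t \<bullet> v t - p 0 \<bullet> v 0)) {0..t}"
    by (rule fundamental_theorem_of_calculus[OF t])
  have i1: "(\<lambda>s. x s \<bullet> k s) integrable_on {0..t}"
    using abs_integrable_inner[OF k continuous_onT[OF x]] by (simp add: set_lebesgue_integral_eq_integral(1))
  have i2: "(\<lambda>s. p' s \<bullet> b s) integrable_on {0..t}"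
    using abs_integrable_inner[OF p'i continuous_onT[OF b]] by (simp add: set_lebesgue_integral_eq_integral(1) inner_commute)
  have "integral {0..t} (\<lambda>s. x s \<bullet> k s) - integral {0..t} (\<lambda>s. p' s \<bullet> b s) = p t \<bullet> v t - p 0 \<bullet> v 0"
    using integral_unique[OF int] Henstock_Kurzweil_Integration.integral_diff[OF i1 i2] by simp
  moreover have "v 0 = x 0" by (simp add: v_def)
  moreover have "p t \<bullet> v t = p t \<bullet> x t - p t \<bullet> b t" using xv[OF t] by (metis inner_diff_right)
  ultimately show ?thesis by (simp add: p'_def)
qed

end

context kalman_bucy_model begin

abbreviation ZZ :: "'a measure" where "ZZ \<equiv> generated_algebra M Z {0..T}"

lemma subalgebra_ZZ: "subalgebra M ZZ"
  unfolding subalgebra_def generated_algebra_simps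
proof (intro conjI refl sets.sigma_sets_subset subsetI)
  fix a assume "a \<in> {Z t -` A \<inter> space M |t A. t \<in> {0..T} \<and> A \<in> sets borel}"
  then show "a \<in> sets M" using measurable_sets[OF Z_meas] by auto
qed

lemma paths: "AE \<omega> in M. (continuous_on {0..} (\<lambda>t. X t \<omega>) \<and>
      (\<forall>t\<ge>0. X t \<omega> = X 0 \<omega> + integral {0..t} (\<lambda>s. A s *v X s \<omega>) + B t \<omega>)) \<and>
      continuous_on {0..} (\<lambda>t. B t \<omega>) \<and> W 0 \<omega> = 0 \<and> 
      (\<forall>t\<ge>0. Z t \<omega> = integral {0..t} (\<lambda>s. C s *v X s \<omega>) + W t \<omega>)"
proof -
  have "AE \<omega> in M. B 0 \<omega> = 0 \<and> continuous_on {0..} (\<lambda>t. B t \<omega>)" "AE \<omega> in M. W 0 \<omega> = 0 \<and> continuous_on {0..} (\<lambda>t. W t \<omega>)"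
    using B W by (auto simp: wiener_process_def)
  then show ?thesis using X_eq Z_eq by eventually_elim blast
qed

lemma CX_continuous: "continuous_on {0..} (\<lambda>t. X t \<omega>) \<Longrightarrow> continuous_on {0..T} (\<lambda>t. C t *v X t \<omega>)"
  by (intro bounded_bilinear.continuous_on[OF bounded_bilinear_matrix_vector] continuous_onT C_cont)

lemma drift_inner:
  "v \<bullet> (C t *v x) = (transpose (C t) *v v) \<bullet> x"
  by (rule inner_matrix_vector)

lemma drift_abs_integrable:
  assumes "admissible C R T v" "continuous_on {0..} (\<lambda>t. X t \<omega>)"
  shows "(\<lambda>t. v t \<bullet> (C t *v X t \<omega>)) absolutely_integrable_on {0..T}"
  unfolding drift_inner inner_commute[of _ "X _ \<omega>"]
  by (rule abs_integrable_inner[OF _ continuous_onT[OF assms(2)]])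
     (use assms(1) in \<open>simp add: admissible_def del: transpose_matrix_vector\<close>)

lemma admissible_cost:
  assumes "admissible C R T v"
  shows "NW.cost C T v < top" and "v \<in> borel_measurable (lebesgue_on {0..T})" and "NW.L2 T v"
proof -
  show m: "v \<in> borel_measurable (lebesgue_on {0..T})" and "NW.L2 T v" using assms by (auto simp: admissible_def NW.L2_def)
  have "integrable (lebesgue_on {0..T}) (\<lambda>t. v t \<bullet> (R t *v v t))" "integrable (lebesgue_on {0..T}) (\<lambda>t. transpose (C t) *v v t)"
    using assms by (auto simp: admissible_def integrable_restrict_space set_integrable_def)
  then have i: "integrable (lebesgue_on {0..T}) (\<lambda>t. v t \<bullet> (R t *v v t) + norm (transpose (C t) *v v t))"
    by (intro Bochner_Integration.integrable_add integrable_norm)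
  have "NW.cost C T v = ennreal (\<integral>t. v t \<bullet> (R t *v v t) + norm (transpose (C t) *v v t) \<partial>lebesgue_on {0..T})"
    unfolding NW.cost_def
    by (rule nn_integral_eq_integral[OF i], rule AE_I2, rule add_nonneg_nonneg[OF NW.form_nonneg norm_ge_zero])
  then show "NW.cost C T v < top" by simp
qed

text \<open>Along one sequence of step functions, the elementary integrals against \<open>W\<close> converge almost surely and
  the drift parts converge in the mean, path by path. Hence the elementary integrals against \<open>Z\<close>
  converge, and their limit is a function of the observations.\<close>

lemma ito_observable_version:
  assumes v: "admissible C R T v"
  obtains I J where "I \<in> borel_measurable ZZ" "has_wiener_integral M W R T v J"
    "AE \<omega> in M. I \<omega> = integral {0..T} (\<lambda>t. v t \<bullet> (C t *v X t \<omega>)) + J \<omega>"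
proof -
  note vc = admissible_cost[OF v]
  obtain n \<tau> x J where p: "\<And>k. partition_of T (n k) (\<tau> k)"
    and c: "(\<lambda>k. NW.cost C T (\<lambda>t. step_function (n k) (\<tau> k) (x k) t - v t)) \<longlonglongrightarrow> 0"
    and J: "has_wiener_integral M W R T v J"
    and lim: "AE \<omega> in M. (\<lambda>k. step_integral W (n k) (\<tau> k) (x k) \<omega>) \<longlonglongrightarrow> J \<omega>"
    by (rule NW.wiener_integral_exists[OF T0 continuous_onT[OF C_cont] vc(2,1)], rule that) blast+
  define s where "s k = step_function (n k) (\<tau> k) (x k)" for k
  define S where "S k = step_integral Z (n k) (\<tau> k) (x k)" for k
  have Sm[measurable]: "S k \<in> borel_measurable ZZ" for k
    unfolding S_def step_integral_def[abs_def]
    by (intro borel_measurable_sum borel_measurable_inner borel_measurable_const borel_measurable_diff generated_algebra_measurable)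
       (use partition_range[OF p] in auto)
  have "(\<lambda>k. \<integral>\<^sup>+t. ennreal (norm (transpose (C t) *v (s k t - v t))) \<partial>lebesgue_on {0..T}) \<longlonglongrightarrow> 0"
    unfolding s_def by (rule ennreal_tendsto_zero_le[OF c NW.drift_le_cost])
  moreover have di: "(\<lambda>t. transpose (C t) *v (s k t - v t)) absolutely_integrable_on {0..T}" for k
  proof -
    have "continuous_on {0..T} (\<lambda>t. transpose (C t))" by (intro NW.transpose_continuous continuous_onT C_cont)
    then have "(\<lambda>t. transpose (C t)) absolutely_integrable_on {0..T}" by (rule absolutely_integrable_continuous_real)
    moreover have "bilinear (\<lambda>x (S::real^'m^'d). S *v x)"
      using bounded_bilinear.flip[OF bounded_bilinear_matrix_vector] bilinear_conv_bounded_bilinear by blast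
    moreover have "bounded (s k ` {0..T})"
    proof -
      have "norm (s k t) \<le> (\<Sum>i<n k. norm (x k i))" for t
        unfolding s_def step_function_def by (rule sum_norm_le) (auto split: split_indicator)
      then show ?thesis by (auto simp: bounded_iff)
    qed
    ultimately have "(\<lambda>t. transpose (C t) *v s k t) absolutely_integrable_on {0..T}"
      by (intro absolutely_integrable_bounded_measurable_product[where h = "\<lambda>x S. S *v x"])
         (auto simp: s_def step_function_lebesgue)
    from set_integral_diff(1)[OF this] show ?thesis
      using v unfolding admissible_def matrix_vector_mult_diff_distrib by blast
  qed
  have nn: "(\<integral>\<^sup>+t. ennreal (norm (transpose (C t) *v (s k t - v t))) \<partial>lebesgue_on {0..T}) =
      ennreal (integral {0..T} (\<lambda>t. norm (transpose (C t) *v (s k t - v t))))" for k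
  proof -
    have i: "integrable (lebesgue_on {0..T}) (\<lambda>t. norm (transpose (C t) *v (s k t - v t)))"
      using di[of k] by (intro integrable_norm) (simp add: integrable_restrict_space set_integrable_def)
    show ?thesis using nn_integral_eq_integral[OF i] lebesgue_integral_eq_integral[OF i] by simp
  qed
  ultimately have "(\<lambda>k. ennreal (integral {0..T} (\<lambda>t. norm (transpose (C t) *v (s k t - v t))))) \<longlonglongrightarrow> ennreal 0"
    by simp
  then have L1: "(\<lambda>k. integral {0..T} (\<lambda>t. norm (transpose (C t) *v (s k t - v t)))) \<longlonglongrightarrow> 0"
  proof (subst (asm) tendsto_ennreal_iff)
    show "\<forall>\<^sub>F k in sequentially. 0 \<le> integral {0..T} (\<lambda>t. norm (transpose (C t) *v (s k t - v t)))"
      by (intro always_eventually allI integral_nonneg conjunct2[OF absolutely_integrable_on_def[THEN iffD1, OF di]]) auto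
  qed auto
  have conv: "(\<lambda>k. S k \<omega>) \<longlonglongrightarrow> integral {0..T} (\<lambda>t. v t \<bullet> (C t *v X t \<omega>)) + J \<omega>"
    if l: "(\<lambda>k. step_integral W (n k) (\<tau> k) (x k) \<omega>) \<longlonglongrightarrow> J \<omega>" and Xc: "continuous_on {0..} (\<lambda>t. X t \<omega>)"
      and Ze: "\<forall>t\<ge>0. Z t \<omega> = integral {0..t} (\<lambda>s. C s *v X s \<omega>) + W t \<omega>" for \<omega>
  proof -
    let ?g = "\<lambda>t. C t *v X t \<omega>"
    have gi: "?g integrable_on {0..T}" by (rule integrable_continuous_interval[OF CX_continuous[OF Xc]])
    have Seq: "S k \<omega> = integral {0..T} (\<lambda>t. ?g t \<bullet> s k t) + step_integral W (n k) (\<tau> k) (x k) \<omega>" for k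
    proof -
      have piece: "Z (\<tau> k (Suc i)) \<omega> - Z (\<tau> k i) \<omega> = integral {\<tau> k i..\<tau> k (Suc i)} ?g + (W (\<tau> k (Suc i)) \<omega> - W (\<tau> k i) \<omega>)"
        if "i < n k" for i
      proof -
        have r: "0 \<le> \<tau> k i" "\<tau> k i \<le> \<tau> k (Suc i)" "\<tau> k (Suc i) \<le> T"
          using partition_range[OF p] partition_mono[OF p, of i "Suc i"] that by auto
        have "integral {0..\<tau> k i} ?g + integral {\<tau> k i..\<tau> k (Suc i)} ?g = integral {0..\<tau> k (Suc i)} ?g"
          by (rule Henstock_Kurzweil_Integration.integral_combine[OF r(1,2) integrable_subinterval_real[OF gi]]) (use r in auto)
        then show ?thesis using Ze r by (simp add: algebra_simps)
      qed
      have "S k \<omega> = (\<Sum>i<n k. integral {\<tau> k i..\<tau> k (Suc i)} ?g \<bullet> x k i) + step_integral W (n k) (\<tau> k) (x k) \<omega>"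
        unfolding S_def step_integral_def sum.distrib[symmetric]
        by (rule sum.cong[OF refl]) (subst piece, auto simp: inner_add_right inner_commute)
      then show ?thesis
        unfolding s_def integral_unique[OF step_function_inner_integral[OF p gi]] .
    qed
    have "bounded ((\<lambda>t. X t \<omega>) ` {0..T})" by (intro compact_imp_bounded compact_continuous_image continuous_onT Xc) auto
    then obtain K where "\<forall>y\<in>(\<lambda>t. X t \<omega>) ` {0..T}. norm y \<le> K" unfolding bounded_iff by blast
    then have K: "\<And>t. t \<in> {0..T} \<Longrightarrow> norm (X t \<omega>) \<le> K" by auto
    have vi: "(\<lambda>t. v t \<bullet> ?g t) integrable_on {0..T}"
      using drift_abs_integrable[OF v Xc] by (simp add: set_lebesgue_integral_eq_integral(1))
    have si: "(\<lambda>t. ?g t \<bullet> s k t) integrable_on {0..T}" for k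
      unfolding s_def using step_function_inner_integral[OF p gi] by (rule has_integral_integrable)
    have "(\<lambda>k. integral {0..T} (\<lambda>t. ?g t \<bullet> s k t) - integral {0..T} (\<lambda>t. v t \<bullet> ?g t)) \<longlonglongrightarrow> 0"
    proof (rule Lim_null_comparison)
      show "(\<lambda>k. K * integral {0..T} (\<lambda>t. norm (transpose (C t) *v (s k t - v t)))) \<longlonglongrightarrow> 0"
        using tendsto_mult_right_zero[OF L1] by simp
      show "\<forall>\<^sub>F k in sequentially. norm (integral {0..T} (\<lambda>t. ?g t \<bullet> s k t) - integral {0..T} (\<lambda>t. v t \<bullet> ?g t))
         \<le> K * integral {0..T} (\<lambda>t. norm (transpose (C t) *v (s k t - v t)))"
      proof (rule always_eventually, rule allI)
        fix k
        have "integral {0..T} (\<lambda>t. ?g t \<bullet> s k t) - integral {0..T} (\<lambda>t. v t \<bullet> ?g t) = integral {0..T} (\<lambda>t. ?g t \<bullet> s k t - v t \<bullet> ?g t)"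
          by (rule Henstock_Kurzweil_Integration.integral_diff[symmetric, OF si vi])
        also have "norm \<dots> \<le> integral {0..T} (\<lambda>t. K *\<^sub>R norm (transpose (C t) *v (s k t - v t)))"
        proof (rule integral_norm_bound_integral)
          show "(\<lambda>t. ?g t \<bullet> s k t - v t \<bullet> ?g t) integrable_on {0..T}" by (rule integrable_diff[OF si vi])
          show "(\<lambda>t. K *\<^sub>R norm (transpose (C t) *v (s k t - v t))) integrable_on {0..T}"
            using di[of k] by (intro integrable_cmul) (simp add: absolutely_integrable_on_def)
          fix t assume t: "t \<in> {0..T}"
          have "?g t \<bullet> s k t - v t \<bullet> ?g t = (s k t - v t) \<bullet> ?g t"
            unfolding inner_diff_left by (simp add: inner_commute[of "s k t"])
          also have "\<dots> = (transpose (C t) *v (s k t - v t)) \<bullet> X t \<omega>" by (rule drift_inner)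
          finally have "norm (?g t \<bullet> s k t - v t \<bullet> ?g t) \<le> norm (transpose (C t) *v (s k t - v t)) * norm (X t \<omega>)"
            using Cauchy_Schwarz_ineq2[of "transpose (C t) *v (s k t - v t)" "X t \<omega>"] by simp
          also have "\<dots> \<le> norm (transpose (C t) *v (s k t - v t)) * K" by (intro mult_left_mono K t) auto
          finally show "norm (?g t \<bullet> s k t - v t \<bullet> ?g t) \<le> K *\<^sub>R norm (transpose (C t) *v (s k t - v t))"
            by (simp add: mult.commute)
        qed
        also have "\<dots> = K * integral {0..T} (\<lambda>t. norm (transpose (C t) *v (s k t - v t)))" by simp
        finally show "norm (integral {0..T} (\<lambda>t. ?g t \<bullet> s k t) - integral {0..T} (\<lambda>t. v t \<bullet> ?g t))
         \<le> K * integral {0..T} (\<lambda>t. norm (transpose (C t) *v (s k t - v t)))" .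
      qed
    qed
    then have "(\<lambda>k. integral {0..T} (\<lambda>t. ?g t \<bullet> s k t)) \<longlonglongrightarrow> integral {0..T} (\<lambda>t. v t \<bullet> ?g t)"
      by (simp add: LIM_zero_iff)
    from tendsto_add[OF this l] show ?thesis unfolding Seq .
  qed
  define I where "I \<omega> = lim (\<lambda>k. S k \<omega>)" for \<omega>
  have "I \<in> borel_measurable ZZ" unfolding I_def by (rule borel_measurable_lim_metric) measurable
  moreover have "AE \<omega> in M. I \<omega> = integral {0..T} (\<lambda>t. v t \<bullet> (C t *v X t \<omega>)) + J \<omega>"
    using lim paths
  proof eventually_elim
    case (elim \<omega>)
    then show ?case unfolding I_def by (intro limI conv) blast+
  qed
  ultimately show ?thesis using J that by blast
qed

lemma ito_integral_AE:
  assumes v: "admissible C R T v" and J: "has_wiener_integral M W R T v J"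
  shows "ito_integral M (\<lambda>t \<omega>. C t *v X t \<omega>) W R T v \<in> borel_measurable M"
    and "AE \<omega> in M. ito_integral M (\<lambda>t \<omega>. C t *v X t \<omega>) W R T v \<omega> = integral {0..T} (\<lambda>t. v t \<bullet> (C t *v X t \<omega>)) + J \<omega>"
    and "\<exists>I\<in>borel_measurable ZZ. AE \<omega> in M. ito_integral M (\<lambda>t \<omega>. C t *v X t \<omega>) W R T v \<omega> = I \<omega>"
proof -
  let ?ito = "ito_integral M (\<lambda>t \<omega>. C t *v X t \<omega>) W R T v"
  obtain I J' where I: "I \<in> borel_measurable ZZ" "has_wiener_integral M W R T v J'"
    "AE \<omega> in M. I \<omega> = integral {0..T} (\<lambda>t. v t \<bullet> (C t *v X t \<omega>)) + J' \<omega>"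
    by (rule ito_observable_version[OF v])
  have "has_ito_integral M (\<lambda>t \<omega>. C t *v X t \<omega>) W R T v I"
    unfolding has_ito_integral_def
  proof (intro conjI exI[of _ J'] I(2))
    show "I \<in> borel_measurable M" by (rule measurable_from_subalg[OF subalgebra_ZZ I(1)])
    show "AE \<omega> in M. (\<lambda>t. v t \<bullet> (C t *v X t \<omega>)) absolutely_integrable_on {0..T} \<and>
        I \<omega> = integral {0..T} (\<lambda>t. v t \<bullet> (C t *v X t \<omega>)) + J' \<omega>"
      using I(3) paths by eventually_elim (use drift_abs_integrable[OF v] in blast)
  qed
  then have "has_ito_integral M (\<lambda>t \<omega>. C t *v X t \<omega>) W R T v ?ito"
    unfolding ito_integral_def by (rule someI[where P = "has_ito_integral M (\<lambda>t \<omega>. C t *v X t \<omega>) W R T v"])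
  then obtain J2 where J2: "?ito \<in> borel_measurable M" "has_wiener_integral M W R T v J2"
    "AE \<omega> in M. ?ito \<omega> = integral {0..T} (\<lambda>t. v t \<bullet> (C t *v X t \<omega>)) + J2 \<omega>"
    unfolding has_ito_integral_def by (auto elim: eventually_mono)
  note uniq = NW.wiener_integral_unique[OF T0 admissible_cost(2)[OF v]]
  show "?ito \<in> borel_measurable M" by (rule J2(1))
  show "AE \<omega> in M. ?ito \<omega> = integral {0..T} (\<lambda>t. v t \<bullet> (C t *v X t \<omega>)) + J \<omega>"
    using J2(3) uniq[OF J2(2) J] by eventually_elim simp
  have "AE \<omega> in M. ?ito \<omega> = I \<omega>"
    using J2(3) uniq[OF J2(2) I(2)] I(3) by eventually_elim simp
  then show "\<exists>I\<in>borel_measurable ZZ. AE \<omega> in M. ?ito \<omega> = I \<omega>" using I(1) by blast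
qed

end

section \<open>The estimation error\<close>

context kalman_bucy_model begin

lemma indicator_simple_pair:
  assumes t: "0 \<le> t" "t \<le> T"
  shows "simple_pair W T (\<lambda>s. indicator {0<..t} s *\<^sub>R w) (\<lambda>\<omega>. w \<bullet> (W t \<omega> - W 0 \<omega>))"
  unfolding simple_pair_def
proof (intro exI conjI)
  let ?\<tau> = "\<lambda>i::nat. if i = 0 then 0 else if i = 1 then t else T" and ?x = "\<lambda>i::nat. if i = 0 then w else 0"
  show "partition_of T 2 ?\<tau>" using t by (auto simp: partition_of_def)
  show "(\<lambda>s. indicator {0<..t} s *\<^sub>R w) = step_function 2 ?\<tau> ?x"
    by (rule ext) (simp add: step_function_def numeral_2_eq_2)
  show "(\<lambda>\<omega>. w \<bullet> (W t \<omega> - W 0 \<omega>)) = step_integral W 2 ?\<tau> ?x"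
    by (rule ext) (simp add: step_integral_def numeral_2_eq_2)
qed

text \<open>Duality with the adjoint equation \<open>q' = - A\<^sup>T q - C\<^sup>T w\<close>. The integrand \<open>q\<close> is continued by zero beyond
  \<open>t\<close>; this is still absolutely continuous, as needed for integration by parts, if \<open>q\<close> vanishes at \<open>t\<close> or
  there is nothing beyond \<open>t\<close>. The first case serves the observations, the second the final state.\<close>

lemma observable_gauss:
  assumes t: "0 \<le> t" "t \<le> T" and y: "y = 0 \<or> t = T"
  obtains q where "q t = y"
    "\<And>s. s \<in> {0..t} \<Longrightarrow> (q has_vector_derivative - (transpose (A s) *v q s) + - (transpose (C s) *v w)) (at s within {0..t})"
    "gauss (q 0 \<bullet> m0) 0 (q 0) (\<lambda>s. if s \<le> t then q s else 0) (\<lambda>s. indicator {0<..t} s *\<^sub>R w) (\<lambda>\<omega>. y \<bullet> X t \<omega> + w \<bullet> Z t \<omega>)"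
proof -
  have trA: "continuous_on {0..t} (\<lambda>s. - transpose (A s))" and trC: "continuous_on {0..t} (\<lambda>s. - (transpose (C s) *v w))"
    unfolding transpose_def
    by (intro continuous_intros continuous_onT A_cont C_cont bounded_bilinear.continuous_on[OF bounded_bilinear_matrix_vector])+
  obtain q where qt: "q t = y"
    and q0: "\<And>s. s \<in> {0..t} \<Longrightarrow> (q has_vector_derivative (- transpose (A s)) *v q s + - (transpose (C s) *v w)) (at s within {0..t})"
    using terminal_ode_exists[OF t(1) trA trC, of y] by blast
  have q: "(q has_vector_derivative - (transpose (A s) *v q s) + - (transpose (C s) *v w)) (at s within {0..t})"
    if "s \<in> {0..t}" for s
    using q0[OF that] unfolding uminus_matrix_vector .
  define h where "h s = - (transpose (A s) *v q s) + - (transpose (C s) *v w)" for s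
  have qc: "continuous_on {0..t} q"
    by (metis q has_vector_derivative_continuous continuous_on_eq_continuous_within)
  have hc: "continuous_on {0..t} h"
    unfolding h_def uminus_matrix_vector[symmetric]
    by (intro continuous_on_add trA trC[unfolded uminus_matrix_vector[symmetric]] qc bounded_bilinear.continuous_on[OF bounded_bilinear_matrix_vector])
  define p where "p s = (if s \<le> t then q s else 0)" for s
  define p' where "p' s = (if s \<in> {0..t} then h s else 0)" for s
  have p'ai: "p' absolutely_integrable_on {0..T}"
  proof -
    have "h absolutely_integrable_on {0..t}" by (rule absolutely_integrable_continuous_real[OF hc])
    then have "p' absolutely_integrable_on UNIV"
      unfolding p'_def[abs_def] by (subst absolutely_integrable_restrict_UNIV)
    then show ?thesis by (rule set_integrable_subset) auto
  qed
  have qint: "q s = q 0 + integral {0..s} h" if "s \<in> {0..t}" for s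
  proof -
    have "(h has_integral (q s - q 0)) {0..s}"
    proof (rule fundamental_theorem_of_calculus)
      fix r assume "r \<in> {0..s}"
      then show "(q has_vector_derivative h r) (at r within {0..s})"
        using has_vector_derivative_within_subset[OF q[of r, folded h_def], of "{0..s}"] that by auto
    qed (use that in simp)
    then show ?thesis by (simp add: integral_unique)
  qed
  have int_restrict: "integral {0..s} (\<lambda>r. if r \<in> {0..t} then f r else 0) = integral {0..min s t} f"
    for s and f :: "real \<Rightarrow> 'b::euclidean_space"
  proof -
    have "{0..t} \<inter> {0..s} = {0..min s t}" by auto
    then show ?thesis using integral_restrict_Int[of "{0..s}" "{0..t}" f] by (simp add: Int_commute)
  qed
  have p: "p s = q 0 + integral {0..s} p'" if s: "s \<in> {0..T}" for s
  proof (cases "s \<le> t")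
    case True
    then show ?thesis using qint[of s] s unfolding p'_def[abs_def] int_restrict by (simp add: p_def min_absorb1)
  next
    case False
    then have "y = 0" using y s by auto
    then show ?thesis using False qint[of t] qt t unfolding p'_def[abs_def] int_restrict by (simp add: p_def min_absorb2)
  qed
  have pT: "p T = y" using qt y t by (auto simp: p_def)
  obtain I where I: "has_wiener_integral M B Q T p I"
    "AE \<omega> in M. I \<omega> = p T \<bullet> B T \<omega> - integral {0..T} (\<lambda>t. p' t \<bullet> B t \<omega>)"
    using NB.wiener_integral_by_parts[OF T0 p'ai p] by blast
  note sp = indicator_simple_pair[OF t, of w]
  have pc: "continuous_on {0..T} p"
  proof (rule continuous_on_eq)
    show "continuous_on {0..T} (\<lambda>s. q 0 + integral {0..s} p')"
      using p'ai by (intro continuous_intros indefinite_integral_continuous_1) (simp add: set_lebesgue_integral_eq_integral(1))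
  qed (use p in simp)
  have G: "gauss (q 0 \<bullet> m0) 0 (q 0) p (\<lambda>s. indicator {0<..t} s *\<^sub>R w) (\<lambda>\<omega>. y \<bullet> X t \<omega> + w \<bullet> Z t \<omega>)"
    unfolding gauss_def
  proof (intro conjI exI)
    show "(\<lambda>\<omega>. y \<bullet> X t \<omega> + w \<bullet> Z t \<omega>) \<in> borel_measurable M"
      by (intro borel_measurable_add borel_measurable_inner borel_measurable_const X_meas Z_meas t)
    show "NB.L2 T p" unfolding NB.L2_def
      by (intro conjI continuous_on_imp_lebesgue_measurable abs_integrable_quadratic Q_int T0 pc)
    show "NW.L2 T (\<lambda>s. indicator {0<..t} s *\<^sub>R w)"
      unfolding NW.L2_def using NW.simple_form_integrable[OF sp T0] by blast
    show "has_wiener_integral M B Q T p I" by (rule I)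
    show "has_wiener_integral M W R T (\<lambda>s. indicator {0<..t} s *\<^sub>R w) (\<lambda>\<omega>. w \<bullet> (W t \<omega> - W 0 \<omega>))"
      by (rule NW.wiener_integral_simple[OF sp T0])
    have kai: "(\<lambda>s. - (transpose (C s) *v w)) absolutely_integrable_on {0..t}"
      by (rule absolutely_integrable_continuous_real[OF trC])
    show "AE \<omega> in M. y \<bullet> X t \<omega> + w \<bullet> Z t \<omega> = q 0 \<bullet> m0 + 0 \<bullet> (Xbar0 \<omega> - m0) + q 0 \<bullet> (X 0 \<omega> - m0) + I \<omega> + w \<bullet> (W t \<omega> - W 0 \<omega>)"
      using paths I(2)
    proof eventually_elim
      case (elim \<omega>)
      have Xc: "continuous_on {0..} (\<lambda>t. X t \<omega>)" and Bc: "continuous_on {0..} (\<lambda>t. B t \<omega>)" and W0: "W 0 \<omega> = 0"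
        and Ze: "Z t \<omega> = integral {0..t} (\<lambda>s. C s *v X s \<omega>) + W t \<omega>" using elim t by auto
      have Xe: "\<And>s. 0 \<le> s \<Longrightarrow> X s \<omega> = X 0 \<omega> + integral {0..s} (\<lambda>r. A r *v X r \<omega>) + B s \<omega>" using elim by blast
      have dual: "q t \<bullet> X t \<omega> = q 0 \<bullet> X 0 \<omega> + integral {0..t} (\<lambda>s. X s \<omega> \<bullet> - (transpose (C s) *v w))
         + (q t \<bullet> B t \<omega> - integral {0..t} (\<lambda>s. h s \<bullet> B s \<omega>))"
        unfolding h_def
        by (rule path_duality[OF t(1) Xc Bc Xe q kai])
      have CXi: "(\<lambda>s. C s *v X s \<omega>) integrable_on {0..t}"
        by (rule integrable_subinterval_real[OF integrable_continuous_interval[OF CX_continuous[OF Xc]]]) (use t in auto)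
      have "w \<bullet> integral {0..t} (\<lambda>s. C s *v X s \<omega>) = integral {0..t} (\<lambda>s. w \<bullet> (C s *v X s \<omega>))"
        using integral_linear[OF CXi bounded_linear_inner_right[of w]] by (simp add: o_def)
      also have "\<dots> = integral {0..t} (\<lambda>s. - (X s \<omega> \<bullet> - (transpose (C s) *v w)))"
        unfolding drift_inner by (simp add: inner_commute del: transpose_matrix_vector)
      finally have d1: "w \<bullet> integral {0..t} (\<lambda>s. C s *v X s \<omega>) = - integral {0..t} (\<lambda>s. X s \<omega> \<bullet> - (transpose (C s) *v w))"
        by simp
      have p'B: "p' s \<bullet> B s \<omega> = (if s \<in> {0..t} then h s \<bullet> B s \<omega> else 0)" for s by (simp add: p'_def)
      have d2: "integral {0..T} (\<lambda>s. p' s \<bullet> B s \<omega>) = integral {0..t} (\<lambda>s. h s \<bullet> B s \<omega>)"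
        unfolding p'B int_restrict using t by (simp add: min_absorb2)
      have d3: "p T \<bullet> B T \<omega> = y \<bullet> B t \<omega>" using y pT by auto
      have "w \<bullet> Z t \<omega> = w \<bullet> integral {0..t} (\<lambda>s. C s *v X s \<omega>) + w \<bullet> W t \<omega>" unfolding Ze by (rule inner_add_right)
      then show ?case
        using dual d1 d2 d3 elim(2) W0 qt by (simp add: inner_diff_right del: transpose_matrix_vector)
    qed
  qed
  have pe: "p = (\<lambda>s. if s \<le> t then q s else 0)" by (simp add: p_def fun_eq_iff)
  show ?thesis
  proof (rule that)
    show "q t = y" by (rule qt)
    show "gauss (q 0 \<bullet> m0) 0 (q 0) (\<lambda>s. if s \<le> t then q s else 0) (\<lambda>s. indicator {0<..t} s *\<^sub>R w) (\<lambda>\<omega>. y \<bullet> X t \<omega> + w \<bullet> Z t \<omega>)"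
      using G unfolding pe .
  qed (rule q)
qed

lemma state_gaussian: "\<exists>\<mu> v. 0 \<le> v \<and> distr M borel (\<lambda>\<omega>. a \<bullet> X T \<omega>) = normal_law \<mu> v"
proof -
  obtain q g where "gauss (q 0 \<bullet> m0) 0 (q 0) (\<lambda>s. if s \<le> T then q s else 0) g (\<lambda>\<omega>. a \<bullet> X T \<omega> + 0 \<bullet> Z T \<omega>)"
    by (rule observable_gauss[OF T0 order_refl, of a 0]) auto
  then have G: "gauss (q 0 \<bullet> m0) 0 (q 0) (\<lambda>s. if s \<le> T then q s else 0) g (\<lambda>\<omega>. a \<bullet> X T \<omega>)" by simp
  show ?thesis by (intro exI conjI, rule gauss_var_nonneg[OF G], rule gauss_law[OF G])
qed

definition opt_u :: "real^'d \<Rightarrow> real \<Rightarrow> real^'m" where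
  "opt_u a t = Kt t *v (\<Phi> t T *v a)"

definition opt_error :: "real^'d \<Rightarrow> 'a \<Rightarrow> real" where
  "opt_error a \<omega> = a \<bullet> X T \<omega> - ((\<Phi> 0 T *v a) \<bullet> m0 + ito_integral M (\<lambda>t \<omega>. C t *v X t \<omega>) W R T (opt_u a) \<omega>)"

lemma opt_u_admissible: "admissible C R T (opt_u a)"
  unfolding opt_u_def[abs_def] by (rule gain_admissible[OF sol_Phi[OF T0] T0])

text \<open>Duality with \<open>p\<close>: the drift of \<open>p \<bullet> X\<close> is exactly the drift of \<open>\<integral> u \<bullet> dZ\<close>, so that only noise is left.
  The integrand \<open>- u\<close> has the shape of a linear combination with \<open>0\<close> because that is how its integral is
  obtained.\<close>

lemma opt_error_gauss:
  "gauss 0 0 (\<Phi> 0 T *v a) (\<lambda>t. \<Phi> t T *v a) (\<lambda>t. (-1) *\<^sub>R opt_u a t + 0) (opt_error a)"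
proof -
  define p where "p t = \<Phi> t T *v a" for t
  have sp: "sol p" unfolding p_def[abs_def] by (rule sol_Phi[OF T0])
  have pT: "p T = a" unfolding p_def by (rule transition_vector(2)[OF Phi T0 T0])
  have u: "opt_u a t = Kt t *v p t" for t by (simp add: opt_u_def p_def)
  note adm = opt_u_admissible[of a]
  define k where "k s = transpose (C s) *v opt_u a s" for s
  define p' where "p' s = - (transpose (A s) *v p s) + k s" for s
  have kai: "k absolutely_integrable_on {0..T}" using adm by (simp add: admissible_def k_def[abs_def] del: transpose_matrix_vector)
  have pd: "(p has_vector_derivative p' s) (at s within {0..T})" if "s \<in> {0..T}" for s
  proof -
    have "(p has_vector_derivative F s *v p s) (at s within {0..})" using sp that by (simp add: sol_def)
    moreover have "F s *v p s = p' s" by (simp add: p'_def k_def u F_vector del: transpose_matrix_vector)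
    ultimately show ?thesis using has_vector_derivative_within_subset[of p "p' s" s "{0..}" "{0..T}"] by auto
  qed
  have pc: "continuous_on {0..T} p" by (rule continuous_onT[OF sol_continuous[OF sp]])
  have p'ai: "p' absolutely_integrable_on {0..T}"
  proof -
    have "continuous_on {0..T} (\<lambda>s. transpose (A s))" unfolding transpose_def by (intro continuous_intros continuous_onT A_cont)
    then have "(\<lambda>s. - (transpose (A s) *v p s)) absolutely_integrable_on {0..T}"
      by (intro absolutely_integrable_continuous_real continuous_on_minus bounded_bilinear.continuous_on[OF bounded_bilinear_matrix_vector] pc)
    then show ?thesis unfolding p'_def[abs_def] using kai by (rule set_integral_add(1))
  qed
  have pint: "p s = p 0 + integral {0..s} p'" if s: "s \<in> {0..T}" for s
  proof -
    have "(p' has_integral (p s - p 0)) {0..s}"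
    proof (rule fundamental_theorem_of_calculus)
      fix r assume "r \<in> {0..s}"
      then show "(p has_vector_derivative p' r) (at r within {0..s})"
        using has_vector_derivative_within_subset[OF pd[of r], of "{0..s}"] s by auto
    qed (use s in simp)
    then show ?thesis by (simp add: integral_unique)
  qed
  obtain I where I: "has_wiener_integral M B Q T p I"
    "AE \<omega> in M. I \<omega> = p T \<bullet> B T \<omega> - integral {0..T} (\<lambda>t. p' t \<bullet> B t \<omega>)"
    using NB.wiener_integral_by_parts[OF T0 p'ai pint] by blast
  obtain I' J where J: "I' \<in> borel_measurable ZZ" "has_wiener_integral M W R T (opt_u a) J"
    "AE \<omega> in M. I' \<omega> = integral {0..T} (\<lambda>t. opt_u a t \<bullet> (C t *v X t \<omega>)) + J \<omega>"
    by (rule ito_observable_version[OF adm])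
  note ito = ito_integral_AE[OF adm J(2)]
  note zero = NW.wiener_integral_simple[OF simple_pair_zero[OF T0] T0]
  have "gauss 0 0 (p 0) p (\<lambda>t. (-1) *\<^sub>R opt_u a t + 0) (opt_error a)"
    unfolding gauss_def
  proof (intro conjI exI)
    show "opt_error a \<in> borel_measurable M"
      unfolding opt_error_def[abs_def]
      by (intro borel_measurable_diff borel_measurable_add borel_measurable_inner borel_measurable_const X_meas T0 ito(1))
    show "NB.L2 T p" unfolding NB.L2_def
      by (intro conjI continuous_on_imp_lebesgue_measurable abs_integrable_quadratic Q_int T0 pc)
    show "NW.L2 T (\<lambda>t. (-1) *\<^sub>R opt_u a t + 0)"
      by (rule NW.L2_lincomb[OF T0 admissible_cost(3)[OF adm] NW.L2_zero])
    show "has_wiener_integral M B Q T p I" by (rule I)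
    show "has_wiener_integral M W R T (\<lambda>t. (-1) *\<^sub>R opt_u a t + 0) (\<lambda>\<omega>. (-1) * J \<omega> + 0)"
      by (rule NW.wiener_integral_lincomb[OF T0 admissible_cost(2)[OF adm] _ J(2) zero]) simp
    show "AE \<omega> in M. opt_error a \<omega> = 0 + 0 \<bullet> (Xbar0 \<omega> - m0) + p 0 \<bullet> (X 0 \<omega> - m0) + I \<omega> + ((-1) * J \<omega> + 0)"
      using paths I(2) ito(2)
    proof eventually_elim
      case (elim \<omega>)
      have Xc: "continuous_on {0..} (\<lambda>t. X t \<omega>)" and Bc: "continuous_on {0..} (\<lambda>t. B t \<omega>)" using elim by auto
      have Xe: "\<And>s. 0 \<le> s \<Longrightarrow> X s \<omega> = X 0 \<omega> + integral {0..s} (\<lambda>r. A r *v X r \<omega>) + B s \<omega>" using elim by blast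
      have dual: "p T \<bullet> X T \<omega> = p 0 \<bullet> X 0 \<omega> + integral {0..T} (\<lambda>s. X s \<omega> \<bullet> k s)
         + (p T \<bullet> B T \<omega> - integral {0..T} (\<lambda>s. p' s \<bullet> B s \<omega>))"
        unfolding p'_def
        by (rule path_duality[OF T0 Xc Bc Xe pd[unfolded p'_def] kai])
      have "integral {0..T} (\<lambda>t. opt_u a t \<bullet> (C t *v X t \<omega>)) = integral {0..T} (\<lambda>s. X s \<omega> \<bullet> k s)"
        unfolding drift_inner k_def by (simp add: inner_commute del: transpose_matrix_vector)
      then show ?case
        using dual elim(2,3) pT by (simp add: opt_error_def p_def[symmetric] inner_diff_right)
    qed
  qed
  then show ?thesis by (simp add: p_def[abs_def])
qed

text \<open>The energy identity for \<open>p\<close>, integrated from \<open>0\<close> to \<open>T\<close>.\<close>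

lemma opt_error_variance:
  "gauss_var 0 (\<Phi> 0 T *v a) (\<lambda>t. \<Phi> t T *v a) (\<lambda>t. (-1) *\<^sub>R opt_u a t + 0) = a \<bullet> (\<Sigma> T *v a)"
proof -
  define p where "p t = \<Phi> t T *v a" for t
  have sp: "sol p" unfolding p_def[abs_def] by (rule sol_Phi[OF T0])
  have pT: "p T = a" unfolding p_def by (rule transition_vector(2)[OF Phi T0 T0])
  note int = set_lebesgue_integral_eq_integral(1)
  have neg: "R t *v (- x) = - (R t *v x)" for x t
    using matrix_vector_mult_diff_distrib[of "R t" 0 x] by simp
  have cR: "cov_form R T (\<lambda>t. (-1) *\<^sub>R opt_u a t + 0) = cov_form R T (\<lambda>t. Kt t *v p t)"
    by (simp add: cov_form_def opt_u_def p_def neg)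
  have "cov_form Q T p + cov_form R T (\<lambda>t. Kt t *v p t) = p T \<bullet> (\<Sigma> T *v p T) - p 0 \<bullet> (\<Sigma> 0 *v p 0)"
    unfolding cov_form_def
    using integral_unique[OF energy_has_integral[OF sp sp T0]]
      Henstock_Kurzweil_Integration.integral_add[OF int[OF Q_form_integrable[OF sp sp T0]] int[OF R_form_integrable_diag[OF sp T0]]]
    by simp
  then show ?thesis
    using cR pT by (simp add: gauss_var_def p_def[abs_def])
qed

text \<open>The derivative of \<open>q \<bullet> \<Sigma> p\<close> is \<open>q \<bullet> Q p - w \<bullet> R u\<close>, because \<open>R u = C \<Sigma> p\<close>. Its integral over \<open>[0, t]\<close>
  equals \<open>- q\<^sub>0 \<bullet> \<Sigma>\<^sub>0 p\<^sub>0\<close>, as \<open>q\<close> vanishes at \<open>t\<close>, and this cancels the contribution of the initial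
  condition to the covariance.\<close>

lemma opt_error_orthogonal:
  assumes t: "0 \<le> t" "t \<le> T"
  shows "\<exists>c \<gamma> \<alpha> f g. gauss c \<gamma> \<alpha> f g (\<lambda>\<omega>. w \<bullet> Z t \<omega>) \<and>
    gauss_cov 0 (\<Phi> 0 T *v a) (\<lambda>t. \<Phi> t T *v a) (\<lambda>t. (-1) *\<^sub>R opt_u a t + 0) \<gamma> \<alpha> f g = 0"
proof -
  define p where "p t = \<Phi> t T *v a" for t
  have sp: "sol p" unfolding p_def[abs_def] by (rule sol_Phi[OF T0])
  have pc: "continuous_on {0..t} p" by (rule continuous_onT[OF sol_continuous[OF sp]])
  obtain q where qt: "q t = 0"
    and q: "\<And>s. s \<in> {0..t} \<Longrightarrow> (q has_vector_derivative - (transpose (A s) *v q s) + - (transpose (C s) *v w)) (at s within {0..t})"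
    and g: "gauss (q 0 \<bullet> m0) 0 (q 0) (\<lambda>s. if s \<le> t then q s else 0) (\<lambda>s. indicator {0<..t} s *\<^sub>R w) (\<lambda>\<omega>. 0 \<bullet> X t \<omega> + w \<bullet> Z t \<omega>)"
    by (rule observable_gauss[OF t, of 0 w]) auto
  have qc: "continuous_on {0..t} q"
    by (metis q has_vector_derivative_continuous continuous_on_eq_continuous_within)
  have "((\<lambda>s. q s \<bullet> (\<Sigma> s *v p s)) has_vector_derivative q s \<bullet> (Q s *v p s) - w \<bullet> (R s *v (Kt s *v p s))) (at s within {0..t})"
    if s: "s \<in> {0..t}" for s
  proof -
    have "((\<lambda>s. \<Sigma> s *v p s) has_vector_derivative A s *v (\<Sigma> s *v p s) + Q s *v p s) (at s within {0..t})"
      using has_vector_derivative_within_subset[OF Sigma_sol_derivative[OF sp, of s], of "{0..t}"] s by auto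
    then have "((\<lambda>s. q s \<bullet> (\<Sigma> s *v p s)) has_vector_derivative
       q s \<bullet> (A s *v (\<Sigma> s *v p s) + Q s *v p s) + (- (transpose (A s) *v q s) + - (transpose (C s) *v w)) \<bullet> (\<Sigma> s *v p s)) (at s within {0..t})"
      by (intro bounded_bilinear.has_vector_derivative[OF bounded_bilinear_inner] q s)
    moreover have "q s \<bullet> (A s *v (\<Sigma> s *v p s) + Q s *v p s) + (- (transpose (A s) *v q s) + - (transpose (C s) *v w)) \<bullet> (\<Sigma> s *v p s)
       = q s \<bullet> (Q s *v p s) - w \<bullet> (R s *v (Kt s *v p s))"
      using s by (simp add: R_Kt inner_add_right inner_add_left inner_diff_left inner_minus_left inner_matrix_vector[of "q s" "A s"]
          inner_matrix_vector[of w "C s"] del: transpose_matrix_vector)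
    ultimately show ?thesis by simp
  qed
  then have ftc: "((\<lambda>s. q s \<bullet> (Q s *v p s) - w \<bullet> (R s *v (Kt s *v p s))) has_integral - (q 0 \<bullet> (\<Sigma> 0 *v p 0))) {0..t}"
    using fundamental_theorem_of_calculus[OF t(1), of "\<lambda>s. q s \<bullet> (\<Sigma> s *v p s)"] qt by simp
  have i1: "(\<lambda>s. q s \<bullet> (Q s *v p s)) integrable_on {0..t}"
    using abs_integrable_quadratic[OF Q_int[OF t(1)] qc pc] by (rule set_lebesgue_integral_eq_integral(1))
  have i2: "(\<lambda>s. w \<bullet> (R s *v (Kt s *v p s))) integrable_on {0..t}"
    using integrable_diff[OF i1 has_integral_integrable[OF ftc]] by simp
  have sum: "integral {0..t} (\<lambda>s. q s \<bullet> (Q s *v p s)) - integral {0..t} (\<lambda>s. w \<bullet> (R s *v (Kt s *v p s))) = - (q 0 \<bullet> (\<Sigma> 0 *v p 0))"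
    using integral_unique[OF ftc] Henstock_Kurzweil_Integration.integral_diff[OF i1 i2] by simp
  have restrict: "integral {0..T} (\<lambda>r. if r \<in> {0..t} then f r else 0) = integral {0..t} f" for f :: "real \<Rightarrow> real"
  proof -
    have "{0..t} \<inter> {0..T} = {0..t}" using t by auto
    then show ?thesis using integral_restrict_Int[of "{0..T}" "{0..t}" f] by (simp only: Int_commute[of "{0..T}"])
  qed
  have cQ: "NB.cov_inner T p (\<lambda>s. if s \<le> t then q s else 0) = integral {0..t} (\<lambda>s. q s \<bullet> (Q s *v p s))"
  proof -
    have "NB.cov_inner T p (\<lambda>s. if s \<le> t then q s else 0) = integral {0..T} (\<lambda>r. if r \<in> {0..t} then q r \<bullet> (Q r *v p r) else 0)"
      unfolding NB.cov_inner_def by (rule integral_cong) (auto intro!: posdef_swap Q_pos)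
    then show ?thesis by (simp only: restrict)
  qed
  have cR: "NW.cov_inner T (\<lambda>t. (-1) *\<^sub>R opt_u a t + 0) (\<lambda>s. indicator {0<..t} s *\<^sub>R w) = - integral {0..t} (\<lambda>s. w \<bullet> (R s *v (Kt s *v p s)))"
  proof -
    have "NW.cov_inner T (\<lambda>t. (-1) *\<^sub>R opt_u a t + 0) (\<lambda>s. indicator {0<..t} s *\<^sub>R w)
       = integral {0..T} (\<lambda>r. if r \<in> {0..t} then - (w \<bullet> (R r *v (Kt r *v p r))) else 0)"
      unfolding NW.cov_inner_def
    proof (rule integral_spike[of "{0}"])
      fix r assume r: "r \<in> {0..T} - {0}"
      have "opt_u a r \<bullet> (R r *v w) = w \<bullet> (R r *v opt_u a r)" using r by (intro posdef_swap R_pos) auto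
      then show "(if r \<in> {0..t} then - (w \<bullet> (R r *v (Kt r *v p r))) else 0) = ((-1) *\<^sub>R opt_u a r + 0) \<bullet> (R r *v indicator {0<..t} r *\<^sub>R w)"
        using r by (auto simp: opt_u_def p_def)
    qed auto
    then show ?thesis by (simp only: restrict) simp
  qed
  have "gauss_cov 0 (p 0) p (\<lambda>t. (-1) *\<^sub>R opt_u a t + 0) 0 (q 0) (\<lambda>s. if s \<le> t then q s else 0) (\<lambda>s. indicator {0<..t} s *\<^sub>R w) = 0"
    unfolding gauss_cov_def cQ cR using sum posdef_swap[OF Sigma0_pos, of "p 0" "q 0"] by simp
  then show ?thesis using g unfolding p_def[abs_def] by (intro exI conjI) auto
qed

end

section \<open>Exactness, optimality and uniqueness\<close>

lemma (in prob_space) cond_mse_cong: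
  assumes "AE \<omega> in M. real_cond_exp M F S \<omega> = real_cond_exp M F S' \<omega>"
  shows "cond_mse M F S U = cond_mse M F S' U"
  unfolding cond_mse_def by (rule nn_integral_cong_AE) (use assms in \<open>eventually_elim, simp\<close>)

context kalman_bucy_model begin

abbreviation ito :: "(real \<Rightarrow> real^'m) \<Rightarrow> 'a \<Rightarrow> real" where
  "ito v \<equiv> ito_integral M (\<lambda>t \<omega>. C t *v X t \<omega>) W R T v"

abbreviation S_est :: "real^'d \<Rightarrow> real^'d \<Rightarrow> (real \<Rightarrow> real^'m) \<Rightarrow> 'a \<Rightarrow> real" where
  "S_est b c v \<equiv> estimator M C R X W Xbar0 m0 T b c v"

lemma Xbar0_measurable [measurable]: "Xbar0 \<in> borel_measurable M"
  using Xbar0 by (simp add: gaussian_vector_def)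

lemma XT_measurable [measurable]: "X T \<in> borel_measurable M"
  by (rule X_meas[OF T0])

lemma ito_measurable: "admissible C R T v \<Longrightarrow> ito v \<in> borel_measurable M"
  by (rule ito_observable_version) (auto intro: ito_integral_AE(1))

lemma S_est_measurable: "admissible C R T v \<Longrightarrow> S_est b c v \<in> borel_measurable M"
  unfolding estimator_def[abs_def]
  by (intro borel_measurable_add borel_measurable_const borel_measurable_inner borel_measurable_diff Xbar0_measurable ito_measurable)

lemma ito_observable: "admissible C R T v \<Longrightarrow> \<exists>I\<in>borel_measurable ZZ. AE \<omega> in M. ito v \<omega> = I \<omega>"
  by (rule ito_observable_version) (auto dest: ito_integral_AE(3))

lemma opt_error_indep:
  "indep_set (sets ZZ) {opt_error a -` D \<inter> space M | D. D \<in> sets borel}"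
  by (rule gauss_orthogonal_indep[OF opt_error_gauss opt_error_orthogonal])

lemma opt_error_law: "distr M borel (opt_error a) = normal_law 0 (a \<bullet> (\<Sigma> T *v a))"
  using gauss_law[OF opt_error_gauss[of a]] unfolding opt_error_variance .

lemma sample_gauss: "gauss 0 c 0 (\<lambda>_. 0) (\<lambda>_. 0) (\<lambda>\<omega>. c \<bullet> (Xbar0 \<omega> - m0))"
  unfolding gauss_def
  using NB.wiener_integral_simple[OF simple_pair_zero[OF T0] T0] NW.wiener_integral_simple[OF simple_pair_zero[OF T0] T0]
  by (intro conjI exI[of _ "\<lambda>_. 0"]) (auto simp: NB.L2_zero NW.L2_zero)

lemma sample_law: "distr M borel (\<lambda>\<omega>. c \<bullet> (Xbar0 \<omega> - m0)) = normal_law 0 (c \<bullet> (\<Sigma> 0 *v c))"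
  using gauss_law[OF sample_gauss[of c]] by (simp add: gauss_var_def cov_form_def)

text \<open>The observations have no component along the sampled initial condition.\<close>

lemma sample_indep:
  "indep_set (sets ZZ) {(\<lambda>\<omega>. c \<bullet> (Xbar0 \<omega> - m0)) -` D \<inter> space M | D. D \<in> sets borel}"
proof (rule gauss_orthogonal_indep[OF sample_gauss])
  fix t w assume t: "0 \<le> t" "t \<le> T"
  obtain q f g where "gauss (q 0 \<bullet> m0) 0 (q 0 :: real^'d) f g (\<lambda>\<omega>. 0 \<bullet> X t \<omega> + w \<bullet> Z t \<omega>)"
    by (rule observable_gauss[OF t, of 0 w]) auto
  then show "\<exists>c' \<gamma>' \<alpha>' f' g'. gauss c' \<gamma>' \<alpha>' f' g' (\<lambda>\<omega>. w \<bullet> Z t \<omega>) \<and> gauss_cov c 0 (\<lambda>_. 0) (\<lambda>_. 0) \<gamma>' \<alpha>' f' g' = 0"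
    by (intro exI conjI) (auto simp: gauss_cov_def NB.cov_inner_def NW.cov_inner_def)
qed

lemma estimator_decomposition:
  assumes "admissible C R T v" "I \<in> borel_measurable ZZ" "AE \<omega> in M. ito v \<omega> = I \<omega>"
  shows "(\<lambda>\<omega>. b \<bullet> m0 + I \<omega>) \<in> borel_measurable ZZ"
    and "AE \<omega> in M. S_est b c v \<omega> = (b \<bullet> m0 + I \<omega>) + c \<bullet> (Xbar0 \<omega> - m0)"
  using assms(2,3) by (auto simp: estimator_def)

lemma state_decomposition:
  assumes "I \<in> borel_measurable ZZ" "AE \<omega> in M. ito (opt_u a) \<omega> = I \<omega>"
  shows "AE \<omega> in M. a \<bullet> X T \<omega> = ((\<Phi> 0 T *v a) \<bullet> m0 + I \<omega>) + opt_error a \<omega>"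
  using assms(2) by eventually_elim (simp add: opt_error_def)

lemma opt_error_measurable: "opt_error a \<in> borel_measurable M"
  using opt_error_gauss[of a] by (simp add: gauss_def)

text \<open>Given the observations, both variables are the same constant plus an independent centred normal
  variable, with equal variances.\<close>

theorem estimator_exact:
  assumes c: "c \<bullet> (\<Sigma> 0 *v c) = a \<bullet> (\<Sigma> T *v a)" and g[measurable]: "g \<in> borel_measurable borel"
  shows "AE \<omega> in M. real_cond_exp M ZZ (\<lambda>\<omega>. g (S_est (\<Phi> 0 T *v a) c (opt_u a) \<omega>)) \<omega> =
     real_cond_exp M ZZ (\<lambda>\<omega>. g (a \<bullet> X T \<omega>)) \<omega>"
proof -
  note adm = opt_u_admissible[of a]
  obtain I where I: "I \<in> borel_measurable ZZ" "AE \<omega> in M. ito (opt_u a) \<omega> = I \<omega>"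
    using ito_observable[OF adm] by blast
  let ?Y = "\<lambda>\<omega>. (\<Phi> 0 T *v a) \<bullet> m0 + I \<omega>"
  note d = estimator_decomposition(1)[OF adm I, where b = "\<Phi> 0 T *v a"]
    estimator_decomposition(2)[OF adm I, where b = "\<Phi> 0 T *v a" and c = c]
  have "AE \<omega> in M. real_cond_exp M ZZ (\<lambda>\<omega>. g (S_est (\<Phi> 0 T *v a) c (opt_u a) \<omega>)) \<omega> =
     enn2real (\<integral>\<^sup>+x. ennreal (g (?Y \<omega> + x)) \<partial>distr M borel (\<lambda>\<omega>. c \<bullet> (Xbar0 \<omega> - m0)))
     - enn2real (\<integral>\<^sup>+x. ennreal (- g (?Y \<omega> + x)) \<partial>distr M borel (\<lambda>\<omega>. c \<bullet> (Xbar0 \<omega> - m0)))"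
    by (rule real_cond_exp_indep_sum[OF subalgebra_ZZ d(1) _ sample_indep g S_est_measurable[OF adm] d(2)]) measurable
  moreover have "AE \<omega> in M. real_cond_exp M ZZ (\<lambda>\<omega>. g (a \<bullet> X T \<omega>)) \<omega> =
     enn2real (\<integral>\<^sup>+x. ennreal (g (?Y \<omega> + x)) \<partial>distr M borel (opt_error a))
     - enn2real (\<integral>\<^sup>+x. ennreal (- g (?Y \<omega> + x)) \<partial>distr M borel (opt_error a))"
    by (rule real_cond_exp_indep_sum[OF subalgebra_ZZ d(1) opt_error_measurable opt_error_indep g _ state_decomposition[OF I]]) measurable
  ultimately show ?thesis
    unfolding sample_law opt_error_law c by eventually_elim simp
qed

lemma state_square_integrable:
  "integrable M (\<lambda>\<omega>. (a \<bullet> X T \<omega>)\<^sup>2)" "integrable M (\<lambda>\<omega>. ((a \<bullet> X T \<omega>)\<^sup>2)\<^sup>2)"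
proof -
  obtain \<mu> v where v: "0 \<le> v" "distr M borel (\<lambda>\<omega>. a \<bullet> X T \<omega>) = normal_law \<mu> v" using state_gaussian by blast
  have m: "(\<lambda>\<omega>. a \<bullet> X T \<omega>) \<in> borel_measurable M" by measurable
  note i = normal_integrable_power[OF m v]
  show "integrable M (\<lambda>\<omega>. (a \<bullet> X T \<omega>)\<^sup>2)" by (rule i)
  show "integrable M (\<lambda>\<omega>. ((a \<bullet> X T \<omega>)\<^sup>2)\<^sup>2)" using i[of 4] by (simp add: power_mult[symmetric])
qed

abbreviation solution :: "real^'d \<Rightarrow> real^'d \<Rightarrow> real^'d \<Rightarrow> (real \<Rightarrow> real^'m) \<Rightarrow> bool" where
  "solution a b c v \<equiv> bi_objective_solution M C R X W Z Xbar0 m0 T a b c v"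

theorem solution_if_variance:
  assumes c: "c \<bullet> (\<Sigma> 0 *v c) = a \<bullet> (\<Sigma> T *v a)"
  shows "solution a (\<Phi> 0 T *v a) c (opt_u a)"
proof -
  have m: "(\<lambda>\<omega>. a \<bullet> X T \<omega>) \<in> borel_measurable M" "(\<lambda>\<omega>. (a \<bullet> X T \<omega>)\<^sup>2) \<in> borel_measurable M" by measurable
  have 1: "AE \<omega> in M. real_cond_exp M ZZ (S_est (\<Phi> 0 T *v a) c (opt_u a)) \<omega> = real_cond_exp M ZZ (\<lambda>\<omega>. a \<bullet> X T \<omega>) \<omega>"
    using estimator_exact[OF c, of "\<lambda>x. x"] by simp
  have 2: "AE \<omega> in M. real_cond_exp M ZZ (\<lambda>\<omega>. (S_est (\<Phi> 0 T *v a) c (opt_u a) \<omega>)\<^sup>2) \<omega> = real_cond_exp M ZZ (\<lambda>\<omega>. (a \<bullet> X T \<omega>)\<^sup>2) \<omega>"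
    using estimator_exact[OF c, of "\<lambda>x. x\<^sup>2"] by simp
  show ?thesis
    unfolding bi_objective_solution_def Let_def
    using opt_u_admissible cond_mse_ge(1)[OF subalgebra_ZZ m(1) state_square_integrable(1)]
      cond_mse_ge(1)[OF subalgebra_ZZ m(2) state_square_integrable(2)]
    by (simp add: cond_mse_cong[OF 1] cond_mse_cong[OF 2])
qed

text \<open>The comparison with an exact estimator shows that a solution attains both minima, so its first two
  conditional moments are those of \<open>a \<bullet> X\<^sub>T\<close>. The difference of the second moment and the squared first
  moment is the variance.\<close>

theorem variance_if_solution:
  assumes sol: "solution a b c v" and c0: "c0 \<bullet> (\<Sigma> 0 *v c0) = a \<bullet> (\<Sigma> T *v a)"
  shows "c \<bullet> (\<Sigma> 0 *v c) = a \<bullet> (\<Sigma> T *v a)"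
proof -
  have m: "(\<lambda>\<omega>. a \<bullet> X T \<omega>) \<in> borel_measurable M" "(\<lambda>\<omega>. (a \<bullet> X T \<omega>)\<^sup>2) \<in> borel_measurable M" by measurable
  have 1: "AE \<omega> in M. real_cond_exp M ZZ (S_est (\<Phi> 0 T *v a) c0 (opt_u a)) \<omega> = real_cond_exp M ZZ (\<lambda>\<omega>. a \<bullet> X T \<omega>) \<omega>"
    using estimator_exact[OF c0, of "\<lambda>x. x"] by simp
  have 2: "AE \<omega> in M. real_cond_exp M ZZ (\<lambda>\<omega>. (S_est (\<Phi> 0 T *v a) c0 (opt_u a) \<omega>)\<^sup>2) \<omega> = real_cond_exp M ZZ (\<lambda>\<omega>. (a \<bullet> X T \<omega>)\<^sup>2) \<omega>"
    using estimator_exact[OF c0, of "\<lambda>x. x\<^sup>2"] by simp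
  have v: "admissible C R T v"
    and le: "cond_mse M ZZ (S_est b c v) (\<lambda>\<omega>. a \<bullet> X T \<omega>) \<le> cond_mse M ZZ (S_est (\<Phi> 0 T *v a) c0 (opt_u a)) (\<lambda>\<omega>. a \<bullet> X T \<omega>)"
      "cond_mse M ZZ (\<lambda>\<omega>. (S_est b c v \<omega>)\<^sup>2) (\<lambda>\<omega>. (a \<bullet> X T \<omega>)\<^sup>2) \<le> cond_mse M ZZ (\<lambda>\<omega>. (S_est (\<Phi> 0 T *v a) c0 (opt_u a) \<omega>)\<^sup>2) (\<lambda>\<omega>. (a \<bullet> X T \<omega>)\<^sup>2)"
    using sol opt_u_admissible[of a] unfolding bi_objective_solution_def Let_def by blast+
  have e1: "AE \<omega> in M. real_cond_exp M ZZ (S_est b c v) \<omega> = real_cond_exp M ZZ (\<lambda>\<omega>. a \<bullet> X T \<omega>) \<omega>"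
    using le(1) unfolding cond_mse_cong[OF 1] by (rule cond_mse_ge(2)[OF subalgebra_ZZ m(1) state_square_integrable(1)])
  have e2: "AE \<omega> in M. real_cond_exp M ZZ (\<lambda>\<omega>. (S_est b c v \<omega>)\<^sup>2) \<omega> = real_cond_exp M ZZ (\<lambda>\<omega>. (a \<bullet> X T \<omega>)\<^sup>2) \<omega>"
    using le(2) unfolding cond_mse_cong[OF 2] by (rule cond_mse_ge(2)[OF subalgebra_ZZ m(2) state_square_integrable(2)])
  obtain Iv where Iv: "Iv \<in> borel_measurable ZZ" "AE \<omega> in M. ito v \<omega> = Iv \<omega>"
    using ito_observable[OF v] by blast
  obtain I where I: "I \<in> borel_measurable ZZ" "AE \<omega> in M. ito (opt_u a) \<omega> = I \<omega>"
    using ito_observable[OF opt_u_admissible] by blast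
  have cm: "(\<lambda>\<omega>. c \<bullet> (Xbar0 \<omega> - m0)) \<in> borel_measurable M" by measurable
  note dv = estimator_decomposition(1)[OF v Iv, where b = b] estimator_decomposition(2)[OF v Iv, where b = b and c = c]
  note Ym = estimator_decomposition(1)[OF opt_u_admissible I, where b = "\<Phi> 0 T *v a"]
  note cv = real_cond_exp_indep_normal[OF subalgebra_ZZ dv(1) cm sample_indep sample_law posdef_nonneg[OF Sigma0_pos] S_est_measurable[OF v] dv(2)]
  note cx = real_cond_exp_indep_normal[OF subalgebra_ZZ Ym opt_error_measurable opt_error_indep opt_error_law posdef_nonneg[OF Sigma_pos[OF T0]] m(1) state_decomposition[OF I]]
  have "AE \<omega> in M. c \<bullet> (\<Sigma> 0 *v c) = a \<bullet> (\<Sigma> T *v a)"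
    using cv cx e1 e2 by eventually_elim simp
  then show ?thesis by simp
qed

lemma ito_linear:
  "AE \<omega> in M. ito (opt_u (s *\<^sub>R a + a')) \<omega> = s * ito (opt_u a) \<omega> + ito (opt_u a') \<omega>"
proof -
  have lin: "opt_u (s *\<^sub>R a + a') = (\<lambda>t. s *\<^sub>R opt_u a t + opt_u a' t)"
    by (simp add: opt_u_def fun_eq_iff matrix_vector_right_distrib matrix_vector_mult_scaleR)
  obtain J where J: "has_wiener_integral M W R T (opt_u a) J" by (rule ito_observable_version[OF opt_u_admissible])
  obtain J' where J': "has_wiener_integral M W R T (opt_u a') J'" by (rule ito_observable_version[OF opt_u_admissible])
  have "has_wiener_integral M W R T (opt_u (s *\<^sub>R a + a')) (\<lambda>\<omega>. s * J \<omega> + J' \<omega>)"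
    unfolding lin by (intro NW.wiener_integral_lincomb T0 J J' admissible_cost(2)[OF opt_u_admissible])
  note ae = ito_integral_AE(2)[OF opt_u_admissible this]
  show ?thesis
    using ae ito_integral_AE(2)[OF opt_u_admissible J] ito_integral_AE(2)[OF opt_u_admissible J'] paths
  proof eventually_elim
    case (elim \<omega>)
    have i: "(\<lambda>t. opt_u a t \<bullet> (C t *v X t \<omega>)) integrable_on {0..T}" for a
      using drift_abs_integrable[OF opt_u_admissible] elim(4) by (auto intro: set_lebesgue_integral_eq_integral(1))
    have "integral {0..T} (\<lambda>t. s *\<^sub>R (opt_u a t \<bullet> (C t *v X t \<omega>)) + opt_u a' t \<bullet> (C t *v X t \<omega>)) =
        s * integral {0..T} (\<lambda>t. opt_u a t \<bullet> (C t *v X t \<omega>)) + integral {0..T} (\<lambda>t. opt_u a' t \<bullet> (C t *v X t \<omega>))"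
      by (subst Henstock_Kurzweil_Integration.integral_add[OF integrable_cmul[OF i] i]) simp
    moreover have "(\<lambda>t. opt_u (s *\<^sub>R a + a') t \<bullet> (C t *v X t \<omega>)) =
        (\<lambda>t. s *\<^sub>R (opt_u a t \<bullet> (C t *v X t \<omega>)) + opt_u a' t \<bullet> (C t *v X t \<omega>))"
      by (simp add: lin inner_add_left)
    ultimately show ?case using elim(1-3) by (simp add: distrib_left)
  qed
qed

text \<open>A stochastic integral is determined only up to null sets, so the linear dependence on \<open>a\<close> has to be
  carried through the finite sum one term at a time.\<close>

lemma ito_expand:
  "AE \<omega> in M. ito (opt_u (\<Sum>i\<in>K. (a $ i) *\<^sub>R axis i 1)) \<omega> = (\<Sum>i\<in>K. a $ i * ito (opt_u (axis i 1)) \<omega>)"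
  if "finite K"
  using that
proof (induction K rule: finite_induct)
  case empty
  have "AE \<omega> in M. ito (opt_u (1 *\<^sub>R 0 + 0)) \<omega> = 1 * ito (opt_u 0) \<omega> + ito (opt_u 0) \<omega>" by (rule ito_linear)
  then show ?case by simp
next
  case (insert i K)
  show ?case
    using insert.IH ito_linear[of "a $ i" "axis i 1" "\<Sum>i\<in>K. (a $ i) *\<^sub>R axis i 1"]
    by eventually_elim (use insert.hyps in simp)
qed

lemma row_opt_u: "(\<lambda>t. row i (transpose (\<Phi> t T) ** kalman_gain C R \<Sigma> t)) = opt_u (axis i 1)"
proof
  fix t
  show "row i (transpose (\<Phi> t T) ** kalman_gain C R \<Sigma> t) = opt_u (axis i 1) t"
    by (simp add: opt_u_def Kt_def row_def vec_eq_iff matrix_matrix_mult_def transpose_def matrix_vector_mult_basis column_def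
        matrix_vector_mult_def[of "\<chi> i j. kalman_gain C R \<Sigma> t $ j $ i"] mult.commute)
qed

lemma estimator_componentwise:
  "AE \<omega> in M. S_est (\<Phi> 0 T *v a) (P *v a) (opt_u a) \<omega> =
     a \<bullet> (transpose (\<Phi> 0 T) *v m0 + transpose P *v (Xbar0 \<omega> - m0) +
          (\<chi> i. ito (\<lambda>t. row i (transpose (\<Phi> t T) ** kalman_gain C R \<Sigma> t)) \<omega>))"
proof -
  have "(\<Sum>i\<in>UNIV. (a $ i) *\<^sub>R axis i 1) = a"
    using basis_expansion[of a] by (simp add: scalar_mult_eq_scaleR)
  then have "AE \<omega> in M. ito (opt_u a) \<omega> = (\<Sum>i\<in>UNIV. a $ i * ito (opt_u (axis i 1)) \<omega>)"
    using ito_expand[of UNIV a] by simp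
  then show ?thesis
  proof eventually_elim
    case (elim \<omega>)
    have tr: "(S *v a) \<bullet> x = a \<bullet> (transpose S *v x)" for S :: "real^'d^'d" and x
      by (simp only: inner_matrix_vector transpose_transpose)
    show ?case
      unfolding row_opt_u estimator_def inner_add_right tr elim
      by (simp add: inner_vec_def[of a "\<chi> i. ito (opt_u (axis i 1)) \<omega>"] del: transpose_matrix_vector)
  qed
qed

end

lemma vec_card_one:
  fixes c c' :: "real^'d"
  assumes card: "CARD('d) = 1" and S: "posdef S" and eq: "c \<bullet> (S *v c) = c' \<bullet> (S *v c')"
  shows "c = c' \<or> c = - c'"
proof -
  obtain i :: 'd where i: "UNIV = {i}" using card by (metis card_1_singletonE)
  have v: "v = (v $ i) *\<^sub>R axis i 1" for v :: "real^'d"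
    using i by (auto simp: vec_eq_iff axis_def) 
  define k where "k = axis i 1 \<bullet> (S *v (axis i 1))"
  have "k > 0" unfolding k_def using S by (auto simp: posdef_def axis_eq_0_iff)
  moreover have "v \<bullet> (S *v v) = (v $ i)\<^sup>2 * k" for v
    by (subst (1 2) v) (simp add: matrix_vector_mult_scaleR power2_eq_square k_def)
  ultimately have "(c $ i)\<^sup>2 = (c' $ i)\<^sup>2" using eq by simp
  then have "c $ i = c' $ i \<or> c $ i = - c' $ i" by (simp add: power2_eq_iff)
  then show ?thesis using v[of c] v[of c'] by (metis scaleR_minus_left)
qed

text \<open>Any vector on the ellipsoid that lies on a coordinate axis other than one on which \<open>c'\<close> has a nonzero
  entry will do.\<close>

lemma vec_card_many:
  fixes c' :: "real^'d"
  assumes card: "CARD('d) > 1" and S: "posdef S" and c': "c' \<noteq> 0"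
  shows "\<exists>c. c \<bullet> (S *v c) = c' \<bullet> (S *v c') \<and> c \<noteq> c' \<and> c \<noteq> - c'"
proof -
  obtain i where i: "c' $ i \<noteq> 0" using c' by (auto simp: vec_eq_iff)
  obtain j where j: "j \<noteq> i"
  proof -
    have "UNIV \<noteq> {i}" using card by (metis One_nat_def card.empty card_insert_disjoint empty_iff finite.emptyI less_irrefl)
    then show ?thesis using that by auto
  qed
  \<comment> \<open>a vector on another axis, to be scaled onto the ellipsoid\<close>
  define w where "w = (axis j 1 :: real^'d)"
  have w: "w \<bullet> (S *v w) > 0" using S by (auto simp: posdef_def w_def axis_eq_0_iff)
  have k: "c' \<bullet> (S *v c') \<ge> 0" by (rule posdef_nonneg[OF S])
  define r where "r = sqrt (c' \<bullet> (S *v c') / (w \<bullet> (S *v w)))"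
  have r: "r\<^sup>2 = c' \<bullet> (S *v c') / (w \<bullet> (S *v w))" unfolding r_def using k w by (intro real_sqrt_pow2) simp
  define c where "c = r *\<^sub>R w"
  have "c \<bullet> (S *v c) = r\<^sup>2 * (w \<bullet> (S *v w))"
    by (simp add: c_def matrix_vector_mult_scaleR power2_eq_square)
  then have "c \<bullet> (S *v c) = c' \<bullet> (S *v c')" using w r by simp
  moreover have "c $ i = 0" using j by (simp add: c_def w_def axis_def)
  ultimately show ?thesis using i by (intro exI[of _ c]) auto
qed

theorem theorem1:
  fixes M :: "'a measure"
    and A :: "real \<Rightarrow> real ^ 'd ^ 'd" and C :: "real \<Rightarrow> real ^ 'd ^ 'm"
    and Q :: "real \<Rightarrow> real ^ 'd ^ 'd" and R :: "real \<Rightarrow> real ^ 'm ^ 'm"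
    and \<Sigma> :: "real \<Rightarrow> real ^ 'd ^ 'd"
    and \<Phi> \<Psi> :: "real \<Rightarrow> real \<Rightarrow> real ^ 'd ^ 'd"
    and B X :: "real \<Rightarrow> 'a \<Rightarrow> real ^ 'd" and W Z :: "real \<Rightarrow> 'a \<Rightarrow> real ^ 'm"
    and Xbar0 :: "'a \<Rightarrow> real ^ 'd"
    and m0 a b\<^sub>T c\<^sub>T :: "real ^ 'd" and u :: "real \<Rightarrow> real ^ 'm" and T :: real
  assumes "prob_space M"
    and A_cont: "continuous_on {0..} A" and C_cont: "continuous_on {0..} C"
    and Q_pos: "\<And>t. 0 \<le> t \<Longrightarrow> posdef (Q t)" and R_pos: "\<And>t. 0 \<le> t \<Longrightarrow> posdef (R t)"
    and Sigma0_pos: "posdef (\<Sigma> 0)"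
    and B: "wiener_process M B Q" and W: "wiener_process M W R"
    and X0: "gaussian_vector M (X 0) m0 (\<Sigma> 0)"
    and Xbar0: "gaussian_vector M Xbar0 m0 (\<Sigma> 0)"
    and indep: "prob_space.indep_sets M
      (nth [sets (vimage_algebra (space M) (X 0) borel),
            sets (vimage_algebra (space M) Xbar0 borel),
            sets (generated_algebra M B {0..}),
            sets (generated_algebra M W {0..})]) {..<4}"
    and X_meas: "\<And>t. 0 \<le> t \<Longrightarrow> X t \<in> borel_measurable M"
    and Z_meas: "\<And>t. 0 \<le> t \<Longrightarrow> Z t \<in> borel_measurable M"
    and X_eq: "AE \<omega> in M. continuous_on {0..} (\<lambda>t. X t \<omega>) \<and>
      (\<forall>t\<ge>0. X t \<omega> = X 0 \<omega> + integral {0..t} (\<lambda>s. A s *v X s \<omega>) + B t \<omega>)"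
    and Z_eq: "AE \<omega> in M. \<forall>t\<ge>0. Z t \<omega> = integral {0..t} (\<lambda>s. C s *v X s \<omega>) + W t \<omega>"
    and Sigma: "riccati_solution A C Q R \<Sigma>"
    and Phi: "transition_matrix
      (\<lambda>t. - transpose (A t) + transpose (C t) ** transpose (kalman_gain C R \<Sigma> t)) \<Phi>"
    and Psi: "transition_matrix
      (\<lambda>t. - transpose (A t) + (1/2) *\<^sub>R (transpose (C t) ** transpose (kalman_gain C R \<Sigma> t))
           - (1/2) *\<^sub>R (matrix_inv (\<Sigma> t) ** Q t)) \<Psi>"
    and T_pos: "0 < T"
    and b_eq: "b\<^sub>T = \<Phi> 0 T *v a"
    and c_eq: "c\<^sub>T = \<Psi> 0 T *v a"
    and u_eq: "u = (\<lambda>t. transpose (kalman_gain C R \<Sigma> t) *v (\<Phi> t T *v a))"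
  shows
    "bi_objective_solution M C R X W Z Xbar0 m0 T a b\<^sub>T c\<^sub>T u \<and>
     (CARD('d) = 1 \<longrightarrow>
       {c. \<exists>b v. bi_objective_solution M C R X W Z Xbar0 m0 T a b c v} = {c\<^sub>T, - c\<^sub>T}) \<and>
     (CARD('d) > 1 \<and> a \<noteq> 0 \<longrightarrow>
       \<not> {c. \<exists>b v. bi_objective_solution M C R X W Z Xbar0 m0 T a b c v} \<subseteq> {c\<^sub>T, - c\<^sub>T}) \<and>
     (AE \<omega> in M. estimator M C R X W Xbar0 m0 T b\<^sub>T c\<^sub>T u \<omega> =
       a \<bullet> (transpose (\<Phi> 0 T) *v m0 + transpose (\<Psi> 0 T) *v (Xbar0 \<omega> - m0) +
            (\<chi> i. ito_integral M (\<lambda>t \<omega>. C t *v X t \<omega>) W R T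
                    (\<lambda>t. row i (transpose (\<Phi> t T) ** kalman_gain C R \<Sigma> t)) \<omega>))) \<and>
     (\<forall>g. smooth g \<longrightarrow>
       (AE \<omega> in M.
         real_cond_exp M (generated_algebra M Z {0..T})
           (\<lambda>\<omega>. g (estimator M C R X W Xbar0 m0 T b\<^sub>T c\<^sub>T u \<omega>)) \<omega> =
         real_cond_exp M (generated_algebra M Z {0..T}) (\<lambda>\<omega>. g (a \<bullet> X T \<omega>)) \<omega>))"
proof -
  interpret prob_space M by fact
  interpret K: kalman_bucy_model A C Q R \<Sigma> \<Phi> M B X W Z Xbar0 m0 T
  proof unfold_locales
    show "\<And>t. 0 \<le> t \<Longrightarrow> Q absolutely_integrable_on {0..t}" "\<And>t. 0 \<le> t \<Longrightarrow> R absolutely_integrable_on {0..t}"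
      using B W by (auto simp: wiener_process_def)
  qed (fact A_cont C_cont Q_pos R_pos Sigma0_pos Sigma Phi B W X0 Xbar0 indep X_meas Z_meas X_eq Z_eq T_pos)+
  have T0: "0 \<le> T" using T_pos by simp
  have u: "u = K.opt_u a" by (simp add: u_eq fun_eq_iff K.opt_u_def K.Kt_def)
  have cT: "c\<^sub>T \<bullet> (\<Sigma> 0 *v c\<^sub>T) = a \<bullet> (\<Sigma> T *v a)"
    unfolding c_eq by (rule K.Psi_energy[OF Psi T0])
  have sol: "bi_objective_solution M C R X W Z Xbar0 m0 T a b\<^sub>T c u" if "c \<bullet> (\<Sigma> 0 *v c) = a \<bullet> (\<Sigma> T *v a)" for c
    unfolding b_eq u by (rule K.solution_if_variance[OF that])
  have var: "c \<bullet> (\<Sigma> 0 *v c) = a \<bullet> (\<Sigma> T *v a)" if "bi_objective_solution M C R X W Z Xbar0 m0 T a b c v" for b c v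
    by (rule K.variance_if_solution[OF that cT])
  have negform: "(- c\<^sub>T) \<bullet> (\<Sigma> 0 *v (- c\<^sub>T)) = a \<bullet> (\<Sigma> T *v a)"
    using cT matrix_vector_mult_diff_distrib[of "\<Sigma> 0" 0 c\<^sub>T] by simp
  show ?thesis
  proof (intro conjI impI allI)
    show "bi_objective_solution M C R X W Z Xbar0 m0 T a b\<^sub>T c\<^sub>T u" by (rule sol[OF cT])
    show "{c. \<exists>b v. bi_objective_solution M C R X W Z Xbar0 m0 T a b c v} = {c\<^sub>T, - c\<^sub>T}" if card: "CARD('d) = 1"
    proof (intro equalityI subsetI)
      fix c assume "c \<in> {c. \<exists>b v. bi_objective_solution M C R X W Z Xbar0 m0 T a b c v}"
      then have "c \<bullet> (\<Sigma> 0 *v c) = c\<^sub>T \<bullet> (\<Sigma> 0 *v c\<^sub>T)" using var cT by auto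
      then show "c \<in> {c\<^sub>T, - c\<^sub>T}" using vec_card_one[OF card Sigma0_pos] by blast
    qed (use sol[OF cT] sol[OF negform] in auto)
    show "\<not> {c. \<exists>b v. bi_objective_solution M C R X W Z Xbar0 m0 T a b c v} \<subseteq> {c\<^sub>T, - c\<^sub>T}"
      if card: "CARD('d) > 1 \<and> a \<noteq> 0"
    proof -
      have "a \<bullet> (\<Sigma> T *v a) > 0" using K.Sigma_pos[OF T0] card by (simp add: posdef_def)
      then have "c\<^sub>T \<noteq> 0" using cT by auto
      then obtain c where "c \<bullet> (\<Sigma> 0 *v c) = c\<^sub>T \<bullet> (\<Sigma> 0 *v c\<^sub>T)" "c \<noteq> c\<^sub>T" "c \<noteq> - c\<^sub>T"
        using vec_card_many[OF _ Sigma0_pos] card by blast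
      then show ?thesis using sol[of c] cT by auto
    qed
    show "AE \<omega> in M. estimator M C R X W Xbar0 m0 T b\<^sub>T c\<^sub>T u \<omega> =
       a \<bullet> (transpose (\<Phi> 0 T) *v m0 + transpose (\<Psi> 0 T) *v (Xbar0 \<omega> - m0) +
            (\<chi> i. ito_integral M (\<lambda>t \<omega>. C t *v X t \<omega>) W R T
                    (\<lambda>t. row i (transpose (\<Phi> t T) ** kalman_gain C R \<Sigma> t)) \<omega>))"
      unfolding b_eq c_eq u by (rule K.estimator_componentwise)
    fix g :: "real \<Rightarrow> real" assume "smooth g"
    then have "g differentiable_on UNIV" unfolding smooth_def by (metis funpow_0)
    then have "g \<in> borel_measurable borel"
      by (intro borel_measurable_continuous_onI differentiable_imp_continuous_on)
    then show "AE \<omega> in M.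
         real_cond_exp M (generated_algebra M Z {0..T})
           (\<lambda>\<omega>. g (estimator M C R X W Xbar0 m0 T b\<^sub>T c\<^sub>T u \<omega>)) \<omega> =
         real_cond_exp M (generated_algebra M Z {0..T}) (\<lambda>\<omega>. g (a \<bullet> X T \<omega>)) \<omega>"
      unfolding b_eq u by (intro K.estimator_exact cT)
  qed
qed


end
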